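(* Let $R>0$ and let $f\in A(R\mathcal{D}_0(\mathbb{C});R\mathcal{D}_0(\mathbb{C}))$. Let $\theta=\mathrm{id}_{\mathbb{C}}$ be the linear functional on $\mathbb{C}$ with $\theta(1)=1$. The following conditions are equivalent: (1) there exists $g\in A(R\mathcal{D}_0(\mathbb{C}))$ such that $\partial g=f$; (2) $(\partial\otimes\mathrm{id})f=(\mathrm{id}\otimes\partial)f$; (3) $(\partial\circ\partial_\theta^* )f=N_{\theta,2}f$.
   Context: For $R>0$, $R\mathcal{D}_0(\mathbb{C})=(R\mathcal{D}_0(\mathbb{C})_n)_{n\ge1}$ with $R\mathcal{D}_0(\mathbb{C})_n=\{\omega\in M_n(\mathbb{C}):\|\omega\|<R\}$ (operator norm). Put $\Omega:=R\mathcal{D}_0(\mathbb{C})$. $A(\Omega)$ is the unital algebra of stably matricial analytic $\mathbb{C}$-valued functions on $\Omega$: families $f=(f_n)_{n\ge1}$ of analytic maps $f_n:\Omega_n\to M_n(\mathbb{C})$ such that $f_{m+n}(\omega\oplus\omega')=f_m(\omega)\oplus f_n(\omega')$ and such that $f_n(\omega')=sf_n(\omega)s^{-1}$ whenever $\omega,\omega'\in\Omega_n$, $s\in GL_n(\mathbb{C})$, $\omega'=s\omega s^{-1}$. For $k\geq 2$, the $k$-fold space $A(\Omega;\dots;\Omega)$ consists of families of analytic maps $f_{n_1;\dots;n_k}:\Omega_{n_1}\times\cdots\times\Omega_{n_k}\to M_{n_1}(\mathbb{C})\otimes\cdots\otimes M_{n_k}(\mathbb{C})$ satisfying these two properties in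 each variable separately (other variables fixed; direct sum and conjugation act on the corresponding tensor leg). Each such function extends uniquely to a function with the same properties on $\widetilde\Omega$, $\widetilde\Omega_n=\bigcup_{s\in GL_n(\mathbb{C})}s\Omega_ns^{-1}$; the operators below are defined through this extension and then restricted to $\Omega$. Let $e^{(m,n)}_{b,c}\in M_{m,n}(\mathbb{C})$ and $e^{(n)}_{c,d}\in M_n(\mathbb{C})$ denote matrix units. $\partial:A(\Omega)\to A(\Omega;\Omega)$ is $$(\partial f)_{m;n}(\omega;\omega')=\sum_{1\le a,b\le m,\ 1\le c,d\le n}\Big(\tfrac{d}{d\epsilon}f_{m+n}\big(\left[\begin{smallmatrix}\omega&\epsilon e^{(m,n)}_{b,c}\\0&\omega'\end{smallmatrix}\right]\big)\big|_{\epsilon=0}\Big)_{(a,m+d)}e^{(m)}_{a,b}\otimes e^{(n)}_{c,d}.$$ $\partial\otimes\mathrm{id},\ \mathrm{id}\otimes\partial:A(\Omega;\Omega)\to A(\Omega;\Omega;\Omega)$ are the same construction applied in the first, respectively second, variable: $$((\partial\otimes\mathrm{id})f)_{m;n;l}(\omega;\omega';\omega'')=\sum\Big(\tfrac{d}{d\epsilon}f_{m+n;l}\big(\left[\begin{smallmatrix}\omega&\epsilon e^{(m,n)}_{b,c}\\0&\omega'\end{smallmatrix}\right];\omega''\big)\big|_{\epsilon=0}\Big)_{(a,m+d)(e,f)}e^{(m)}_{a,b}\otimes e^{(n)}_{c,d}\otimes e^{(l)}_{e,f},$$ $$((\mathrm{id}\otimes\partial)f)_{l;m;n}(\omega'';\omega;\omega')=\sum\Big(\tfrac{d}{d\epsilon}f_{l;m+n}\big(\omega'';\left[\begin{smallmatrix}\omega&\epsilon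 e^{(m,n)}_{b,c}\\0&\omega'\end{smallmatrix}\right]\big)\big|_{\epsilon=0}\Big)_{(e,f)(a,m+d)}e^{(l)}_{e,f}\otimes e^{(m)}_{a,b}\otimes e^{(n)}_{c,d},$$ where the sums run over $1\le a,b\le m$, $1\le c,d\le n$, $1\le e,f\le l$, and $(T)_{(i,j)(p,q)}$ is the coefficient of $e_{i,j}\otimes e_{p,q}$ in $T$. $z(\theta)\in A(\Omega)$ is $z(\theta)_n(\omega)=\omega$. With $(a\otimes c)\#b:=abc$, $\partial_\theta^*:A(\Omega;\Omega)\to A(\Omega)$ is $(\partial_\theta^*f)_n(\omega)=f_{n;n}(\omega;\omega)\#\omega$. With $(a\otimes b\otimes c)\#_{1,2}x=axb\otimes c$ and $(a\otimes b\otimes c)\#_{2,3}x=a\otimes bxc$, the maps $\partial_\theta^*\otimes\mathrm{id},\ \mathrm{id}\otimes\partial_\theta^*:A(\Omega;\Omega;\Omega)\to A(\Omega;\Omega)$ are $((\partial_\theta^*\otimes\mathrm{id})f)_{m;n}(\omega;\omega')=f_{m;m;n}(\omega;\omega;\omega')\#_{1,2}\omega$ and $((\mathrm{id}\otimes\partial_\theta^* )f)_{m;n}(\omega;\omega')=f_{m;n;n}(\omega;\omega';\omega')\#_{2,3}\omega'$. Finally $N_\theta\otimes\mathrm{id}=(\partial_\theta^*\otimes\mathrm{id})\circ(\partial\otimes\mathrm{id})$, $\mathrm{id}\otimes N_\theta=(\mathrm{id}\otimes\partial_\theta^* )\circ(\mathrm{id}\otimes\partial)$, and $N_{\theta,2}=N_\theta\otimes\mathrm{id}+\mathrm{id}\otimes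 N_\theta+\mathrm{id}$ on $A(\Omega;\Omega)$. *)

theory Defs
  imports "HOL-Analysis.Derivative" "HOL-Analysis.L2_Norm" "Jordan_Normal_Form.Matrix"
begin

section \<open>Matrices of varying size\<close>

definition op_norm :: "complex mat \<Rightarrow> real" where
  "op_norm A = Sup {L2_set (\<lambda>i. cmod (vec_index (A *\<^sub>v v) i)) {..<dim_row A} | v.
     v \<in> carrier_vec (dim_col A) \<and> L2_set (\<lambda>j. cmod (vec_index v j)) {..<dim_col A} \<le> 1}"

text \<open>A family indexed by the sizes \<open>n \<ge> 1\<close> is a function on \<open>nat\<close>. The value of the domain at
  \<open>n = 0\<close> is the empty set, so that quantification over its points only sees \<open>n \<ge> 1\<close>.\<close>

definition RD0 :: "real \<Rightarrow> nat \<Rightarrow> complex mat set" where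
  "RD0 R n = {\<omega> \<in> carrier_mat n n. n \<ge> 1 \<and> op_norm \<omega> < R}"

definition dir_sum :: "complex mat \<Rightarrow> complex mat \<Rightarrow> complex mat" where
  "dir_sum A B = four_block_mat A (0\<^sub>m (dim_row A) (dim_col B)) (0\<^sub>m (dim_row B) (dim_col A)) B"

text \<open>All matrix indices start at 0, as usual for the type \<open>mat\<close>.\<close>

definition matrix_unit :: "nat \<Rightarrow> nat \<Rightarrow> nat \<Rightarrow> nat \<Rightarrow> complex mat" where
  "matrix_unit m n b c = mat m n (\<lambda>x. if x = (b, c) then 1 else 0)"

definition upper_block ::
  "nat \<Rightarrow> nat \<Rightarrow> complex mat \<Rightarrow> complex mat \<Rightarrow> nat \<Rightarrow> nat \<Rightarrow> complex \<Rightarrow> complex mat" where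
  "upper_block m n \<omega> \<omega>' b c \<epsilon> =
     four_block_mat \<omega> (\<epsilon> \<cdot>\<^sub>m matrix_unit m n b c) (0\<^sub>m n m) \<omega>'"


section \<open>Tensor products of matrix algebras\<close>

text \<open>An element \<open>T\<close> of \<open>M\<^sub>m \<otimes> M\<^sub>n\<close> is given by its coordinates in the basis
  \<open>e\<^sub>i\<^sub>j \<otimes> e\<^sub>p\<^sub>q\<close>: the value \<open>T (i,j) (p,q)\<close> is the coefficient of that basis element,
  and \<open>T\<close> vanishes at all index pairs that are out of range. The same applies to three factors.\<close>

type_synonym ten2 = "nat \<times> nat \<Rightarrow> nat \<times> nat \<Rightarrow> complex"
type_synonym ten3 = "nat \<times> nat \<Rightarrow> nat \<times> nat \<Rightarrow> nat \<times> nat \<Rightarrow> complex"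

definition idx :: "nat \<Rightarrow> (nat \<times> nat) set" where
  "idx n = {..<n} \<times> {..<n}"

definition tens2 :: "nat \<Rightarrow> nat \<Rightarrow> ten2 set" where
  "tens2 m n = {T. \<forall>x y. x \<notin> idx m \<or> y \<notin> idx n \<longrightarrow> T x y = 0}"

definition mk2 :: "nat \<Rightarrow> nat \<Rightarrow> ten2 \<Rightarrow> ten2" where
  "mk2 m n T = (\<lambda>x y. if x \<in> idx m \<and> y \<in> idx n then T x y else 0)"

definition mk3 :: "nat \<Rightarrow> nat \<Rightarrow> nat \<Rightarrow> ten3 \<Rightarrow> ten3" where
  "mk3 m n l T = (\<lambda>x y z. if x \<in> idx m \<and> y \<in> idx n \<and> z \<in> idx l then T x y z else 0)"

text \<open>With \<open>T = (\<Sum>\<^sub>y T\<^sub>y \<otimes> e\<^sub>y)\<close>, the matrix \<open>T\<^sub>y\<close> is \<open>leg1 m T y\<close>. A linear map acts on the first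
  tensor leg of \<open>T\<close> by acting on each \<open>T\<^sub>y\<close>; similarly for the second leg.\<close>

definition leg1 :: "nat \<Rightarrow> ten2 \<Rightarrow> nat \<times> nat \<Rightarrow> complex mat" where
  "leg1 m T y = mat m m (\<lambda>x. T x y)"

definition leg2 :: "nat \<Rightarrow> ten2 \<Rightarrow> nat \<times> nat \<Rightarrow> complex mat" where
  "leg2 n T x = mat n n (\<lambda>y. T x y)"

definition conj_leg1 :: "nat \<Rightarrow> nat \<Rightarrow> complex mat \<Rightarrow> complex mat \<Rightarrow> ten2 \<Rightarrow> ten2" where
  "conj_leg1 m n s t T = mk2 m n (\<lambda>x y. (s * leg1 m T y * t) $$ x)"

definition conj_leg2 :: "nat \<Rightarrow> nat \<Rightarrow> complex mat \<Rightarrow> complex mat \<Rightarrow> ten2 \<Rightarrow> ten2" where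
  "conj_leg2 m n s t T = mk2 m n (\<lambda>x y. (s * leg2 n T x * t) $$ y)"

definition dsum_leg1 :: "nat \<Rightarrow> nat \<Rightarrow> nat \<Rightarrow> ten2 \<Rightarrow> ten2 \<Rightarrow> ten2" where
  "dsum_leg1 m m' n T T' = mk2 (m + m') n (\<lambda>x y. dir_sum (leg1 m T y) (leg1 m' T' y) $$ x)"

definition dsum_leg2 :: "nat \<Rightarrow> nat \<Rightarrow> nat \<Rightarrow> ten2 \<Rightarrow> ten2 \<Rightarrow> ten2" where
  "dsum_leg2 m n n' T T' = mk2 m (n + n') (\<lambda>x y. dir_sum (leg2 n T x) (leg2 n' T' x) $$ y)"

text \<open>The linear extensions of \<open>(a \<otimes> c) # b = a b c\<close>, of \<open>(a \<otimes> b \<otimes> c) #\<^sub>1\<^sub>2 x = a x b \<otimes> c\<close>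
  and of \<open>(a \<otimes> b \<otimes> c) #\<^sub>2\<^sub>3 x = a \<otimes> b x c\<close>; see the lemmas on pure tensors below.\<close>

definition hash :: "nat \<Rightarrow> ten2 \<Rightarrow> complex mat \<Rightarrow> complex mat" where
  "hash n T b = mat n n (\<lambda>(i, q). \<Sum>j<n. \<Sum>p<n. T (i, j) (p, q) * b $$ (j, p))"

definition hash12 :: "nat \<Rightarrow> nat \<Rightarrow> ten3 \<Rightarrow> complex mat \<Rightarrow> ten2" where
  "hash12 m n T b = mk2 m n (\<lambda>x z. hash m (\<lambda>u v. T u v z) b $$ x)"

definition hash23 :: "nat \<Rightarrow> nat \<Rightarrow> ten3 \<Rightarrow> complex mat \<Rightarrow> ten2" where
  "hash23 m n T b = mk2 m n (\<lambda>x z. hash n (\<lambda>u v. T x u v) b $$ z)"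

definition pure2 :: "nat \<Rightarrow> nat \<Rightarrow> complex mat \<Rightarrow> complex mat \<Rightarrow> ten2" where
  "pure2 m n A B = mk2 m n (\<lambda>x y. A $$ x * B $$ y)"

definition pure3 :: "nat \<Rightarrow> nat \<Rightarrow> nat \<Rightarrow> complex mat \<Rightarrow> complex mat \<Rightarrow> complex mat \<Rightarrow> ten3" where
  "pure3 m n l A B C = mk3 m n l (\<lambda>x y z. A $$ x * B $$ y * C $$ z)"


section \<open>Stably matricial analytic functions\<close>

text \<open>Analyticity of a scalar function on an open set of matrices (or of pairs of matrices) is
  complex differentiability at each of its points. The derivative is a complex linear form in the
  matrix entries; a matrix valued or tensor valued map is analytic if its coordinates are.\<close>

definition cdiff1 :: "nat \<Rightarrow> (complex mat \<Rightarrow> complex) \<Rightarrow> complex mat \<Rightarrow> bool" where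
  "cdiff1 n F \<omega> \<longleftrightarrow> (\<exists>D. \<forall>e>0. \<exists>\<delta>>0. \<forall>h \<in> carrier_mat n n. op_norm h < \<delta> \<longrightarrow>
     cmod (F (\<omega> + h) - F \<omega> - (\<Sum>x\<in>idx n. D x * h $$ x)) \<le> e * op_norm h)"

definition cdiff2 ::
  "nat \<Rightarrow> nat \<Rightarrow> (complex mat \<Rightarrow> complex mat \<Rightarrow> complex) \<Rightarrow> complex mat \<Rightarrow> complex mat \<Rightarrow> bool" where
  "cdiff2 m n F \<omega> \<omega>' \<longleftrightarrow> (\<exists>D D'. \<forall>e>0. \<exists>\<delta>>0. \<forall>h \<in> carrier_mat m m. \<forall>h' \<in> carrier_mat n n.
     op_norm h < \<delta> \<and> op_norm h' < \<delta> \<longrightarrow>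
     cmod (F (\<omega> + h) (\<omega>' + h') - F \<omega> \<omega>'
           - ((\<Sum>x\<in>idx m. D x * h $$ x) + (\<Sum>y\<in>idx n. D' y * h' $$ y)))
       \<le> e * (op_norm h + op_norm h'))"

type_synonym fam1 = "nat \<Rightarrow> complex mat \<Rightarrow> complex mat"
type_synonym fam2 = "nat \<Rightarrow> nat \<Rightarrow> complex mat \<Rightarrow> complex mat \<Rightarrow> ten2"
type_synonym fam3 = "nat \<Rightarrow> nat \<Rightarrow> nat \<Rightarrow> complex mat \<Rightarrow> complex mat \<Rightarrow> complex mat \<Rightarrow> ten3"

text \<open>Here \<open>similar_mat_wit \<omega>' \<omega> s t\<close> says that \<open>t\<close> is the inverse of \<open>s\<close> and \<open>\<omega>' = s \<omega> s\<^sup>-\<^sup>1\<close>.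
  Values of a family outside its domain are irrelevant; the domain \<open>\<Omega>\<close> is meant to be
  an open set of square matrices for each size and closed under direct sums, as \<open>RD0 R\<close> is.\<close>

definition A1 :: "(nat \<Rightarrow> complex mat set) \<Rightarrow> fam1 set" where
  "A1 \<Omega> = {f.
     (\<forall>n. \<forall>\<omega>\<in>\<Omega> n. f n \<omega> \<in> carrier_mat n n) \<and>
     (\<forall>n. \<forall>\<omega>\<in>\<Omega> n. \<forall>x\<in>idx n. cdiff1 n (\<lambda>w. f n w $$ x) \<omega>) \<and>
     (\<forall>m n. \<forall>\<omega>\<in>\<Omega> m. \<forall>\<omega>'\<in>\<Omega> n. f (m + n) (dir_sum \<omega> \<omega>') = dir_sum (f m \<omega>) (f n \<omega>')) \<and>
     (\<forall>n. \<forall>\<omega>\<in>\<Omega> n. \<forall>\<omega>'\<in>\<Omega> n. \<forall>s t. similar_mat_wit \<omega>' \<omega> s t \<longrightarrow> f n \<omega>' = s * f n \<omega> * t)}"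

definition A2 :: "(nat \<Rightarrow> complex mat set) \<Rightarrow> fam2 set" where
  "A2 \<Omega> = {f.
     (\<forall>m n. \<forall>\<omega>\<in>\<Omega> m. \<forall>\<eta>\<in>\<Omega> n. f m n \<omega> \<eta> \<in> tens2 m n) \<and>
     (\<forall>m n. \<forall>\<omega>\<in>\<Omega> m. \<forall>\<eta>\<in>\<Omega> n. \<forall>x\<in>idx m. \<forall>y\<in>idx n. cdiff2 m n (\<lambda>w w'. f m n w w' x y) \<omega> \<eta>) \<and>
     (\<forall>m m' n. \<forall>\<omega>\<in>\<Omega> m. \<forall>\<omega>'\<in>\<Omega> m'. \<forall>\<eta>\<in>\<Omega> n.
        f (m + m') n (dir_sum \<omega> \<omega>') \<eta> = dsum_leg1 m m' n (f m n \<omega> \<eta>) (f m' n \<omega>' \<eta>)) \<and>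
     (\<forall>m n n'. \<forall>\<omega>\<in>\<Omega> m. \<forall>\<eta>\<in>\<Omega> n. \<forall>\<eta>'\<in>\<Omega> n'.
        f m (n + n') \<omega> (dir_sum \<eta> \<eta>') = dsum_leg2 m n n' (f m n \<omega> \<eta>) (f m n' \<omega> \<eta>')) \<and>
     (\<forall>m n. \<forall>\<omega>\<in>\<Omega> m. \<forall>\<omega>'\<in>\<Omega> m. \<forall>\<eta>\<in>\<Omega> n. \<forall>s t. similar_mat_wit \<omega>' \<omega> s t \<longrightarrow>
        f m n \<omega>' \<eta> = conj_leg1 m n s t (f m n \<omega> \<eta>)) \<and>
     (\<forall>m n. \<forall>\<omega>\<in>\<Omega> m. \<forall>\<eta>\<in>\<Omega> n. \<forall>\<eta>'\<in>\<Omega> n. \<forall>s t. similar_mat_wit \<eta>' \<eta> s t \<longrightarrow>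
        f m n \<omega> \<eta>' = conj_leg2 m n s t (f m n \<omega> \<eta>))}"

text \<open>The unique extension to the similarity saturation of the domain: the value at
  \<open>s \<omega> s\<^sup>-\<^sup>1\<close> with \<open>\<omega> \<in> \<Omega>\<^sub>n\<close> is \<open>s f\<^sub>n(\<omega>) s\<^sup>-\<^sup>1\<close>, independently of the choice of \<open>\<omega>\<close> and \<open>s\<close>.\<close>

definition ext1 :: "(nat \<Rightarrow> complex mat set) \<Rightarrow> fam1 \<Rightarrow> fam1" where
  "ext1 \<Omega> f n \<omega>' =
     (THE A. \<exists>\<omega>\<in>\<Omega> n. \<exists>s t. similar_mat_wit \<omega>' \<omega> s t \<and> A = s * f n \<omega> * t)"

definition ext2 :: "(nat \<Rightarrow> complex mat set) \<Rightarrow> fam2 \<Rightarrow> fam2" where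
  "ext2 \<Omega> f m n \<omega>' \<eta>' =
     (THE T. \<exists>\<omega>\<in>\<Omega> m. \<exists>\<eta>\<in>\<Omega> n. \<exists>s t u v. similar_mat_wit \<omega>' \<omega> s t \<and> similar_mat_wit \<eta>' \<eta> u v \<and>
        T = conj_leg1 m n s t (conj_leg2 m n u v (f m n \<omega> \<eta>)))"

text \<open>Equality of elements of \<open>A(\<Omega>;\<Omega>)\<close> and of \<open>A(\<Omega>;\<Omega>;\<Omega>)\<close>, i.e. as functions on the domain.\<close>

definition eq2 :: "(nat \<Rightarrow> complex mat set) \<Rightarrow> fam2 \<Rightarrow> fam2 \<Rightarrow> bool" where
  "eq2 \<Omega> F G \<longleftrightarrow> (\<forall>m n. \<forall>\<omega>\<in>\<Omega> m. \<forall>\<omega>'\<in>\<Omega> n. F m n \<omega> \<omega>' = G m n \<omega> \<omega>')"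

definition eq3 :: "(nat \<Rightarrow> complex mat set) \<Rightarrow> fam3 \<Rightarrow> fam3 \<Rightarrow> bool" where
  "eq3 \<Omega> F G \<longleftrightarrow> (\<forall>m n l. \<forall>\<omega>\<in>\<Omega> m. \<forall>\<omega>'\<in>\<Omega> n. \<forall>\<omega>''\<in>\<Omega> l. F m n l \<omega> \<omega>' \<omega>'' = G m n l \<omega> \<omega>' \<omega>'')"


section \<open>The operators\<close>

text \<open>The difference quotient derivation \<open>\<partial>\<close> and its amplifications \<open>\<partial> \<otimes> id\<close> and \<open>id \<otimes> \<partial>\<close>.\<close>

definition del :: "(nat \<Rightarrow> complex mat set) \<Rightarrow> fam1 \<Rightarrow> fam2" where
  "del \<Omega> f m n \<omega> \<omega>' = mk2 m n (\<lambda>(a, b) (c, d).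
     deriv (\<lambda>\<epsilon>. ext1 \<Omega> f (m + n) (upper_block m n \<omega> \<omega>' b c \<epsilon>) $$ (a, m + d)) 0)"

definition del_id :: "(nat \<Rightarrow> complex mat set) \<Rightarrow> fam2 \<Rightarrow> fam3" where
  "del_id \<Omega> f m n l \<omega> \<omega>' \<omega>'' = mk3 m n l (\<lambda>(a, b) (c, d) x.
     deriv (\<lambda>\<epsilon>. ext2 \<Omega> f (m + n) l (upper_block m n \<omega> \<omega>' b c \<epsilon>) \<omega>'' (a, m + d) x) 0)"

definition id_del :: "(nat \<Rightarrow> complex mat set) \<Rightarrow> fam2 \<Rightarrow> fam3" where
  "id_del \<Omega> f l m n \<omega>'' \<omega> \<omega>' = mk3 l m n (\<lambda>x (a, b) (c, d).
     deriv (\<lambda>\<epsilon>. ext2 \<Omega> f l (m + n) \<omega>'' (upper_block m n \<omega> \<omega>' b c \<epsilon>) x (a, m + d)) 0)"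

text \<open>The operators \<open>\<partial>\<^sub>\<theta>\<^sup>*\<close> for \<open>\<theta> = id\<close>, for which \<open>z(\<theta>)\<^sub>n(\<omega>) = \<omega>\<close>.\<close>

definition z_theta :: fam1 where
  "z_theta n \<omega> = \<omega>"

definition del_star :: "fam2 \<Rightarrow> fam1" where
  "del_star f n \<omega> = hash n (f n n \<omega> \<omega>) (z_theta n \<omega>)"

definition del_star_id :: "fam3 \<Rightarrow> fam2" where
  "del_star_id f m n \<omega> \<omega>' = hash12 m n (f m m n \<omega> \<omega> \<omega>') (z_theta m \<omega>)"

definition id_del_star :: "fam3 \<Rightarrow> fam2" where
  "id_del_star f m n \<omega> \<omega>' = hash23 m n (f m n n \<omega> \<omega>' \<omega>') (z_theta n \<omega>')"

definition N_id :: "(nat \<Rightarrow> complex mat set) \<Rightarrow> fam2 \<Rightarrow> fam2" where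
  "N_id \<Omega> f = del_star_id (del_id \<Omega> f)"

definition id_N :: "(nat \<Rightarrow> complex mat set) \<Rightarrow> fam2 \<Rightarrow> fam2" where
  "id_N \<Omega> f = id_del_star (id_del \<Omega> f)"

definition N2 :: "(nat \<Rightarrow> complex mat set) \<Rightarrow> fam2 \<Rightarrow> fam2" where
  "N2 \<Omega> f m n \<omega> \<omega>' =
     (\<lambda>x y. N_id \<Omega> f m n \<omega> \<omega>' x y + id_N \<Omega> f m n \<omega> \<omega>' x y + f m n \<omega> \<omega>' x y)"


section \<open>The coordinate formulas on pure tensors, and the extension on the original domain\<close>

lemma hash_pure2:
  assumes "A \<in> carrier_mat n n" "B \<in> carrier_mat n n" "C \<in> carrier_mat n n"
  shows "hash n (pure2 n n A C) B = A * B * C"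
proof (rule eq_matI)
  fix i q assume "i < dim_row (A * B * C)" "q < dim_col (A * B * C)"
  then have iq: "i < n" "q < n" using assms by auto
  have "(A * B * C) $$ (i, q) = (\<Sum>p<n. (\<Sum>j<n. A $$ (i, j) * B $$ (j, p)) * C $$ (p, q))"
    using assms iq
    by (auto simp: scalar_prod_def lessThan_atLeast0 simp del: assoc_mult_mat intro!: sum.cong)
  also have "\<dots> = (\<Sum>j<n. \<Sum>p<n. A $$ (i, j) * C $$ (p, q) * B $$ (j, p))"
    unfolding sum_distrib_right by (subst sum.swap) (intro sum.cong refl, simp)
  finally show "hash n (pure2 n n A C) B $$ (i, q) = (A * B * C) $$ (i, q)"
    using iq by (simp add: hash_def pure2_def mk2_def idx_def)
qed (use assms in \<open>auto simp: hash_def\<close>)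

lemma hash_smult: "hash n (\<lambda>u v. T u v * c) b = c \<cdot>\<^sub>m hash n T b"
  by (rule eq_matI) (auto simp: hash_def sum_distrib_left mult_ac)

lemma hash12_pure3:
  assumes "A \<in> carrier_mat m m" "B \<in> carrier_mat m m" "C \<in> carrier_mat n n" "X \<in> carrier_mat m m"
  shows "hash12 m n (pure3 m m n A B C) X = pure2 m n (A * X * B) C"
proof (intro ext)
  fix x z
  show "hash12 m n (pure3 m m n A B C) X x z = pure2 m n (A * X * B) C x z"
  proof (cases "x \<in> idx m \<and> z \<in> idx n")
    case True
    then have "(\<lambda>u v. pure3 m m n A B C u v z) = (\<lambda>u v. pure2 m m A B u v * C $$ z)"
      by (auto simp: pure3_def pure2_def mk3_def mk2_def fun_eq_iff)
    then show ?thesis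
      using True assms
      by (auto simp: hash12_def hash_smult hash_pure2 mk2_def[of m n] pure2_def[of m n] idx_def
          simp del: assoc_mult_mat)
  qed (auto simp: hash12_def pure2_def mk2_def)
qed

lemma hash23_pure3:
  assumes "A \<in> carrier_mat m m" "B \<in> carrier_mat n n" "C \<in> carrier_mat n n" "X \<in> carrier_mat n n"
  shows "hash23 m n (pure3 m n n A B C) X = pure2 m n A (B * X * C)"
proof (intro ext)
  fix x z
  show "hash23 m n (pure3 m n n A B C) X x z = pure2 m n A (B * X * C) x z"
  proof (cases "x \<in> idx m \<and> z \<in> idx n")
    case True
    then have "(\<lambda>u v. pure3 m n n A B C x u v) = (\<lambda>u v. pure2 n n B C u v * A $$ x)"
      by (auto simp: pure3_def pure2_def mk3_def mk2_def fun_eq_iff)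
    then show ?thesis
      using True assms
      by (auto simp: hash23_def hash_smult hash_pure2 mk2_def[of m n] pure2_def[of m n] idx_def
          simp del: assoc_mult_mat)
  qed (auto simp: hash23_def pure2_def mk2_def)
qed

lemma conj_leg1_pure2:
  assumes "A \<in> carrier_mat m m" "s \<in> carrier_mat m m" "t \<in> carrier_mat m m"
  shows "conj_leg1 m n s t (pure2 m n A B) = pure2 m n (s * A * t) B"
proof (intro ext)
  fix x y
  show "conj_leg1 m n s t (pure2 m n A B) x y = pure2 m n (s * A * t) B x y"
  proof (cases "x \<in> idx m \<and> y \<in> idx n")
    case True
    then have "leg1 m (pure2 m n A B) y = (B $$ y) \<cdot>\<^sub>m A"
      using assms by (auto simp: leg1_def pure2_def mk2_def idx_def intro!: eq_matI)
    moreover have "s * ((B $$ y) \<cdot>\<^sub>m A) * t = (B $$ y) \<cdot>\<^sub>m (s * A * t)"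
      using assms by (simp add: mult_smult_distrib[of _ m m _ m] mult_smult_assoc_mat[of _ m m _ m])
    ultimately show ?thesis
      using True assms by (auto simp: conj_leg1_def pure2_def mk2_def idx_def)
  qed (auto simp: conj_leg1_def pure2_def mk2_def)
qed

lemma conj_leg2_pure2:
  assumes "B \<in> carrier_mat n n" "s \<in> carrier_mat n n" "t \<in> carrier_mat n n"
  shows "conj_leg2 m n s t (pure2 m n A B) = pure2 m n A (s * B * t)"
proof (intro ext)
  fix x y
  show "conj_leg2 m n s t (pure2 m n A B) x y = pure2 m n A (s * B * t) x y"
  proof (cases "x \<in> idx m \<and> y \<in> idx n")
    case True
    then have "leg2 n (pure2 m n A B) x = (A $$ x) \<cdot>\<^sub>m B"
      using assms by (auto simp: leg2_def pure2_def mk2_def idx_def intro!: eq_matI)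
    moreover have "s * ((A $$ x) \<cdot>\<^sub>m B) * t = (A $$ x) \<cdot>\<^sub>m (s * B * t)"
      using assms by (simp add: mult_smult_distrib[of _ n n _ n] mult_smult_assoc_mat[of _ n n _ n])
    ultimately show ?thesis
      using True assms by (auto simp: conj_leg2_def pure2_def mk2_def idx_def)
  qed (auto simp: conj_leg2_def pure2_def mk2_def)
qed

lemma ext1_eq:
  assumes f: "f \<in> A1 \<Omega>" and w: "\<omega> \<in> \<Omega> n" "\<omega> \<in> carrier_mat n n"
  shows "ext1 \<Omega> f n \<omega> = f n \<omega>"
proof -
  have "similar_mat_wit \<omega> \<omega> (1\<^sub>m n) (1\<^sub>m n)"
    using w by (auto simp: similar_mat_wit_def Let_def)
  moreover have "f n \<omega> = 1\<^sub>m n * f n \<omega> * 1\<^sub>m n"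
  proof -
    have "f n \<omega> \<in> carrier_mat n n" using f w(1) unfolding A1_def by blast
    then show ?thesis by simp
  qed
  ultimately have 1: "\<exists>\<omega>'\<in>\<Omega> n. \<exists>s t. similar_mat_wit \<omega> \<omega>' s t \<and> f n \<omega> = s * f n \<omega>' * t"
    using w(1) by blast
  have 2: "A = f n \<omega>" if A: "\<exists>\<omega>'\<in>\<Omega> n. \<exists>s t. similar_mat_wit \<omega> \<omega>' s t \<and> A = s * f n \<omega>' * t" for A
  proof -
    have "\<forall>n. \<forall>\<omega>\<in>\<Omega> n. \<forall>\<omega>'\<in>\<Omega> n. \<forall>s t. similar_mat_wit \<omega>' \<omega> s t \<longrightarrow> f n \<omega>' = s * f n \<omega> * t"
      using f unfolding A1_def by blast
    then show ?thesis using A w(1) by metis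
  qed
  show ?thesis
    unfolding ext1_def by (rule the_equality, rule 1, rule 2)
qed

end

theory Submission
  imports
    Defs
    "HOL-Computational_Algebra.Formal_Power_Series"
    "HOL-Complex_Analysis.Cauchy_Integral_Formula"
    "Jordan_Normal_Form.Jordan_Normal_Form_Existence"
begin

text \<open>
  Every element of \<open>A(\<Omega>)\<close> is a matrix power series \<open>\<Sum>\<^sub>k c\<^sub>k \<omega>\<^sup>k\<close>, and every element \<open>f\<close> of
  \<open>A(\<Omega>;\<Omega>)\<close> is a double series \<open>\<Sum>\<^sub>k\<^sub>l a\<^sub>k\<^sub>l \<omega>\<^sup>k \<otimes> \<eta>\<^sup>l\<close>
  (\<open>A1_power_series\<close>, \<open>A2_power_series\<close>). In one variable the coefficients are those of the
  holomorphic function given by the matrices of size 1: compatibility with direct sums and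
  similarities forces the formula on diagonalizable matrices, and these are dense. In two variables
  the one-variable result is applied to each leg in turn.

  On such series the operators act term by term. The difference quotient sends \<open>z\<^sup>k\<close> to
  \<open>\<Sum>\<^sub>i\<^sub><\<^sub>k z\<^sup>i \<otimes> z\<^sup>k\<^sup>-\<^sup>1\<^sup>-\<^sup>i\<close>; the contraction \<open>\<partial>\<^sub>\<theta>\<^sup>*\<close> sends \<open>z\<^sup>k \<otimes> z\<^sup>l\<close> to
  \<open>z\<^sup>k\<^sup>+\<^sup>l\<^sup>+\<^sup>1\<close>; hence \<open>N\<^sub>\<theta>\<^sub>,\<^sub>2\<close> multiplies \<open>z\<^sup>k \<otimes> z\<^sup>l\<close>
  by \<open>k + l + 1\<close>. Each of the three conditions then says that \<open>a\<^sub>k\<^sub>l\<close> depends only on \<open>k + l\<close>: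
  (1) reads \<open>a\<^sub>k\<^sub>l = g\<^sub>k\<^sub>+\<^sub>l\<^sub>+\<^sub>1\<close>, (2) reads \<open>a\<^sub>k\<^sub>+\<^sub>1\<^sub>,\<^sub>l = a\<^sub>k\<^sub>,\<^sub>l\<^sub>+\<^sub>1\<close>, and (3) says
  that \<open>(k + l + 1) a\<^sub>k\<^sub>l\<close> is the sum of all coefficients of the same total degree
  (\<open>range_del_iff_hankel\<close>, \<open>coassoc_iff_hankel\<close>, \<open>number_operator_iff_hankel\<close>). In (1), the
  solution is \<open>g(\<omega>) = \<omega> f(\<omega>; 0)\<close>, which visibly lies in \<open>A(\<Omega>)\<close>.

  Coefficients are extracted by evaluating at scaled nilpotent shifts, whose powers have a corner
  entry in exactly one degree, so that only one term of the series survives.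
\<close>

section \<open>The operator norm\<close>

text \<open>The Euclidean norm of a vector.\<close>

abbreviation vnorm :: "complex vec \<Rightarrow> real" where
  "vnorm v \<equiv> L2_set (\<lambda>i. cmod (vec_index v i)) {..<dim_vec v}"

lemma sum_lessThan_add:
  "sum f {..<m + n :: nat} = sum f {..<m} + (\<Sum>i<n. f (m + i))"
  by (induction n) (auto simp: add.assoc)

lemma mult_mat_vec_index:
  assumes "A \<in> carrier_mat m n" "v \<in> carrier_vec n" "i < m"
  shows "vec_index (A *\<^sub>v v) i = (\<Sum>j<n. A $$ (i, j) * vec_index v j)"
  using assms by (auto simp: scalar_prod_def lessThan_atLeast0 intro!: sum.cong)

lemma mult_mat_index:
  assumes "A \<in> carrier_mat m n" "B \<in> carrier_mat n l" "i < m" "j < l"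
  shows "(A * B) $$ (i, j) = (\<Sum>p<n. A $$ (i, p) * B $$ (p, j))"
  using assms by (auto simp: scalar_prod_def lessThan_atLeast0 intro!: sum.cong)

lemma cmod_index_le_vnorm: "i < dim_vec v \<Longrightarrow> cmod (vec_index v i) \<le> vnorm v"
  using member_le_L2_set[of "{..<dim_vec v}" i "\<lambda>i. cmod (vec_index v i)"] by simp

lemma vnorm_mult_le_sum:
  assumes A: "A \<in> carrier_mat m n" and v: "v \<in> carrier_vec n" "vnorm v \<le> 1"
  shows "vnorm (A *\<^sub>v v) \<le> (\<Sum>i<m. \<Sum>j<n. cmod (A $$ (i, j)))"
proof -
  have "cmod (vec_index (A *\<^sub>v v) i) \<le> (\<Sum>j<n. cmod (A $$ (i, j)))" if "i < m" for i
  proof -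
    have "cmod (vec_index v j) \<le> 1" if "j < n" for j
      using cmod_index_le_vnorm[of j v] v that by auto
    then show ?thesis
      unfolding mult_mat_vec_index[OF A v(1) that]
      by (intro order_trans[OF norm_sum] sum_mono) (auto simp: norm_mult intro!: mult_left_le)
  qed
  then have "(\<Sum>i<m. cmod (vec_index (A *\<^sub>v v) i)) \<le> (\<Sum>i<m. \<Sum>j<n. cmod (A $$ (i, j)))"
    by (intro sum_mono) auto
  moreover have "vnorm (A *\<^sub>v v) \<le> (\<Sum>i<m. cmod (vec_index (A *\<^sub>v v) i))"
    using A by (auto intro: order_trans[OF L2_set_le_sum])
  ultimately show ?thesis by linarith
qed

lemma op_norm_alt:
  assumes "A \<in> carrier_mat m n"
  shows "op_norm A = Sup {vnorm (A *\<^sub>v v) | v. v \<in> carrier_vec n \<and> vnorm v \<le> 1}"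
proof -
  have "dim_row A = m" "dim_col A = n" using assms by auto
  moreover have "L2_set (\<lambda>j. cmod (vec_index v j)) {..<n} = vnorm v" if "v \<in> carrier_vec n" for v
    using that by simp
  ultimately show ?thesis
    unfolding op_norm_def by (intro arg_cong[where f = Sup] Collect_cong) auto
qed

lemma op_norm_leI:
  assumes A: "A \<in> carrier_mat m n"
    and le: "\<And>v. v \<in> carrier_vec n \<Longrightarrow> vnorm v \<le> 1 \<Longrightarrow> vnorm (A *\<^sub>v v) \<le> c"
  shows "op_norm A \<le> c"
proof -
  have "vnorm (0\<^sub>v n) \<le> 1" by (simp add: L2_set_def)
  then have "{vnorm (A *\<^sub>v v) | v. v \<in> carrier_vec n \<and> vnorm v \<le> 1} \<noteq> {}"
    using zero_carrier_vec[of n] by blast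
  then show ?thesis
    unfolding op_norm_alt[OF A] by (rule cSup_least) (use le in auto)
qed

lemma op_norm_le_sum:
  assumes A: "A \<in> carrier_mat m n"
  shows "op_norm A \<le> (\<Sum>i<m. \<Sum>j<n. cmod (A $$ (i, j)))"
  by (rule op_norm_leI[OF A]) (rule vnorm_mult_le_sum[OF A])

lemma vnorm_le_op_norm:
  assumes A: "A \<in> carrier_mat m n" and v: "v \<in> carrier_vec n" "vnorm v \<le> 1"
  shows "vnorm (A *\<^sub>v v) \<le> op_norm A"
proof -
  have "bdd_above {vnorm (A *\<^sub>v v) | v. v \<in> carrier_vec n \<and> vnorm v \<le> 1}"
    by (rule bdd_aboveI[of _ "\<Sum>i<m. \<Sum>j<n. cmod (A $$ (i, j))"])
      (use vnorm_mult_le_sum[OF A] in blast)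
  then show ?thesis
    unfolding op_norm_alt[OF A] by (intro cSup_upper) (use v in blast)
qed

lemma op_norm_nonneg:
  assumes A: "A \<in> carrier_mat m n"
  shows "0 \<le> op_norm A"
  by (rule order_trans[OF L2_set_nonneg vnorm_le_op_norm[OF A, of "0\<^sub>v n"]]) (auto simp: L2_set_def)

lemma vnorm_smult: "vnorm (c \<cdot>\<^sub>v v) = cmod c * vnorm v"
proof -
  have "vnorm (c \<cdot>\<^sub>v v) = L2_set (\<lambda>i. cmod c * cmod (vec_index v i)) {..<dim_vec v}"
    by (auto simp: norm_mult intro!: L2_set_cong)
  then show ?thesis by (simp add: L2_set_right_distrib)
qed

lemma vnorm_eq_0: "v \<in> carrier_vec n \<Longrightarrow> vnorm v = 0 \<Longrightarrow> v = 0\<^sub>v n"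
  by (intro eq_vecI) (auto simp: L2_set_eq_0_iff)

lemma vnorm_mult_le:
  assumes A: "A \<in> carrier_mat m n" and v: "v \<in> carrier_vec n"
  shows "vnorm (A *\<^sub>v v) \<le> op_norm A * vnorm v"
proof (cases "vnorm v = 0")
  case True
  then have "v = 0\<^sub>v n" using vnorm_eq_0 v by blast
  moreover have "A *\<^sub>v 0\<^sub>v n = 0\<^sub>v m" using A by (intro eq_vecI) auto
  ultimately show ?thesis using A by (simp add: L2_set_def)
next
  case False
  then have pos: "vnorm v > 0" by (simp add: order_less_le L2_set_nonneg)
  define c where "c = complex_of_real (1 / vnorm v)"
  have c: "cmod c = 1 / vnorm v" using pos by (simp add: c_def norm_divide)
  have "vnorm (c \<cdot>\<^sub>v v) = 1" unfolding vnorm_smult c using pos by simp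
  then have "vnorm (A *\<^sub>v (c \<cdot>\<^sub>v v)) \<le> op_norm A"
    using v by (intro vnorm_le_op_norm[OF A]) auto
  then have "cmod c * vnorm (A *\<^sub>v v) \<le> op_norm A"
    using A v by (simp only: mult_mat_vec[OF A v] vnorm_smult)
  then show ?thesis using pos c by (simp add: field_simps)
qed

lemma cmod_index_le_op_norm:
  assumes A: "A \<in> carrier_mat m n" and ij: "i < m" "j < n"
  shows "cmod (A $$ (i, j)) \<le> op_norm A"
proof -
  have u: "unit_vec n j \<in> carrier_vec n" by simp
  have "vnorm (unit_vec n j :: complex vec) = sqrt (\<Sum>i<n. if i = j then 1 else 0)"
    unfolding L2_set_def using ij by (intro arg_cong[where f = sqrt] sum.cong) (auto simp: unit_vec_def)
  then have n1: "vnorm (unit_vec n j) \<le> 1" using ij by simp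
  have "vec_index (A *\<^sub>v unit_vec n j) i = (\<Sum>p<n. A $$ (i, p) * (if p = j then 1 else 0))"
    unfolding mult_mat_vec_index[OF A u ij(1)] using ij by (intro sum.cong) (auto simp: unit_vec_def)
  also have "\<dots> = A $$ (i, j)" using ij by (simp add: if_distrib cong: if_cong)
  finally show ?thesis
    using cmod_index_le_vnorm[of i "A *\<^sub>v unit_vec n j"] vnorm_le_op_norm[OF A u n1] A ij by auto
qed

lemma op_norm_mult:
  assumes A: "A \<in> carrier_mat m n" and B: "B \<in> carrier_mat n l"
  shows "op_norm (A * B) \<le> op_norm A * op_norm B"
proof (rule op_norm_leI)
  show "A * B \<in> carrier_mat m l" using A B by simp
  fix v :: "complex vec" assume v: "v \<in> carrier_vec l" "vnorm v \<le> 1"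
  have "vnorm (A * B *\<^sub>v v) = vnorm (A *\<^sub>v (B *\<^sub>v v))"
    using assoc_mult_mat_vec[OF A B v(1)] by simp
  also have "\<dots> \<le> op_norm A * vnorm (B *\<^sub>v v)"
    using B v by (intro vnorm_mult_le[OF A]) auto
  also have "\<dots> \<le> op_norm A * op_norm B"
    by (intro mult_left_mono vnorm_le_op_norm[OF B v] op_norm_nonneg[OF A])
  finally show "vnorm (A * B *\<^sub>v v) \<le> op_norm A * op_norm B" .
qed

lemma op_norm_add:
  assumes A: "A \<in> carrier_mat m n" and B: "B \<in> carrier_mat m n"
  shows "op_norm (A + B) \<le> op_norm A + op_norm B"
proof (rule op_norm_leI)
  show "A + B \<in> carrier_mat m n" using A B by simp
  fix v :: "complex vec" assume v: "v \<in> carrier_vec n" "vnorm v \<le> 1"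
  have "vnorm ((A + B) *\<^sub>v v) = vnorm (A *\<^sub>v v + B *\<^sub>v v)"
    using add_mult_distrib_mat_vec[OF A B v(1)] by simp
  also have "\<dots> = L2_set (\<lambda>i. cmod (vec_index (A *\<^sub>v v) i + vec_index (B *\<^sub>v v) i)) {..<m}"
    using A B by (auto intro!: L2_set_cong)
  also have "\<dots> \<le> L2_set (\<lambda>i. cmod (vec_index (A *\<^sub>v v) i) + cmod (vec_index (B *\<^sub>v v) i)) {..<m}"
    by (intro L2_set_mono norm_triangle_ineq) auto
  also have "\<dots> \<le> vnorm (A *\<^sub>v v) + vnorm (B *\<^sub>v v)"
    using L2_set_triangle_ineq[of _ _ "{..<m}"] A B by auto
  also have "\<dots> \<le> op_norm A + op_norm B"
    by (intro add_mono vnorm_le_op_norm[OF A v] vnorm_le_op_norm[OF B v])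
  finally show "vnorm ((A + B) *\<^sub>v v) \<le> op_norm A + op_norm B" .
qed

lemma op_norm_smult:
  assumes A: "A \<in> carrier_mat m n"
  shows "op_norm (c \<cdot>\<^sub>m A) \<le> cmod c * op_norm A"
proof (rule op_norm_leI)
  show "c \<cdot>\<^sub>m A \<in> carrier_mat m n" using A by simp
  fix v :: "complex vec" assume v: "v \<in> carrier_vec n" "vnorm v \<le> 1"
  have "(c \<cdot>\<^sub>m A) *\<^sub>v v = c \<cdot>\<^sub>v (A *\<^sub>v v)" using A v by (intro eq_vecI) auto
  then have "vnorm ((c \<cdot>\<^sub>m A) *\<^sub>v v) = cmod c * vnorm (A *\<^sub>v v)" using vnorm_smult by metis
  also have "\<dots> \<le> cmod c * op_norm A"
    by (intro mult_left_mono vnorm_le_op_norm[OF A v]) auto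
  finally show "vnorm ((c \<cdot>\<^sub>m A) *\<^sub>v v) \<le> cmod c * op_norm A" .
qed

lemma op_norm_zero: "op_norm (0\<^sub>m m n) = 0"
  using op_norm_le_sum[of "0\<^sub>m m n" m n] op_norm_nonneg[of "0\<^sub>m m n" m n] by auto

lemma op_norm_mat_diag:
  assumes "\<And>i. i < n \<Longrightarrow> cmod (d i) \<le> r" "0 \<le> r"
  shows "op_norm (mat_diag n d) \<le> r"
proof (rule op_norm_leI)
  show "mat_diag n d \<in> carrier_mat n n" by simp
  fix v :: "complex vec" assume v: "v \<in> carrier_vec n" "vnorm v \<le> 1"
  have "vec_index (mat_diag n d *\<^sub>v v) i = d i * vec_index v i" if "i < n" for i
  proof -
    have "vec_index (mat_diag n d *\<^sub>v v) i = (\<Sum>j<n. mat_diag n d $$ (i, j) * vec_index v j)"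
      by (rule mult_mat_vec_index[OF _ v(1) that]) simp
    also have "\<dots> = (\<Sum>j<n. if j = i then d i * vec_index v i else 0)"
      using that by (intro sum.cong) (auto simp: mat_diag_def)
    finally show ?thesis using that by simp
  qed
  then have "vnorm (mat_diag n d *\<^sub>v v) = L2_set (\<lambda>i. cmod (d i) * cmod (vec_index v i)) {..<n}"
    by (auto simp: mat_diag_def norm_mult intro!: L2_set_cong)
  also have "\<dots> \<le> L2_set (\<lambda>i. r * cmod (vec_index v i)) {..<n}"
    using assms by (intro L2_set_mono mult_right_mono) auto
  also have "\<dots> = r * vnorm v" using v assms by (simp add: L2_set_right_distrib)
  also have "\<dots> \<le> r * 1" by (rule mult_left_mono[OF v(2) assms(2)])
  finally show "vnorm (mat_diag n d *\<^sub>v v) \<le> r" by simp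
qed

lemma op_norm_pow:
  assumes A: "A \<in> carrier_mat n n"
  shows "op_norm (A ^\<^sub>m k) \<le> op_norm A ^ k"
proof (induction k)
  case 0
  show ?case using A op_norm_mat_diag[of n "\<lambda>_. 1" 1] by simp
next
  case (Suc k)
  have "op_norm (A ^\<^sub>m Suc k) \<le> op_norm (A ^\<^sub>m k) * op_norm A"
    using op_norm_mult[of "A ^\<^sub>m k" n n A n] A by simp
  also have "\<dots> \<le> op_norm A ^ k * op_norm A"
    by (intro mult_right_mono Suc op_norm_nonneg[OF A])
  finally show ?case by (simp add: mult.commute)
qed

lemma cmod_pow_index_le:
  assumes A: "A \<in> carrier_mat n n" and "i < n" "j < n"
  shows "cmod ((A ^\<^sub>m k) $$ (i, j)) \<le> op_norm A ^ k"
  using cmod_index_le_op_norm[of "A ^\<^sub>m k" n n i j] op_norm_pow[OF A, of k] assms by fastforce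

lemma eigenvalue_le_op_norm:
  assumes A: "A \<in> carrier_mat n n" and v: "v \<in> carrier_vec n" "v \<noteq> 0\<^sub>v n"
    and eig: "A *\<^sub>v v = c \<cdot>\<^sub>v v"
  shows "cmod c \<le> op_norm A"
proof -
  have "vnorm v > 0" using vnorm_eq_0[OF v(1)] v(2) by (auto simp: order_less_le L2_set_nonneg)
  moreover have "cmod c * vnorm v \<le> op_norm A * vnorm v"
    using vnorm_mult_le[OF A v(1)] unfolding eig vnorm_smult .
  ultimately show ?thesis by simp
qed

lemma dir_sum_carrier:
  "A \<in> carrier_mat m m \<Longrightarrow> B \<in> carrier_mat n n \<Longrightarrow> dir_sum A B \<in> carrier_mat (m + n) (m + n)"
  by (auto simp: dir_sum_def)

lemma op_norm_dir_sum:
  assumes A: "A \<in> carrier_mat m m" and B: "B \<in> carrier_mat n n"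
    and rA: "op_norm A \<le> r" and rB: "op_norm B \<le> r"
  shows "op_norm (dir_sum A B) \<le> r"
proof (rule op_norm_leI)
  have r0: "0 \<le> r" using op_norm_nonneg[OF A] rA by linarith
  show "dir_sum A B \<in> carrier_mat (m + n) (m + n)" by (rule dir_sum_carrier[OF A B])
  fix v :: "complex vec" assume v: "v \<in> carrier_vec (m + n)" "vnorm v \<le> 1"
  define u where "u = vec_first v m"
  define w where "w = vec_last v n"
  have u: "u \<in> carrier_vec m" and w: "w \<in> carrier_vec n" by (auto simp: u_def w_def)
  have vuw: "v = u @\<^sub>v w" using v by (simp add: u_def w_def)
  have sq: "(vnorm (x @\<^sub>v y))\<^sup>2 = (vnorm x)\<^sup>2 + (vnorm y)\<^sup>2" for x y :: "complex vec"
  proof -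
    have "(\<Sum>i<dim_vec x + dim_vec y. (cmod (vec_index (x @\<^sub>v y) i))\<^sup>2)
        = (\<Sum>i<dim_vec x. (cmod (vec_index x i))\<^sup>2) + (\<Sum>i<dim_vec y. (cmod (vec_index y i))\<^sup>2)"
      unfolding sum_lessThan_add by (intro arg_cong2[where f = "(+)"] sum.cong) auto
    then show ?thesis
      by (simp add: L2_set_def sum_nonneg)
  qed
  have "dir_sum A B *\<^sub>v v = (A *\<^sub>v u) @\<^sub>v (B *\<^sub>v w)"
    unfolding vuw dir_sum_def using A B u w
    by (simp add: mult_mat_vec_split)
  then have "(vnorm (dir_sum A B *\<^sub>v v))\<^sup>2 = (vnorm (A *\<^sub>v u))\<^sup>2 + (vnorm (B *\<^sub>v w))\<^sup>2"
    by (simp only: sq)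
  also have "\<dots> \<le> (r * vnorm u)\<^sup>2 + (r * vnorm w)\<^sup>2"
    using vnorm_mult_le[OF A u] vnorm_mult_le[OF B w] rA rB
    by (intro add_mono power_mono order_trans[OF vnorm_mult_le[OF A u]]
        order_trans[OF vnorm_mult_le[OF B w]] mult_right_mono) auto
  also have "\<dots> = (r * vnorm v)\<^sup>2"
    unfolding vuw by (simp only: power_mult_distrib sq distrib_left)
  finally have "vnorm (dir_sum A B *\<^sub>v v) \<le> r * vnorm v"
    using r0 by (auto intro: power2_le_imp_le)
  also have "\<dots> \<le> r * 1" by (rule mult_left_mono[OF v(2) r0])
  finally show "vnorm (dir_sum A B *\<^sub>v v) \<le> r" by simp
qed

section \<open>Diagonalizable matrices\<close>

lemma jordan_matrix_size_one:
  assumes "\<And>p. p \<in> set n_as \<Longrightarrow> fst p = 1"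
  shows "jordan_matrix n_as = mat_diag (length n_as) (\<lambda>i. snd (n_as ! i))"
  using assms
proof (induction n_as)
  case Nil
  show ?case by (intro eq_matI) (auto simp: jordan_matrix_def mat_diag_def)
next
  case (Cons p n_as)
  obtain a where p: "p = (1, a)" using Cons.prems[of p] by (cases p) auto
  have IH: "jordan_matrix n_as = mat_diag (length n_as) (\<lambda>i. snd (n_as ! i))"
    using Cons by auto
  have "sum_list (map fst n_as) = length n_as"
    using Cons.prems by (induction n_as) auto
  then show ?case
    unfolding p jordan_matrix_Cons IH
    by (intro eq_matI) (auto simp: mat_diag_def jordan_block_def nth_Cons')
qed

lemma order_prod_linear_le_1:
  assumes "distinct (as :: complex list)"
  shows "order x (\<Prod>a\<leftarrow>as. [:- a, 1:]) \<le> 1"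
  using assms
proof (induction as)
  case (Cons a as)
  have nz: "(\<Prod>a\<leftarrow>as. [:- a, 1:]) \<noteq> 0" by (auto simp: prod_list_zero_iff)
  have mult: "order x (\<Prod>a\<leftarrow>a # as. [:- a, 1:]) = order x [:- a, 1:] + order x (\<Prod>a\<leftarrow>as. [:- a, 1:])"
    using nz by (simp add: order_mult del: mult_pCons_left)
  show ?case
  proof (cases "x = a")
    case True
    have "poly (\<Prod>a\<leftarrow>as. [:- a, 1:]) x \<noteq> 0"
      using Cons.prems True by (auto simp: poly_prod_list prod_list_zero_iff)
    moreover have "order x [:- a, 1:] = 1"
      using order_power_n_n[of x 1] True by simp
    ultimately show ?thesis unfolding mult by (simp add: order_0I)
  next
    case False
    then have "order x [:- a, 1:] = 0" by (intro order_0I) simp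
    then show ?thesis unfolding mult using Cons by simp
  qed
qed simp

text \<open>Distinct diagonal entries are simple roots of the characteristic polynomial, so that all Jordan
  blocks have size 1.\<close>

lemma upper_triangular_distinct_diagonalizable:
  fixes A :: "complex mat"
  assumes A: "A \<in> carrier_mat n n" "upper_triangular A" and dist: "distinct (diag_mat A)"
  shows "\<exists>d s t. similar_mat_wit A (mat_diag n d) s t"
proof -
  have cp: "char_poly A = (\<Prod>a\<leftarrow>diag_mat A. [:- a, 1:])"
    by (rule char_poly_upper_triangular[OF A])
  obtain n_as where jnf: "jordan_nf A n_as" using jordan_nf_exists[OF A(1) cp] by blast
  have one: "fst p = 1" if p: "p \<in> set n_as" for p
  proof -
    have "fst p \<in> set (map fst (filter (\<lambda>na. snd na = snd p) n_as))" using p by auto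
    then have "fst p \<le> sum_list (map fst (filter (\<lambda>na. snd na = snd p) n_as))"
      by (rule member_le_sum_list) simp
    also have "\<dots> \<le> 1"
      using order_prod_linear_le_1[OF dist] unfolding cp[symmetric] jordan_nf_order[OF jnf] by simp
    finally have "fst p \<le> 1" .
    moreover have "fst p \<noteq> 0" using jnf p unfolding jordan_nf_def by force
    ultimately show ?thesis by simp
  qed
  obtain s t where w: "similar_mat_wit A (jordan_matrix n_as) s t"
    using jnf unfolding jordan_nf_def similar_mat_def by blast
  have J: "jordan_matrix n_as = mat_diag (length n_as) (\<lambda>i. snd (n_as ! i))"
    by (rule jordan_matrix_size_one) (rule one)
  have "jordan_matrix n_as \<in> carrier_mat n n" using similar_mat_witD2[OF A(1) w] by simp
  then have "length n_as = n" unfolding J by (auto simp: mat_diag_def)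
  then show ?thesis using w J by auto
qed

text \<open>Diagonalizable matrices are dense: every matrix is the limit, along a segment, of
  diagonalizable matrices.\<close>

lemma diagonalizable_perturbation:
  fixes \<omega> :: "complex mat"
  assumes \<omega>: "\<omega> \<in> carrier_mat n n"
  obtains K e0 where "K \<in> carrier_mat n n" "e0 > (0::real)"
    "\<And>e. 0 < e \<Longrightarrow> e < e0 \<Longrightarrow> \<exists>d s t. similar_mat_wit (\<omega> + of_real e \<cdot>\<^sub>m K) (mat_diag n d) s t"
proof -
  obtain as where "char_poly \<omega> = (\<Prod>a\<leftarrow>as. [:- a, 1:])"
    using char_poly_factorized[OF \<omega>] by blast
  then obtain n_as where jnf: "jordan_nf \<omega> n_as" using jordan_nf_exists[OF \<omega>] by blast
  define J where "J = jordan_matrix n_as"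
  obtain P Q where w: "similar_mat_wit \<omega> J P Q"
    using jnf unfolding jordan_nf_def similar_mat_def J_def by blast
  note wD = similar_mat_witD2[OF \<omega> w]
  have J: "J \<in> carrier_mat n n" and P: "P \<in> carrier_mat n n" and Q: "Q \<in> carrier_mat n n"
    and PQ: "P * Q = 1\<^sub>m n" "Q * P = 1\<^sub>m n" and \<omega>J: "\<omega> = P * J * Q"
    using wD by auto
  have ut: "J $$ (i, j) = 0" if "i < n" "j < i" for i j
  proof -
    have "sum_list (map fst n_as) = n" using J unfolding J_def by (auto dest: carrier_matD)
    then show ?thesis using that unfolding J_def by (intro jordan_matrix_upper_triangular) auto
  qed
  (* Adding e times diag(0, ..., n - 1) to the Jordan form makes its diagonal entries distinct, unless
     e lies in the finite set B below. *)
  define D where "D = (mat_diag n of_nat :: complex mat)"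
  have D: "D \<in> carrier_mat n n" by (simp add: D_def)
  define K where "K = P * D * Q"
  have K: "K \<in> carrier_mat n n" using P Q D by (simp add: K_def)
  define B where "B = (\<lambda>(i, k). Re ((J $$ (k, k) - J $$ (i, i)) / (of_nat i - of_nat k))) ` ({..<n} \<times> {..<n})"
  define e0 where "e0 = Min (insert 1 {b \<in> B. b > 0})"
  have fin: "finite (insert 1 {b \<in> B. b > 0})" by (simp add: B_def)
  have e0: "e0 > 0" unfolding e0_def using fin by (subst Min_gr_iff) auto
  have "\<exists>d s t. similar_mat_wit (\<omega> + of_real e \<cdot>\<^sub>m K) (mat_diag n d) s t" if e: "0 < e" "e < e0" for e
  proof -
    define T where "T = J + of_real e \<cdot>\<^sub>m D"
    have T: "T \<in> carrier_mat n n" using J D by (simp add: T_def)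
    have eB: "e \<notin> B"
    proof
      assume "e \<in> B"
      then have "e0 \<le> e" unfolding e0_def using e fin by (intro Min_le) auto
      then show False using e by simp
    qed
    have Tii: "T $$ (i, i) = J $$ (i, i) + of_real e * of_nat i" if "i < n" for i
      using that J D by (auto simp: T_def D_def mat_diag_def)
    have inj: "i = k" if ik: "i < n" "k < n" and eq: "T $$ (i, i) = T $$ (k, k)" for i k
    proof (rule ccontr)
      assume "i \<noteq> k"
      then have "(of_nat i - of_nat k :: complex) \<noteq> 0" by simp
      then have "(J $$ (k, k) - J $$ (i, i)) / (of_nat i - of_nat k) = complex_of_real e"
        using eq unfolding Tii[OF ik(1)] Tii[OF ik(2)] by (simp add: field_simps)
      then have "e = Re ((J $$ (k, k) - J $$ (i, i)) / (of_nat i - of_nat k))" by simp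
      then have "e \<in> B" unfolding B_def using ik by (auto intro!: image_eqI[of _ _ "(i, k)"])
      then show False using eB by simp
    qed
    have "distinct (diag_mat T)"
      using T inj by (auto simp: diag_mat_def distinct_map inj_on_def)
    moreover have "upper_triangular T"
      using T J D ut by (auto simp: upper_triangular_def T_def D_def mat_diag_def)
    ultimately obtain d s t where dst: "similar_mat_wit T (mat_diag n d) s t"
      using upper_triangular_distinct_diagonalizable[OF T] by blast
    have "\<omega> + of_real e \<cdot>\<^sub>m K = P * T * Q"
    proof -
      have "of_real e \<cdot>\<^sub>m K = P * (of_real e \<cdot>\<^sub>m D) * Q"
        unfolding K_def using P D Q
        by (simp add: mult_smult_distrib[of _ n n _ n] mult_smult_assoc_mat[of _ n n _ n])
      then show ?thesis
        unfolding \<omega>J T_def using P J D Q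
        by (simp add: mult_add_distrib_mat[of _ n n _ n] add_mult_distrib_mat[of _ n n _ _ n])
    qed
    then have "similar_mat_wit (\<omega> + of_real e \<cdot>\<^sub>m K) T P Q"
      using P Q T PQ K \<omega> by (auto simp: similar_mat_wit_def Let_def)
    then show ?thesis using similar_mat_wit_trans[OF _ dst] by blast
  qed
  then show thesis using that K e0 by blast
qed

lemma cmod_diagonal_le_op_norm:
  assumes w: "similar_mat_wit \<omega> (mat_diag n d) s t" and i: "i < n"
  shows "cmod (d i) \<le> op_norm \<omega>"
proof -
  have "dim_row \<omega> = n"
    using carrier_matD(1)[OF similar_mat_witD(5)[OF refl w]] carrier_matD(1)[OF mat_diag_dim[of n d]]
    by simp
  note D = similar_mat_witD[OF this[symmetric] w]
  have c: "\<omega> \<in> carrier_mat n n" "s \<in> carrier_mat n n" "t \<in> carrier_mat n n"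
    and ts: "t * s = 1\<^sub>m n" and om: "\<omega> = s * mat_diag n d * t"
    using D by blast+
  have "\<omega> * s = s * mat_diag n d * (t * s)"
    unfolding om by (rule assoc_mult_mat[of _ n n _ n _ n]) (use c in auto)
  then have \<omega>s: "\<omega> * s = s * mat_diag n d" unfolding ts using right_mult_one_mat[of "s * mat_diag n d" n n] c by simp
  have "\<omega> *\<^sub>v col s i = col (\<omega> * s) i" using c i by (simp add: col_mult2[of _ n n _ n])
  also have "\<dots> = d i \<cdot>\<^sub>v col s i"
    unfolding \<omega>s using c i by (intro eq_vecI) (auto simp: mat_diag_mult_right)
  finally have eig: "\<omega> *\<^sub>v col s i = d i \<cdot>\<^sub>v col s i" .
  have "col s i \<noteq> 0\<^sub>v n"
  proof
    assume 0: "col s i = 0\<^sub>v n"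
    have "col (t * s) i = t *\<^sub>v col s i" using c i by (simp add: col_mult2[of _ n n _ n])
    also have "\<dots> = 0\<^sub>v n" unfolding 0 using c by (intro eq_vecI) auto
    finally have "vec_index (col (1\<^sub>m n :: complex mat) i) i = 0" unfolding ts using i by simp
    then show False using i by simp
  qed
  then show ?thesis using c eig by (intro eigenvalue_le_op_norm[of \<omega> n "col s i"]) auto
qed

section \<open>Functions of one matrix variable as power series\<close>

lemma RD0_carrier: "\<omega> \<in> RD0 R n \<Longrightarrow> \<omega> \<in> carrier_mat n n"
  by (simp add: RD0_def)

lemma RD0_pos: "\<omega> \<in> RD0 R n \<Longrightarrow> 0 < n"
  by (simp add: RD0_def)

lemma RD0_norm: "\<omega> \<in> RD0 R n \<Longrightarrow> op_norm \<omega> < R"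
  by (simp add: RD0_def)

lemma mat_diag_in_RD0:
  assumes "n \<ge> 1" "\<And>i. i < n \<Longrightarrow> cmod (d i) < R"
  shows "mat_diag n d \<in> RD0 R n"
proof -
  define r where "r = Max ((\<lambda>i. cmod (d i)) ` {..<n})"
  have ne: "(\<lambda>i. cmod (d i)) ` {..<n} \<noteq> {}" "finite ((\<lambda>i. cmod (d i)) ` {..<n})"
    using assms(1) by (auto simp: lessThan_empty_iff)
  have le: "cmod (d i) \<le> r" if "i < n" for i
    unfolding r_def using ne that by (intro Max_ge) auto
  have "r < R" unfolding r_def using ne assms by (subst Max_less_iff) auto
  moreover have "0 \<le> r" using le[of 0] assms(1) by (auto intro: order_trans[OF norm_ge_zero])
  then have "op_norm (mat_diag n d) \<le> r" using le by (intro op_norm_mat_diag)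
  ultimately show ?thesis using assms(1) by (simp add: RD0_def)
qed

text \<open>The point of size 1 with entry \<open>z\<close>.\<close>

abbreviation mat1 :: "complex \<Rightarrow> complex mat" where
  "mat1 z \<equiv> mat_diag 1 (\<lambda>_. z)"

lemma op_norm_mat1: "op_norm (mat1 z) = cmod z"
proof (rule antisym)
  show "op_norm (mat1 z) \<le> cmod z" by (rule op_norm_mat_diag) auto
  show "cmod z \<le> op_norm (mat1 z)"
    using cmod_index_le_op_norm[of "mat1 z" 1 1 0 0] by (simp add: mat_diag_def)
qed

lemma mat1_in_RD0: "mat1 z \<in> RD0 R 1 \<longleftrightarrow> cmod z < R"
  by (simp add: RD0_def op_norm_mat1 del: One_nat_def)

lemma mat1_add: "mat1 z + mat1 w = mat1 (z + w)"
  by (intro eq_matI) (auto simp: mat_diag_def)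

lemma A1_carrier: "h \<in> A1 \<Omega> \<Longrightarrow> \<omega> \<in> \<Omega> n \<Longrightarrow> h n \<omega> \<in> carrier_mat n n"
  unfolding A1_def by blast

lemma A1_cdiff1: "h \<in> A1 \<Omega> \<Longrightarrow> \<omega> \<in> \<Omega> n \<Longrightarrow> x \<in> idx n \<Longrightarrow> cdiff1 n (\<lambda>w. h n w $$ x) \<omega>"
  unfolding A1_def by blast

lemma A1_dir_sum:
  "h \<in> A1 \<Omega> \<Longrightarrow> \<omega> \<in> \<Omega> m \<Longrightarrow> \<omega>' \<in> \<Omega> n \<Longrightarrow> h (m + n) (dir_sum \<omega> \<omega>') = dir_sum (h m \<omega>) (h n \<omega>')"
  unfolding A1_def by blast

lemma A1_similar:
  "h \<in> A1 \<Omega> \<Longrightarrow> \<omega> \<in> \<Omega> n \<Longrightarrow> \<omega>' \<in> \<Omega> n \<Longrightarrow> similar_mat_wit \<omega>' \<omega> s t \<Longrightarrow> h n \<omega>' = s * h n \<omega> * t"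
  unfolding A1_def by blast

lemma A1_mat_diag:
  assumes h: "h \<in> A1 (RD0 R)" and n: "n \<ge> 1" and d: "\<And>i. i < n \<Longrightarrow> cmod (d i) < R"
  shows "h n (mat_diag n d) = mat_diag n (\<lambda>i. h 1 (mat1 (d i)) $$ (0, 0))"
  using n d
proof (induction n rule: nat_induct_at_least)
  case base
  have "mat_diag 1 d = mat1 (d 0)" by (intro eq_matI) (auto simp: mat_diag_def)
  moreover have "h 1 (mat1 (d 0)) \<in> carrier_mat 1 1"
    using base by (intro A1_carrier[OF h]) (simp add: mat1_in_RD0 del: One_nat_def)
  ultimately show ?case by (intro eq_matI) (auto simp: mat_diag_def)
next
  case (Suc n)
  have split: "mat_diag (n + 1) e = dir_sum (mat_diag n e) (mat1 (e n))" for e :: "nat \<Rightarrow> complex"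
    by (intro eq_matI) (auto simp: mat_diag_def dir_sum_def less_Suc_eq)
  have last: "h 1 (mat1 (d n)) = mat1 (h 1 (mat1 (d n)) $$ (0, 0))"
  proof -
    have "h 1 (mat1 (d n)) \<in> carrier_mat 1 1"
      using Suc.prems by (intro A1_carrier[OF h]) (simp add: mat1_in_RD0 del: One_nat_def)
    then show ?thesis by (intro eq_matI) (auto simp: mat_diag_def)
  qed
  have "h (n + 1) (mat_diag (n + 1) d) = dir_sum (h n (mat_diag n d)) (h 1 (mat1 (d n)))"
    unfolding split using Suc
    by (intro A1_dir_sum[OF h] mat_diag_in_RD0) (auto simp: mat1_in_RD0 simp del: One_nat_def)
  also have "h n (mat_diag n d) = mat_diag n (\<lambda>i. h 1 (mat1 (d i)) $$ (0, 0))"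
    using Suc by simp
  also have "dir_sum \<dots> (h 1 (mat1 (d n))) = mat_diag (n + 1) (\<lambda>i. h 1 (mat1 (d i)) $$ (0, 0))"
    unfolding split by (subst last) (rule refl)
  finally show ?case by simp
qed

text \<open>A differentiable function is Lipschitz at the point.\<close>

lemma cdiff1_lipschitz:
  assumes "cdiff1 n F \<omega>"
  obtains C \<delta> where "C \<ge> 0" "\<delta> > 0"
    "\<And>h. h \<in> carrier_mat n n \<Longrightarrow> op_norm h < \<delta> \<Longrightarrow> cmod (F (\<omega> + h) - F \<omega>) \<le> C * op_norm h"
proof -
  obtain D where D: "\<And>e. e > 0 \<Longrightarrow> \<exists>\<delta>>0. \<forall>h \<in> carrier_mat n n. op_norm h < \<delta> \<longrightarrow>
     cmod (F (\<omega> + h) - F \<omega> - (\<Sum>x\<in>idx n. D x * h $$ x)) \<le> e * op_norm h"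
    using assms unfolding cdiff1_def by blast
  obtain \<delta> where \<delta>: "\<delta> > 0" "\<And>h. h \<in> carrier_mat n n \<Longrightarrow> op_norm h < \<delta> \<Longrightarrow>
     cmod (F (\<omega> + h) - F \<omega> - (\<Sum>x\<in>idx n. D x * h $$ x)) \<le> 1 * op_norm h"
    using D[of 1] by auto
  define C where "C = 1 + (\<Sum>x\<in>idx n. cmod (D x))"
  have "cmod (F (\<omega> + h) - F \<omega>) \<le> C * op_norm h" if h: "h \<in> carrier_mat n n" "op_norm h < \<delta>" for h
  proof -
    have "cmod (\<Sum>x\<in>idx n. D x * h $$ x) \<le> (\<Sum>x\<in>idx n. cmod (D x) * op_norm h)"
      using cmod_index_le_op_norm[OF h(1)]
      by (intro order_trans[OF norm_sum] sum_mono) (auto simp: norm_mult idx_def intro!: mult_left_mono)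
    then show ?thesis
      using \<delta>(2)[OF h] norm_triangle_sub[of "F (\<omega> + h) - F \<omega>" "\<Sum>x\<in>idx n. D x * h $$ x"]
      by (simp add: C_def algebra_simps sum_distrib_left)
  qed
  moreover have "C \<ge> 0" unfolding C_def by (intro add_nonneg_nonneg sum_nonneg) auto
  ultimately show thesis using that \<delta>(1) by blast
qed

lemma cdiff1_tendsto_line:
  assumes F: "cdiff1 n F \<omega>" and K: "K \<in> carrier_mat n n"
  shows "((\<lambda>e. F (\<omega> + of_real e \<cdot>\<^sub>m K)) \<longlongrightarrow> F \<omega>) (at_right (0::real))"
proof -
  obtain C \<delta> where C: "C \<ge> 0" "\<delta> > 0"
    "\<And>h. h \<in> carrier_mat n n \<Longrightarrow> op_norm h < \<delta> \<Longrightarrow> cmod (F (\<omega> + h) - F \<omega>) \<le> C * op_norm h"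
    using cdiff1_lipschitz[OF F] by blast
  define L where "L = op_norm K"
  have L: "op_norm (of_real e \<cdot>\<^sub>m K) \<le> e * L" if "e \<ge> 0" for e
    using op_norm_smult[OF K, of "of_real e"] that by (simp add: L_def)
  have lim: "((\<lambda>e. e * L) \<longlongrightarrow> 0) (at_right 0)" by (intro tendsto_eq_intros) auto
  have ev: "eventually (\<lambda>e. e * L < \<delta>) (at_right 0)"
    using order_tendstoD(2)[OF lim C(2)] .
  have "eventually (\<lambda>e. cmod (F (\<omega> + of_real e \<cdot>\<^sub>m K) - F \<omega>) \<le> C * (e * L)) (at_right 0)"
    using ev eventually_at_right_less
  proof eventually_elim
    case (elim e)
    have "cmod (F (\<omega> + of_real e \<cdot>\<^sub>m K) - F \<omega>) \<le> C * op_norm (of_real e \<cdot>\<^sub>m K)"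
      using L[of e] elim K by (intro C(3)) auto
    also have "\<dots> \<le> C * (e * L)" using L[of e] elim C(1) by (intro mult_left_mono) auto
    finally show ?case .
  qed
  moreover have "((\<lambda>e. C * (e * L)) \<longlongrightarrow> 0) (at_right 0)" by (intro tendsto_eq_intros) auto
  ultimately have "((\<lambda>e. F (\<omega> + of_real e \<cdot>\<^sub>m K) - F \<omega>) \<longlongrightarrow> 0) (at_right 0)"
    by (rule Lim_null_comparison)
  then show ?thesis by (rule LIM_zero_cancel)
qed

lemma A1_holomorphic:
  assumes h: "h \<in> A1 (RD0 R)"
  shows "(\<lambda>z. h 1 (mat1 z) $$ (0, 0)) holomorphic_on ball 0 R"
proof -
  let ?\<phi> = "\<lambda>z. h 1 (mat1 z) $$ (0, 0)"
  have "\<exists>D. (?\<phi> has_field_derivative D) (at z)" if z: "z \<in> ball 0 R" for z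
  proof -
    have "cdiff1 1 (\<lambda>w. h 1 w $$ (0, 0)) (mat1 z)"
      using z by (intro A1_cdiff1[OF h]) (auto simp: mat1_in_RD0 idx_def simp del: One_nat_def)
    then obtain D where D: "\<And>e. e > 0 \<Longrightarrow> \<exists>\<delta>>0. \<forall>k \<in> carrier_mat 1 1. op_norm k < \<delta> \<longrightarrow>
       cmod (h 1 (mat1 z + k) $$ (0, 0) - ?\<phi> z - (\<Sum>x\<in>idx 1. D x * k $$ x)) \<le> e * op_norm k"
      unfolding cdiff1_def by blast
    have idx1: "idx 1 = {(0, 0)}" by (auto simp: idx_def)
    have "(?\<phi> has_derivative (*) (D (0, 0))) (at z)"
      unfolding has_derivative_at_alt
    proof (intro conjI allI impI)
      show "bounded_linear ((*) (D (0, 0)))" by (rule bounded_linear_mult_right)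
      fix e :: real assume "e > 0"
      then obtain \<delta> where \<delta>: "\<delta> > 0" "\<And>k. k \<in> carrier_mat 1 1 \<Longrightarrow> op_norm k < \<delta> \<Longrightarrow>
         cmod (h 1 (mat1 z + k) $$ (0, 0) - ?\<phi> z - (\<Sum>x\<in>idx 1. D x * k $$ x)) \<le> e * op_norm k"
        using D by blast
      have "cmod (?\<phi> y - ?\<phi> z - D (0, 0) * (y - z)) \<le> e * cmod (y - z)" if y: "cmod (y - z) < \<delta>" for y
      proof -
        have "mat1 z + mat1 (y - z) = mat1 y" by (simp add: mat1_add del: One_nat_def)
        moreover have "(\<Sum>x\<in>idx 1. D x * mat1 (y - z) $$ x) = D (0, 0) * (y - z)"
          unfolding idx1 by (simp add: mat_diag_def)
        ultimately show ?thesis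
          using \<delta>(2)[of "mat1 (y - z)"] y op_norm_mat1[of "y - z"] by (simp del: One_nat_def)
      qed
      then show "\<exists>d>0. \<forall>y. cmod (y - z) < d \<longrightarrow> cmod (?\<phi> y - ?\<phi> z - D (0, 0) * (y - z)) \<le> e * cmod (y - z)"
        using \<delta>(1) by blast
    qed
    then show ?thesis unfolding has_field_derivative_def by blast
  qed
  then show ?thesis
    by (auto simp: holomorphic_on_open)
qed

lemma mat_diag_pow: "mat_diag n d ^\<^sub>m k = mat_diag n (\<lambda>i. d i ^ k)" for d :: "nat \<Rightarrow> complex"
proof (induction k)
  case 0
  then show ?case by (simp add: carrier_matD(1)[OF mat_diag_dim])
next
  case (Suc k)
  then show ?case by (simp add: mult.commute)
qed

lemma conj_mat_diag_index:
  assumes "s \<in> carrier_mat n n" "t \<in> carrier_mat n n" "i < n" "j < n"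
  shows "(s * mat_diag n d * t) $$ (i, j) = (\<Sum>p<n. s $$ (i, p) * d p * t $$ (p, j))"
proof -
  have "(s * mat_diag n d * t) $$ (i, j) = (\<Sum>p<n. (s * mat_diag n d) $$ (i, p) * t $$ (p, j))"
    using assms by (intro mult_mat_index[of _ n]) auto
  also have "\<dots> = (\<Sum>p<n. s $$ (i, p) * d p * t $$ (p, j))"
    using assms by (intro sum.cong) (auto simp: mat_diag_mult_right[OF assms(1)])
  finally show ?thesis .
qed

lemma continuous_on_line_pow:
  fixes \<omega> K :: "complex mat"
  assumes \<omega>: "\<omega> \<in> carrier_mat n n" and K: "K \<in> carrier_mat n n" and "i < n" "j < n"
  shows "continuous_on S (\<lambda>e::real. ((\<omega> + of_real e \<cdot>\<^sub>m K) ^\<^sub>m k) $$ (i, j))"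
  using assms(3,4)
proof (induction k arbitrary: i j)
  case 0
  then show ?case using \<omega> K by simp
next
  case (Suc k)
  have "((\<omega> + of_real e \<cdot>\<^sub>m K) ^\<^sub>m Suc k) $$ (i, j)
     = (\<Sum>p<n. ((\<omega> + of_real e \<cdot>\<^sub>m K) ^\<^sub>m k) $$ (i, p) * (\<omega> $$ (p, j) + of_real e * K $$ (p, j)))" for e
  proof -
    have c: "\<omega> + of_real e \<cdot>\<^sub>m K \<in> carrier_mat n n" using \<omega> K by simp
    show ?thesis
      unfolding pow_mat.simps mult_mat_index[OF pow_carrier_mat[OF c] c Suc.prems]
      using \<omega> K Suc.prems by (intro sum.cong) auto
  qed
  moreover have "continuous_on S (\<lambda>e. \<Sum>p<n. ((\<omega> + of_real e \<cdot>\<^sub>m K) ^\<^sub>m k) $$ (i, p)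
      * (\<omega> $$ (p, j) + of_real e * K $$ (p, j)))"
    using Suc.prems
    by (intro continuous_on_sum continuous_on_mult Suc.IH continuous_on_add continuous_on_const
        continuous_on_of_real continuous_on_id) auto
  ultimately show ?case by (simp only: cong: continuous_on_cong)
qed

text \<open>\<open>series1 R c h\<close>: on the domain of radius \<open>R\<close>, the family \<open>h\<close> has square matrices of
  the right size as values and is the matrix power series with coefficients \<open>c\<close>,
  entrywise and unconditionally convergent. The predicate \<open>cauchy_estimates R c \<phi>\<close> expresses
  Cauchy's bounds on \<open>c\<close> in terms of upper bounds for \<open>\<phi>\<close> on circles.\<close>

definition series1 :: "real \<Rightarrow> (nat \<Rightarrow> complex) \<Rightarrow> fam1 \<Rightarrow> bool" where
  "series1 R c h \<longleftrightarrow> (\<forall>n. \<forall>\<omega>\<in>RD0 R n. h n \<omega> \<in> carrier_mat n n \<and>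
     (\<forall>x\<in>idx n. ((\<lambda>k. c k * (\<omega> ^\<^sub>m k) $$ x) has_sum h n \<omega> $$ x) UNIV))"

definition cauchy_estimates :: "real \<Rightarrow> (nat \<Rightarrow> complex) \<Rightarrow> (complex \<Rightarrow> complex) \<Rightarrow> bool" where
  "cauchy_estimates R c \<phi> \<longleftrightarrow> (\<forall>r B. 0 < r \<longrightarrow> r < R \<longrightarrow> (\<forall>z. cmod z = r \<longrightarrow> cmod (\<phi> z) \<le> B) \<longrightarrow>
     (\<forall>k. cmod (c k) \<le> B / r ^ k))"

lemma series1D:
  "series1 R c h \<Longrightarrow> \<omega> \<in> RD0 R n \<Longrightarrow> x \<in> idx n \<Longrightarrow>
    ((\<lambda>k. c k * (\<omega> ^\<^sub>m k) $$ x) has_sum h n \<omega> $$ x) UNIV"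
  unfolding series1_def by simp

lemma series1_carrier: "series1 R c h \<Longrightarrow> \<omega> \<in> RD0 R n \<Longrightarrow> h n \<omega> \<in> carrier_mat n n"
  unfolding series1_def by simp

lemma cauchy_estimatesD:
  assumes "cauchy_estimates R c \<phi>" "0 < r" "r < R" "\<And>z. cmod z = r \<Longrightarrow> cmod (\<phi> z) \<le> B"
  shows "cmod (c k) \<le> B / r ^ k"
  using assms unfolding cauchy_estimates_def by simp

text \<open>A function in \<open>A(\<Omega>)\<close> is given by the Taylor series at 0 of its scalar component, evaluated
  at matrices. On diagonalizable matrices this follows from compatibility with similarities and
  direct sums, and diagonalizable matrices are dense.\<close>

theorem A1_power_series:
  assumes h: "h \<in> A1 (RD0 R)"
  obtains c where "cauchy_estimates R c (\<lambda>z. h 1 (mat1 z) $$ (0, 0))" "series1 R c h"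
proof -
  define \<phi> where "\<phi> = (\<lambda>z. h 1 (mat1 z) $$ (0, 0))"
  have hol: "\<phi> holomorphic_on ball 0 R" unfolding \<phi>_def by (rule A1_holomorphic[OF h])
  define c where "c k = (deriv ^^ k) \<phi> 0 / fact k" for k
  have ser: "(\<lambda>k. c k * z ^ k) sums \<phi> z" if "cmod z < R" for z
    using holomorphic_power_series[OF hol, of z] that by (simp add: c_def)
  have cauchy: "cmod (c k) \<le> B / r ^ k"
    if r: "0 < r" "r < R" and B: "\<And>z. cmod z = r \<Longrightarrow> cmod (\<phi> z) \<le> B" for r B k
  proof -
    have sub: "cball 0 r \<subseteq> ball (0::complex) R" "ball 0 r \<subseteq> ball (0::complex) R" using r by auto
    have "cmod ((deriv ^^ k) \<phi> 0) \<le> fact k * B / r ^ k"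
      using holomorphic_on_subset[OF hol sub(2)]
        continuous_on_subset[OF holomorphic_on_imp_continuous_on[OF hol] sub(1)] r(1)
      by (rule Cauchy_inequality) (use B in auto)
    then have "cmod ((deriv ^^ k) \<phi> 0) \<le> (B / r ^ k) * fact k"
      by (simp only: times_divide_eq_left mult.commute[of B])
    then have "cmod ((deriv ^^ k) \<phi> 0) / fact k \<le> B / r ^ k"
      by (simp only: pos_divide_le_eq[OF fact_gt_zero])
    then show ?thesis by (simp only: c_def norm_divide norm_fact)
  qed
  have summ: "summable (\<lambda>k. cmod (c k) * \<rho> ^ k)" if \<rho>: "0 \<le> \<rho>" "\<rho> < R" for \<rho>
  proof -
    obtain r where r: "\<rho> < r" "r < R" using dense[OF \<rho>(2)] by blast
    then have "summable (\<lambda>k. c k * of_real r ^ k)"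
      using ser[of "of_real r"] that by (auto simp: sums_iff)
    then have "summable (\<lambda>k. norm (c k * of_real \<rho> ^ k))"
      by (rule powser_insidea) (use r that in auto)
    then show ?thesis using that by (simp add: norm_mult norm_power)
  qed
  have diag: "(\<lambda>k. c k * (\<omega> ^\<^sub>m k) $$ (i, j)) sums h n \<omega> $$ (i, j)"
    if \<omega>: "\<omega> \<in> RD0 R n" and w: "similar_mat_wit \<omega> (mat_diag n d) s t" and ij: "i < n" "j < n"
    for n \<omega> d s t i j
  proof -
    note D = similar_mat_witD2[OF RD0_carrier[OF \<omega>] w]
    have d: "cmod (d p) < R" if "p < n" for p
      using cmod_diagonal_le_op_norm[OF w that] RD0_norm[OF \<omega>] by linarith
    have n: "n \<ge> 1" using RD0_pos[OF \<omega>] by simp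
    have "h n (mat_diag n d) = mat_diag n (\<lambda>i. \<phi> (d i))"
      unfolding \<phi>_def by (rule A1_mat_diag[OF h n d])
    moreover have "h n \<omega> = s * h n (mat_diag n d) * t"
      by (rule A1_similar[OF h mat_diag_in_RD0[OF n d] \<omega> w])
    ultimately have hn: "h n \<omega> $$ (i, j) = (\<Sum>p<n. s $$ (i, p) * \<phi> (d p) * t $$ (p, j))"
      by (simp only: conj_mat_diag_index[OF D(6,7) ij])
    have pow: "(\<omega> ^\<^sub>m k) $$ (i, j) = (\<Sum>p<n. s $$ (i, p) * d p ^ k * t $$ (p, j))" for k
      unfolding similar_mat_wit_pow_id[OF w] mat_diag_pow by (rule conj_mat_diag_index[OF D(6,7) ij])
    have "(\<lambda>k. \<Sum>p<n. s $$ (i, p) * (c k * d p ^ k) * t $$ (p, j)) sums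
        (\<Sum>p<n. s $$ (i, p) * \<phi> (d p) * t $$ (p, j))"
      using d by (intro sums_sum sums_mult sums_mult2 ser) auto
    then show ?thesis unfolding hn pow by (simp add: sum_distrib_left mult_ac)
  qed
  have gen: "((\<lambda>k. c k * (\<omega> ^\<^sub>m k) $$ (i, j)) has_sum h n \<omega> $$ (i, j)) UNIV"
    if \<omega>: "\<omega> \<in> RD0 R n" and ij: "i < n" "j < n" for n \<omega> i j
  proof -
    have \<omega>c: "\<omega> \<in> carrier_mat n n" by (rule RD0_carrier[OF \<omega>])
    obtain K e0 where K: "K \<in> carrier_mat n n" and e0: "e0 > 0" and
      dia: "\<And>e. 0 < e \<Longrightarrow> e < e0 \<Longrightarrow> \<exists>d s t. similar_mat_wit (\<omega> + of_real e \<cdot>\<^sub>m K) (mat_diag n d) s t"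
      using diagonalizable_perturbation[OF \<omega>c] by metis
    define w where "w e = \<omega> + of_real e \<cdot>\<^sub>m K" for e :: real
    have wc: "w e \<in> carrier_mat n n" for e using \<omega>c K by (simp add: w_def)
    have w0: "w 0 = \<omega>" using \<omega>c K by (intro eq_matI) (auto simp: w_def)
    obtain \<rho> where \<rho>: "op_norm \<omega> < \<rho>" "\<rho> < R" using dense[OF RD0_norm[OF \<omega>]] by blast
    have \<rho>0: "0 \<le> \<rho>" using \<rho> op_norm_nonneg[OF \<omega>c] by linarith
    define \<delta> where "\<delta> = (\<rho> - op_norm \<omega>) / (op_norm K + 1)"
    have K0: "op_norm K + 1 > 0" using op_norm_nonneg[OF K] by linarith
    have \<delta>: "\<delta> > 0" unfolding \<delta>_def using \<rho> K0 by simp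
    have wnorm: "op_norm (w e) \<le> \<rho>" if "e \<in> {0..\<delta>}" for e
    proof -
      have "op_norm (w e) \<le> op_norm \<omega> + e * op_norm K"
        unfolding w_def
        using op_norm_add[of \<omega> n n "of_real e \<cdot>\<^sub>m K"] op_norm_smult[OF K, of "of_real e"] \<omega>c K that by simp
      also have "e * op_norm K \<le> \<delta> * (op_norm K + 1)"
        using that op_norm_nonneg[OF K] \<delta> by (intro mult_mono) auto
      also have "\<dots> = \<rho> - op_norm \<omega>" unfolding \<delta>_def using K0 by simp
      finally show ?thesis by simp
    qed
    have bound: "norm (c k * (w e ^\<^sub>m k) $$ (i, j)) \<le> cmod (c k) * \<rho> ^ k" if "e \<in> {0..\<delta>}" for k e
    proof -
      have "cmod ((w e ^\<^sub>m k) $$ (i, j)) \<le> \<rho> ^ k"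
        using cmod_pow_index_le[OF wc ij] power_mono[OF wnorm[OF that] op_norm_nonneg[OF wc]]
        by (rule order_trans)
      then show ?thesis by (simp add: norm_mult mult_left_mono)
    qed
    (* The series is continuous along the segment by the M-test, and so is h; they agree at the
       diagonalizable points near the end point, hence at the end point. *)
    define G where "G e = (\<Sum>k. c k * (w e ^\<^sub>m k) $$ (i, j))" for e
    have "uniform_limit {0..\<delta>} (\<lambda>N e. \<Sum>k<N. c k * (w e ^\<^sub>m k) $$ (i, j)) G sequentially"
      unfolding G_def by (rule Weierstrass_m_test[OF bound summ[OF \<rho>0 \<rho>(2)]])
    then have "continuous_on {0..\<delta>} G"
      using continuous_on_line_pow[OF \<omega>c K ij]
      by (intro uniform_limit_theorem[OF always_eventually])
        (auto simp: w_def intro!: continuous_intros)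
    then have "(G \<longlongrightarrow> G 0) (at 0 within {0..\<delta>})"
      using \<delta> by (simp add: continuous_on_def)
    moreover have "at 0 within {0..\<delta>} = at_right 0"
      using \<delta> by (rule at_within_Icc_at_right)
    ultimately have G: "(G \<longlongrightarrow> G 0) (at_right 0)" by simp
    have "((\<lambda>e. h n (w e) $$ (i, j)) \<longlongrightarrow> h n \<omega> $$ (i, j)) (at_right 0)"
      unfolding w_def using ij
      by (intro cdiff1_tendsto_line[OF _ K] A1_cdiff1[OF h \<omega>]) (auto simp: idx_def)
    moreover have "eventually (\<lambda>e. h n (w e) $$ (i, j) = G e) (at_right 0)"
    proof -
      have "eventually (\<lambda>e. e \<in> {0<..<min e0 \<delta>}) (at_right 0)"
        using e0 \<delta> by (intro eventually_at_right_real) auto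
      then show ?thesis
      proof eventually_elim
        case (elim e)
        have "w e \<in> RD0 R n"
          using wnorm[of e] elim \<rho> wc RD0_pos[OF \<omega>] by (simp add: RD0_def)
        then show ?case
          using dia[of e] elim diag ij unfolding w_def[symmetric] G_def by (auto simp: sums_iff)
      qed
    qed
    ultimately have "(G \<longlongrightarrow> h n \<omega> $$ (i, j)) (at_right 0)" by (rule Lim_transform_eventually)
    then have eq: "h n \<omega> $$ (i, j) = G 0" using G tendsto_unique trivial_limit_at_right_real by blast
    have "summable (\<lambda>k. norm (c k * (\<omega> ^\<^sub>m k) $$ (i, j)))"
      using bound[of 0] \<delta> w0 by (intro summable_comparison_test'[OF summ[OF \<rho>0 \<rho>(2)], of 0]) auto
    from norm_summable_imp_has_sum[OF this summable_sums[OF summable_norm_cancel[OF this]]]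
    show ?thesis unfolding eq G_def w0 .
  qed
  show thesis
  proof (rule that[of c])
    show "series1 R c h" unfolding series1_def using gen A1_carrier[OF h] by (auto simp: idx_def)
    show "cauchy_estimates R c (\<lambda>z. h 1 (mat1 z) $$ (0, 0))"
      unfolding cauchy_estimates_def \<phi>_def[symmetric] using cauchy by simp
  qed
qed

section \<open>Functions of two matrix variables as power series\<close>

lemma
  assumes f: "f \<in> A2 \<Omega>"
  shows A2_tens: "\<omega> \<in> \<Omega> m \<Longrightarrow> \<eta> \<in> \<Omega> n \<Longrightarrow> f m n \<omega> \<eta> \<in> tens2 m n"
    and A2_cdiff2: "\<omega> \<in> \<Omega> m \<Longrightarrow> \<eta> \<in> \<Omega> n \<Longrightarrow> x \<in> idx m \<Longrightarrow> y \<in> idx n \<Longrightarrow>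
      cdiff2 m n (\<lambda>w w'. f m n w w' x y) \<omega> \<eta>"
    and A2_dir_sum1: "\<omega> \<in> \<Omega> m \<Longrightarrow> \<omega>' \<in> \<Omega> m' \<Longrightarrow> \<eta> \<in> \<Omega> n \<Longrightarrow>
      f (m + m') n (dir_sum \<omega> \<omega>') \<eta> = dsum_leg1 m m' n (f m n \<omega> \<eta>) (f m' n \<omega>' \<eta>)"
    and A2_dir_sum2: "\<omega> \<in> \<Omega> m \<Longrightarrow> \<eta> \<in> \<Omega> n \<Longrightarrow> \<eta>' \<in> \<Omega> n' \<Longrightarrow>
      f m (n + n') \<omega> (dir_sum \<eta> \<eta>') = dsum_leg2 m n n' (f m n \<omega> \<eta>) (f m n' \<omega> \<eta>')"
    and A2_similar1: "\<omega> \<in> \<Omega> m \<Longrightarrow> \<omega>' \<in> \<Omega> m \<Longrightarrow> \<eta> \<in> \<Omega> n \<Longrightarrow> similar_mat_wit \<omega>' \<omega> s t \<Longrightarrow>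
      f m n \<omega>' \<eta> = conj_leg1 m n s t (f m n \<omega> \<eta>)"
    and A2_similar2: "\<omega> \<in> \<Omega> m \<Longrightarrow> \<eta> \<in> \<Omega> n \<Longrightarrow> \<eta>' \<in> \<Omega> n \<Longrightarrow> similar_mat_wit \<eta>' \<eta> s t \<Longrightarrow>
      f m n \<omega> \<eta>' = conj_leg2 m n s t (f m n \<omega> \<eta>)"
proof -
  note D = f[unfolded A2_def mem_Collect_eq]
  note D2 = D[THEN conjunct2] note D3 = D2[THEN conjunct2] note D4 = D3[THEN conjunct2]
  note D5 = D4[THEN conjunct2]
  show "\<omega> \<in> \<Omega> m \<Longrightarrow> \<eta> \<in> \<Omega> n \<Longrightarrow> f m n \<omega> \<eta> \<in> tens2 m n"
    by (rule D[THEN conjunct1, rule_format])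
  show "\<omega> \<in> \<Omega> m \<Longrightarrow> \<eta> \<in> \<Omega> n \<Longrightarrow> x \<in> idx m \<Longrightarrow> y \<in> idx n \<Longrightarrow>
      cdiff2 m n (\<lambda>w w'. f m n w w' x y) \<omega> \<eta>"
    by (rule D2[THEN conjunct1, rule_format])
  show "\<omega> \<in> \<Omega> m \<Longrightarrow> \<omega>' \<in> \<Omega> m' \<Longrightarrow> \<eta> \<in> \<Omega> n \<Longrightarrow>
      f (m + m') n (dir_sum \<omega> \<omega>') \<eta> = dsum_leg1 m m' n (f m n \<omega> \<eta>) (f m' n \<omega>' \<eta>)"
    by (rule D3[THEN conjunct1, rule_format])
  show "\<omega> \<in> \<Omega> m \<Longrightarrow> \<eta> \<in> \<Omega> n \<Longrightarrow> \<eta>' \<in> \<Omega> n' \<Longrightarrow>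
      f m (n + n') \<omega> (dir_sum \<eta> \<eta>') = dsum_leg2 m n n' (f m n \<omega> \<eta>) (f m n' \<omega> \<eta>')"
    by (rule D4[THEN conjunct1, rule_format])
  show "\<omega> \<in> \<Omega> m \<Longrightarrow> \<omega>' \<in> \<Omega> m \<Longrightarrow> \<eta> \<in> \<Omega> n \<Longrightarrow> similar_mat_wit \<omega>' \<omega> s t \<Longrightarrow>
      f m n \<omega>' \<eta> = conj_leg1 m n s t (f m n \<omega> \<eta>)"
    by (rule D5[THEN conjunct1, rule_format])
  show "\<omega> \<in> \<Omega> m \<Longrightarrow> \<eta> \<in> \<Omega> n \<Longrightarrow> \<eta>' \<in> \<Omega> n \<Longrightarrow> similar_mat_wit \<eta>' \<eta> s t \<Longrightarrow>
      f m n \<omega> \<eta>' = conj_leg2 m n s t (f m n \<omega> \<eta>)"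
    by (rule D5[THEN conjunct2, rule_format])
qed

lemma leg1_index: "x \<in> idx m \<Longrightarrow> leg1 m T y $$ x = T x y"
  by (auto simp: leg1_def idx_def)

lemma leg2_index: "y \<in> idx n \<Longrightarrow> leg2 n T x $$ y = T x y"
  by (auto simp: leg2_def idx_def)

lemma leg1_dsum_leg1:
  assumes "y \<in> idx n"
  shows "leg1 (m + m') (dsum_leg1 m m' n T T') y = dir_sum (leg1 m T y) (leg1 m' T' y)"
  by (rule eq_matI) (use assms in \<open>auto simp: leg1_def dsum_leg1_def mk2_def idx_def dir_sum_def\<close>)

lemma leg2_dsum_leg2:
  assumes "x \<in> idx m"
  shows "leg2 (n + n') (dsum_leg2 m n n' T T') x = dir_sum (leg2 n T x) (leg2 n' T' x)"
  by (rule eq_matI) (use assms in \<open>auto simp: leg2_def dsum_leg2_def mk2_def idx_def dir_sum_def\<close>)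

lemma leg1_conj_leg1:
  assumes "y \<in> idx n" "s \<in> carrier_mat m m" "t \<in> carrier_mat m m"
  shows "leg1 m (conj_leg1 m n s t T) y = s * leg1 m T y * t"
  by (rule eq_matI) (use assms in \<open>auto simp: leg1_def conj_leg1_def mk2_def idx_def simp del: assoc_mult_mat\<close>)

lemma leg2_conj_leg2:
  assumes "x \<in> idx m" "s \<in> carrier_mat n n" "t \<in> carrier_mat n n"
  shows "leg2 n (conj_leg2 m n s t T) x = s * leg2 n T x * t"
  by (rule eq_matI) (use assms in \<open>auto simp: leg2_def conj_leg2_def mk2_def idx_def simp del: assoc_mult_mat\<close>)

lemma cdiff2_fst:
  assumes F: "cdiff2 m n F \<omega> \<eta>" and \<eta>: "\<eta> \<in> carrier_mat n n"
  shows "cdiff1 m (\<lambda>w. F w \<eta>) \<omega>"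
proof -
  obtain D D' where D: "\<forall>e>0. \<exists>\<delta>>0. \<forall>h \<in> carrier_mat m m. \<forall>h' \<in> carrier_mat n n.
     op_norm h < \<delta> \<and> op_norm h' < \<delta> \<longrightarrow>
     cmod (F (\<omega> + h) (\<eta> + h') - F \<omega> \<eta> - ((\<Sum>x\<in>idx m. D x * h $$ x) + (\<Sum>y\<in>idx n. D' y * h' $$ y)))
       \<le> e * (op_norm h + op_norm h')"
    using F[unfolded cdiff2_def] by (elim exE) (rule that)
  have [simp]: "\<eta> + 0\<^sub>m n n = \<eta>" using \<eta> by simp
  have [simp]: "(\<Sum>y\<in>idx n. D' y * (0\<^sub>m n n :: complex mat) $$ y) = 0"
    by (intro sum.neutral) (auto simp: idx_def)
  show ?thesis unfolding cdiff1_def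
  proof (rule exI[of _ D], intro allI impI)
    fix e :: real assume "e > 0"
    then obtain \<delta> where \<delta>: "\<delta> > 0" "\<forall>h \<in> carrier_mat m m. \<forall>h' \<in> carrier_mat n n.
     op_norm h < \<delta> \<and> op_norm h' < \<delta> \<longrightarrow>
     cmod (F (\<omega> + h) (\<eta> + h') - F \<omega> \<eta> - ((\<Sum>x\<in>idx m. D x * h $$ x) + (\<Sum>y\<in>idx n. D' y * h' $$ y)))
       \<le> e * (op_norm h + op_norm h')"
      using D[rule_format, of e] by (elim exE conjE meta_impE) (assumption, rule that)
    show "\<exists>\<delta>>0. \<forall>h\<in>carrier_mat m m. op_norm h < \<delta> \<longrightarrow>
       cmod (F (\<omega> + h) \<eta> - F \<omega> \<eta> - (\<Sum>x\<in>idx m. D x * h $$ x)) \<le> e * op_norm h"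
      by (rule exI[of _ \<delta>]) (use \<delta>(1) \<delta>(2)[rule_format, of _ "0\<^sub>m n n"] in \<open>auto simp: op_norm_zero\<close>)
  qed
qed

lemma cdiff2_swap:
  assumes "cdiff2 m n F \<omega> \<eta>"
  shows "cdiff2 n m (\<lambda>w' w. F w w') \<eta> \<omega>"
proof -
  obtain D D' where D: "\<forall>e>0. \<exists>\<delta>>0. \<forall>h \<in> carrier_mat m m. \<forall>h' \<in> carrier_mat n n.
     op_norm h < \<delta> \<and> op_norm h' < \<delta> \<longrightarrow>
     cmod (F (\<omega> + h) (\<eta> + h') - F \<omega> \<eta> - ((\<Sum>x\<in>idx m. D x * h $$ x) + (\<Sum>y\<in>idx n. D' y * h' $$ y)))
       \<le> e * (op_norm h + op_norm h')"
    using assms[unfolded cdiff2_def] by (elim exE) (rule that)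
  show ?thesis
    unfolding cdiff2_def
  proof (rule exI[of _ D'], rule exI[of _ D], intro allI impI)
    fix e :: real assume e: "e > 0"
    obtain \<delta> where \<delta>: "\<delta> > 0" "\<forall>h \<in> carrier_mat m m. \<forall>h' \<in> carrier_mat n n.
     op_norm h < \<delta> \<and> op_norm h' < \<delta> \<longrightarrow>
     cmod (F (\<omega> + h) (\<eta> + h') - F \<omega> \<eta> - ((\<Sum>x\<in>idx m. D x * h $$ x) + (\<Sum>y\<in>idx n. D' y * h' $$ y)))
       \<le> e * (op_norm h + op_norm h')"
      using D[rule_format, OF e] by (elim exE conjE) (rule that)
    show "\<exists>\<delta>>0. \<forall>h \<in> carrier_mat n n. \<forall>h' \<in> carrier_mat m m.
       op_norm h < \<delta> \<and> op_norm h' < \<delta> \<longrightarrow>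
       cmod (F (\<omega> + h') (\<eta> + h) - F \<omega> \<eta> - ((\<Sum>x\<in>idx n. D' x * h $$ x) + (\<Sum>y\<in>idx m. D y * h' $$ y)))
         \<le> e * (op_norm h + op_norm h')"
    proof (intro exI[of _ \<delta>] conjI ballI impI \<delta>(1))
      fix h h' assume h: "h \<in> carrier_mat n n" "h' \<in> carrier_mat m m" "op_norm h < \<delta> \<and> op_norm h' < \<delta>"
      show "cmod (F (\<omega> + h') (\<eta> + h) - F \<omega> \<eta> - ((\<Sum>x\<in>idx n. D' x * h $$ x) + (\<Sum>y\<in>idx m. D y * h' $$ y)))
         \<le> e * (op_norm h + op_norm h')"
        using \<delta>(2)[rule_format, OF h(2,1)] h(3) by (simp add: add.commute)
    qed
  qed
qed

lemma cdiff2_snd: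
  assumes F: "cdiff2 m n F \<omega> \<eta>" and \<omega>: "\<omega> \<in> carrier_mat m m"
  shows "cdiff1 n (\<lambda>w. F \<omega> w) \<eta>"
  by (rule cdiff2_fst[OF cdiff2_swap[OF F] \<omega>])

text \<open>If one variable and one coordinate of the corresponding leg are fixed, an element of
  \<open>A(\<Omega>;\<Omega>)\<close> becomes an element of \<open>A(\<Omega>)\<close>.\<close>

lemma leg1_in_A1:
  assumes f: "f \<in> A2 (RD0 R)" and \<eta>: "\<eta> \<in> RD0 R n" and y: "y \<in> idx n"
  shows "(\<lambda>m \<omega>. leg1 m (f m n \<omega> \<eta>) y) \<in> A1 (RD0 R)"
proof -
  have "leg1 (m + m') (f (m + m') n (dir_sum \<omega> \<omega>') \<eta>) y = dir_sum (leg1 m (f m n \<omega> \<eta>) y) (leg1 m' (f m' n \<omega>' \<eta>) y)"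
    if "\<omega> \<in> RD0 R m" "\<omega>' \<in> RD0 R m'" for m m' \<omega> \<omega>'
    unfolding A2_dir_sum1[OF f that \<eta>] by (rule leg1_dsum_leg1[OF y])
  moreover have "leg1 m (f m n \<omega>' \<eta>) y = s * leg1 m (f m n \<omega> \<eta>) y * t"
    if "\<omega> \<in> RD0 R m" "\<omega>' \<in> RD0 R m" "similar_mat_wit \<omega>' \<omega> s t" for m \<omega> \<omega>' s t
    unfolding A2_similar1[OF f that(1,2) \<eta> that(3)]
    using similar_mat_witD2[OF RD0_carrier[OF that(2)] that(3)] by (intro leg1_conj_leg1[OF y]) auto
  moreover have "cdiff1 m (\<lambda>w. leg1 m (f m n w \<eta>) y $$ x) \<omega>"
    if "\<omega> \<in> RD0 R m" "x \<in> idx m" for m \<omega> x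
    unfolding leg1_index[OF that(2)]
    by (rule cdiff2_fst[OF A2_cdiff2[OF f that(1) \<eta> that(2) y] RD0_carrier[OF \<eta>]])
  moreover have "leg1 m T y \<in> carrier_mat m m" for m T by (simp add: leg1_def)
  ultimately show ?thesis unfolding A1_def by blast
qed

lemma leg2_in_A1:
  assumes f: "f \<in> A2 (RD0 R)" and \<omega>: "\<omega> \<in> RD0 R m" and x: "x \<in> idx m"
  shows "(\<lambda>n \<eta>. leg2 n (f m n \<omega> \<eta>) x) \<in> A1 (RD0 R)"
proof -
  have "leg2 (n + n') (f m (n + n') \<omega> (dir_sum \<eta> \<eta>')) x = dir_sum (leg2 n (f m n \<omega> \<eta>) x) (leg2 n' (f m n' \<omega> \<eta>') x)"
    if "\<eta> \<in> RD0 R n" "\<eta>' \<in> RD0 R n'" for n n' \<eta> \<eta>'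
    unfolding A2_dir_sum2[OF f \<omega> that] by (rule leg2_dsum_leg2[OF x])
  moreover have "leg2 n (f m n \<omega> \<eta>') x = s * leg2 n (f m n \<omega> \<eta>) x * t"
    if "\<eta> \<in> RD0 R n" "\<eta>' \<in> RD0 R n" "similar_mat_wit \<eta>' \<eta> s t" for n \<eta> \<eta>' s t
    unfolding A2_similar2[OF f \<omega> that]
    using similar_mat_witD2[OF RD0_carrier[OF that(2)] that(3)] by (intro leg2_conj_leg2[OF x]) auto
  moreover have "cdiff1 n (\<lambda>w. leg2 n (f m n \<omega> w) x $$ y) \<eta>"
    if "\<eta> \<in> RD0 R n" "y \<in> idx n" for n \<eta> y
    unfolding leg2_index[OF that(2)]
    by (rule cdiff2_snd[OF A2_cdiff2[OF f \<omega> that(1) x that(2)] RD0_carrier[OF \<omega>]])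
  moreover have "leg2 n T x \<in> carrier_mat n n" for n T by (simp add: leg2_def)
  ultimately show ?thesis unfolding A1_def by blast
qed

text \<open>The nilpotent shift of size \<open>k + 1\<close>, scaled so that it lies in the domain. The entry
  \<open>(0, k)\<close> of its \<open>i\<close>-th power vanishes unless \<open>i = k\<close>; evaluated at these points, a power
  series reveals its coefficients. With the factor \<open>R / (k + 2)\<close>, the sum of the moduli of all
  entries, which bounds the norm, is less than \<open>R\<close>.\<close>

definition shift_scale :: "real \<Rightarrow> nat \<Rightarrow> complex" where
  "shift_scale R k = of_real (R / real (k + 2))"

definition shift :: "real \<Rightarrow> nat \<Rightarrow> complex mat" where
  "shift R k = Matrix.mat (Suc k) (Suc k) (\<lambda>(i, j). if Suc i = j then shift_scale R k else 0)"

lemma shift_carrier [simp]: "shift R k \<in> carrier_mat (Suc k) (Suc k)"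
  by (simp add: shift_def)

lemma shift_scale_nz: "R > 0 \<Longrightarrow> shift_scale R k \<noteq> 0"
  unfolding shift_scale_def of_real_eq_0_iff by simp

lemma cmod_shift_scale: "R > 0 \<Longrightarrow> cmod (shift_scale R k) = R / real (k + 2)"
  unfolding shift_scale_def norm_of_real by simp

lemma shift_in_RD0:
  assumes R: "R > 0"
  shows "shift R k \<in> RD0 R (Suc k)"
proof -
  have "op_norm (shift R k) \<le> (\<Sum>i<Suc k. \<Sum>j<Suc k. cmod (shift R k $$ (i, j)))"
    by (rule op_norm_le_sum) simp
  also have "\<dots> \<le> (\<Sum>i<Suc k. R / real (k + 2))"
  proof (rule sum_mono)
    fix i assume i: "i \<in> {..<Suc k}"
    have "(\<Sum>j<Suc k. cmod (shift R k $$ (i, j))) = (\<Sum>j<Suc k. if j = Suc i then R / real (k + 2) else 0)"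
      using i R by (intro sum.cong) (auto simp: shift_def cmod_shift_scale)
    also have "\<dots> \<le> R / real (k + 2)" using R by (auto simp: sum.delta)
    finally show "(\<Sum>j<Suc k. cmod (shift R k $$ (i, j))) \<le> R / real (k + 2)" .
  qed
  also have "\<dots> = real (Suc k) * (R / real (k + 2))" by simp
  also have "\<dots> < R" using R by (simp add: field_simps)
  finally show ?thesis by (simp add: RD0_def)
qed

lemma shift_pow_index:
  assumes "p \<le> k" "q \<le> k"
  shows "(shift R k ^\<^sub>m i) $$ (p, q) = (if q = p + i then shift_scale R k ^ i else 0)"
  using assms(2)
proof (induction i arbitrary: q)
  case 0
  then show ?case using assms by (auto simp: shift_def)
next
  case (Suc i)
  have "(shift R k ^\<^sub>m Suc i) $$ (p, q) = (\<Sum>r<Suc k. (shift R k ^\<^sub>m i) $$ (p, r) * shift R k $$ (r, q))"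
    unfolding pow_mat.simps using assms(1) Suc.prems by (intro mult_mat_index[of _ "Suc k" "Suc k" _ "Suc k"]) auto
  also have "\<dots> = (\<Sum>r<Suc k. if r = p + i then (if q = Suc r then shift_scale R k ^ Suc i else 0) else 0)"
    using Suc by (intro sum.cong) (auto simp: shift_def)
  also have "\<dots> = (if q = p + Suc i then shift_scale R k ^ Suc i else 0)"
    using Suc.prems by (auto simp: sum.delta)
  finally show ?case .
qed

lemma shift_pow_corner: "(shift R k ^\<^sub>m i) $$ (0, k) = (if i = k then shift_scale R k ^ k else 0)"
  by (auto simp: shift_pow_index)

lemma corner_idx [simp]: "(0, k) \<in> idx (Suc k)"
  by (simp add: idx_def)

text \<open>Reading off a coefficient from the value at a shift.\<close>

lemma shift_has_sum:
  assumes "((\<lambda>i. c i * (shift R k ^\<^sub>m i) $$ (0, k)) has_sum S) UNIV"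
  shows "S = c k * shift_scale R k ^ k"
proof -
  have "((\<lambda>i. c i * (shift R k ^\<^sub>m i) $$ (0, k)) has_sum (c k * shift_scale R k ^ k)) UNIV"
    by (rule has_sum_finite_neutralI[of "{k}"]) (auto simp: shift_pow_corner)
  then show ?thesis using assms has_sum_unique by blast
qed

lemma shift_has_sum2:
  assumes "((\<lambda>(i, j). a i j * ((shift R k ^\<^sub>m i) $$ (0, k) * (shift R l ^\<^sub>m j) $$ (0, l))) has_sum S) UNIV"
  shows "S = a k l * (shift_scale R k ^ k * shift_scale R l ^ l)"
proof -
  have "((\<lambda>(i, j). a i j * ((shift R k ^\<^sub>m i) $$ (0, k) * (shift R l ^\<^sub>m j) $$ (0, l)))
      has_sum (a k l * (shift_scale R k ^ k * shift_scale R l ^ l))) UNIV"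
    by (rule has_sum_finite_neutralI[of "{(k, l)}"]) (auto simp: shift_pow_corner split: if_splits)
  then show ?thesis using assms has_sum_unique by blast
qed

lemma cdiff2_lipschitz:
  assumes "cdiff2 m n F \<omega> \<eta>"
  obtains C \<delta> where "C \<ge> 0" "\<delta> > 0"
    "\<And>h h'. h \<in> carrier_mat m m \<Longrightarrow> h' \<in> carrier_mat n n \<Longrightarrow> op_norm h < \<delta> \<Longrightarrow> op_norm h' < \<delta> \<Longrightarrow>
       cmod (F (\<omega> + h) (\<eta> + h') - F \<omega> \<eta>) \<le> C * (op_norm h + op_norm h')"
proof -
  obtain D D' where D: "\<forall>e>0. \<exists>\<delta>>0. \<forall>h \<in> carrier_mat m m. \<forall>h' \<in> carrier_mat n n.
     op_norm h < \<delta> \<and> op_norm h' < \<delta> \<longrightarrow>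
     cmod (F (\<omega> + h) (\<eta> + h') - F \<omega> \<eta> - ((\<Sum>x\<in>idx m. D x * h $$ x) + (\<Sum>y\<in>idx n. D' y * h' $$ y)))
       \<le> e * (op_norm h + op_norm h')"
    using assms[unfolded cdiff2_def] by (elim exE) (rule that)
  have one: "(0 :: real) < 1" by simp
  obtain \<delta> where \<delta>: "\<delta> > 0" "\<forall>h \<in> carrier_mat m m. \<forall>h' \<in> carrier_mat n n.
     op_norm h < \<delta> \<and> op_norm h' < \<delta> \<longrightarrow>
     cmod (F (\<omega> + h) (\<eta> + h') - F \<omega> \<eta> - ((\<Sum>x\<in>idx m. D x * h $$ x) + (\<Sum>y\<in>idx n. D' y * h' $$ y)))
       \<le> 1 * (op_norm h + op_norm h')"
    using D[rule_format, OF one] by (elim exE conjE) (rule that)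
  define E where "E = (\<Sum>x\<in>idx m. cmod (D x))"
  define E' where "E' = (\<Sum>x\<in>idx n. cmod (D' x))"
  have E: "E \<ge> 0" "E' \<ge> 0" unfolding E_def E'_def by (auto intro: sum_nonneg)
  have lin: "cmod (\<Sum>x\<in>idx l. G x * h $$ x) \<le> (\<Sum>x\<in>idx l. cmod (G x)) * op_norm h"
    if "h \<in> carrier_mat l l" for l h and G :: "nat \<times> nat \<Rightarrow> complex"
    unfolding sum_distrib_right using cmod_index_le_op_norm[OF that]
    by (intro order_trans[OF norm_sum] sum_mono) (auto simp: norm_mult idx_def intro!: mult_left_mono)
  have "cmod (F (\<omega> + h) (\<eta> + h') - F \<omega> \<eta>) \<le> (1 + E + E') * (op_norm h + op_norm h')"
    if h: "h \<in> carrier_mat m m" "h' \<in> carrier_mat n n" "op_norm h < \<delta>" "op_norm h' < \<delta>" for h h'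
  proof -
    let ?L = "(\<Sum>x\<in>idx m. D x * h $$ x)" and ?L' = "(\<Sum>y\<in>idx n. D' y * h' $$ y)"
    have "cmod (F (\<omega> + h) (\<eta> + h') - F \<omega> \<eta>) \<le> cmod (?L + ?L') + cmod (F (\<omega> + h) (\<eta> + h') - F \<omega> \<eta> - (?L + ?L'))"
      by (rule norm_triangle_sub)
    also have "cmod (?L + ?L') \<le> E * op_norm h + E' * op_norm h'"
      unfolding E_def E'_def using lin[OF h(1), of D] lin[OF h(2), of D'] norm_triangle_ineq[of ?L ?L'] by linarith
    also have "\<dots> \<le> E * (op_norm h + op_norm h') + E' * (op_norm h + op_norm h')"
      using op_norm_nonneg[OF h(1)] op_norm_nonneg[OF h(2)] E by (intro add_mono mult_left_mono) auto
    finally show ?thesis using \<delta>(2)[rule_format, OF h(1,2)] h(3,4) by (simp add: algebra_simps)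
  qed
  moreover have "1 + E + E' \<ge> 0" using E by simp
  ultimately show thesis using that \<delta>(1) by blast
qed

lemma A2_scalar_continuous:
  assumes f: "f \<in> A2 (RD0 R)"
  shows "continuous_on (ball 0 R \<times> ball 0 R) (\<lambda>(z, w). f 1 1 (mat1 z) (mat1 w) (0, 0) (0, 0))"
proof -
  let ?F = "\<lambda>(z, w). f 1 1 (mat1 z) (mat1 w) (0, 0) (0, 0)"
  have "isCont ?F (z, w)" if zw: "cmod z < R" "cmod w < R" for z w
  proof -
    have "cdiff2 1 1 (\<lambda>a b. f 1 1 a b (0, 0) (0, 0)) (mat1 z) (mat1 w)"
      using zw by (intro A2_cdiff2[OF f]) (auto simp: mat1_in_RD0 idx_def simp del: One_nat_def)
    then obtain C \<delta> where C: "C \<ge> 0" "\<delta> > 0"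
      "\<And>h h'. h \<in> carrier_mat 1 1 \<Longrightarrow> h' \<in> carrier_mat 1 1 \<Longrightarrow> op_norm h < \<delta> \<Longrightarrow> op_norm h' < \<delta> \<Longrightarrow>
       cmod (f 1 1 (mat1 z + h) (mat1 w + h') (0, 0) (0, 0) - f 1 1 (mat1 z) (mat1 w) (0, 0) (0, 0))
         \<le> C * (op_norm h + op_norm h')"
      using cdiff2_lipschitz by blast
    have le: "cmod (?F p - ?F (z, w)) \<le> C * (cmod (fst p - z) + cmod (snd p - w))" if p: "dist p (z, w) < \<delta>" for p
    proof -
      have "cmod (fst p - z) < \<delta>" "cmod (snd p - w) < \<delta>"
        using p dist_fst_le[of p "(z, w)"] dist_snd_le[of p "(z, w)"] by (auto simp: dist_norm)
      then show ?thesis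
        using C(3)[of "mat1 (fst p - z)" "mat1 (snd p - w)"]
        by (simp add: op_norm_mat1 mat1_add case_prod_beta del: One_nat_def)
    qed
    have "eventually (\<lambda>p. dist p (z, w) < \<delta>) (at (z, w))"
      using C(2) by (auto simp: eventually_at)
    then have "eventually (\<lambda>p. cmod (?F p - ?F (z, w)) \<le> C * (cmod (fst p - z) + cmod (snd p - w))) (at (z, w))"
      by (rule eventually_mono) (rule le)
    moreover have "((\<lambda>p. C * (cmod (fst p - z) + cmod (snd p - w))) \<longlongrightarrow> 0) (at (z, w))"
      by (intro tendsto_eq_intros) auto
    ultimately have "((\<lambda>p. ?F p - ?F (z, w)) \<longlongrightarrow> 0) (at (z, w))"
      by (rule Lim_null_comparison)
    then show ?thesis unfolding isCont_def by (rule LIM_zero_cancel)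
  qed
  then show ?thesis by (intro continuous_at_imp_continuous_on) auto
qed

lemma summable_on_geometric2:
  assumes "0 \<le> q" "q < (1 :: real)"
  shows "(\<lambda>(k, l). q ^ k * q ^ l) summable_on (UNIV :: (nat \<times> nat) set)"
proof -
  have s: "(\<lambda>k. q ^ k) summable_on UNIV"
    using assms by (intro norm_summable_imp_summable_on) (simp add: norm_power)
  have "(\<lambda>(k, l). q ^ k * q ^ l) summable_on (UNIV \<times> UNIV)"
  proof (rule summable_on_SigmaI)
    show "((\<lambda>l. case (k, l) of (k, l) \<Rightarrow> q ^ k * q ^ l) has_sum q ^ k * infsum (\<lambda>l. q ^ l) UNIV) UNIV" for k
      using has_sum_cmult_right[OF has_sum_infsum[OF s], of "q ^ k"] by simp
    show "(\<lambda>k. q ^ k * infsum (\<lambda>l. q ^ l) UNIV) summable_on UNIV"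
      by (rule summable_on_cmult_left[OF s])
  qed (use assms in auto)
  then show ?thesis by simp
qed

text \<open>The family \<open>f\<close> is the double power series with coefficients \<open>a k l\<close> at
  \<open>z\<^sup>k \<otimes> z\<^sup>l\<close>, coordinatewise and unconditionally convergent.\<close>

definition series2 :: "real \<Rightarrow> (nat \<Rightarrow> nat \<Rightarrow> complex) \<Rightarrow> fam2 \<Rightarrow> bool" where
  "series2 R a f \<longleftrightarrow> (\<forall>m n. \<forall>\<omega>\<in>RD0 R m. \<forall>\<eta>\<in>RD0 R n. \<forall>x\<in>idx m. \<forall>y\<in>idx n.
     ((\<lambda>(k, l). a k l * ((\<omega> ^\<^sub>m k) $$ x * (\<eta> ^\<^sub>m l) $$ y)) has_sum f m n \<omega> \<eta> x y) UNIV)"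

lemma series2D:
  "series2 R a f \<Longrightarrow> \<omega> \<in> RD0 R m \<Longrightarrow> \<eta> \<in> RD0 R n \<Longrightarrow> x \<in> idx m \<Longrightarrow> y \<in> idx n \<Longrightarrow>
    ((\<lambda>(k, l). a k l * ((\<omega> ^\<^sub>m k) $$ x * (\<eta> ^\<^sub>m l) $$ y)) has_sum f m n \<omega> \<eta> x y) UNIV"
  unfolding series2_def by simp

text \<open>The one-variable expansion is first applied in the left variable. Its coefficients are,
  up to constants, entries of values at shifts, hence entries of functions in \<open>A(\<Omega>)\<close> of the
  right variable, and can be expanded in turn. Cauchy's estimates make the double series
  absolutely convergent.\<close>

theorem A2_power_series:
  assumes R: "R > 0" and f: "f \<in> A2 (RD0 R)"
  obtains a where "series2 R a f"
proof -
  define b where "b k n \<eta> y = f (Suc k) n (shift R k) \<eta> (0, k) y / shift_scale R k ^ k" for k n \<eta> y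
  have i0: "(0, 0) \<in> idx 1" by (simp add: idx_def)
  have *: "cauchy_estimates R (\<lambda>k. b k n \<eta> y) (\<lambda>z. f 1 n (mat1 z) \<eta> (0, 0) y) \<and>
      series1 R (\<lambda>k. b k n \<eta> y) (\<lambda>m \<omega>. leg1 m (f m n \<omega> \<eta>) y)"
    if \<eta>: "\<eta> \<in> RD0 R n" and y: "y \<in> idx n" for n \<eta> y
  proof -
    obtain c where c: "cauchy_estimates R c (\<lambda>z. leg1 1 (f 1 n (mat1 z) \<eta>) y $$ (0, 0))"
        "series1 R c (\<lambda>m \<omega>. leg1 m (f m n \<omega> \<eta>) y)"
      by (rule A1_power_series[OF leg1_in_A1[OF f \<eta> y]])
    have "c = (\<lambda>k. b k n \<eta> y)"
      using shift_has_sum[OF series1D[OF c(2) shift_in_RD0[OF R] corner_idx]] shift_scale_nz[OF R]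
      by (auto simp: b_def leg1_index fun_eq_iff)
    then show ?thesis using c by (simp add: leg1_index[OF i0] del: One_nat_def)
  qed
  have b: "((\<lambda>k. b k n \<eta> y * (\<omega> ^\<^sub>m k) $$ x) has_sum f m n \<omega> \<eta> x y) UNIV"
    if "\<omega> \<in> RD0 R m" "\<eta> \<in> RD0 R n" "x \<in> idx m" "y \<in> idx n" for m n \<omega> \<eta> x y
    using series1D[OF conjunct2[OF *[OF that(2,4)]] that(1,3)] unfolding leg1_index[OF that(3)] .
  have b': "cauchy_estimates R (\<lambda>k. b k n \<eta> y) (\<lambda>z. f 1 n (mat1 z) \<eta> (0, 0) y)"
    if "\<eta> \<in> RD0 R n" "y \<in> idx n" for n \<eta> y
    by (rule conjunct1[OF *[OF that]])
  have ex: "\<forall>k. \<exists>c. cauchy_estimates R c (\<lambda>w. b k 1 (mat1 w) (0, 0)) \<and>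
      (\<forall>n. \<forall>\<eta>\<in>RD0 R n. \<forall>y\<in>idx n. ((\<lambda>l. c l * (\<eta> ^\<^sub>m l) $$ y) has_sum b k n \<eta> y) UNIV)"
  proof (rule allI)
    fix k
    let ?s = "shift_scale R k ^ k"
    obtain c where c: "cauchy_estimates R c (\<lambda>w. leg2 1 (f (Suc k) 1 (shift R k) (mat1 w)) (0, k) $$ (0, 0))"
        "series1 R c (\<lambda>n \<eta>. leg2 n (f (Suc k) n (shift R k) \<eta>) (0, k))"
      by (rule A1_power_series[OF leg2_in_A1[OF f shift_in_RD0[OF R, of k] corner_idx]])
    have eq: "leg2 n (f (Suc k) n (shift R k) \<eta>) (0, k) $$ y = ?s * b k n \<eta> y" if "y \<in> idx n" for n \<eta> y
      using shift_scale_nz[OF R, of k] by (simp add: b_def leg2_index[OF that])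
    have "((\<lambda>l. c l / ?s * (\<eta> ^\<^sub>m l) $$ y) has_sum b k n \<eta> y) UNIV" if "\<eta> \<in> RD0 R n" "y \<in> idx n" for n \<eta> y
      using has_sum_cmult_right[OF series1D[OF c(2) that], of "1 / ?s"] shift_scale_nz[OF R, of k] unfolding eq[OF that(2)] by simp
    moreover have "cauchy_estimates R (\<lambda>l. c l / ?s) (\<lambda>w. b k 1 (mat1 w) (0, 0))"
      unfolding cauchy_estimates_def
    proof (intro allI impI)
      fix r B l
      assume r: "0 < r" "r < R" and B: "\<forall>w. cmod w = r \<longrightarrow> cmod (b k 1 (mat1 w) (0, 0)) \<le> B"
      have "cmod (c l) \<le> cmod ?s * B / r ^ l"
      proof (rule cauchy_estimatesD[OF c(1) r])
        fix w assume "cmod w = r"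
        then have "cmod (b k 1 (mat1 w) (0, 0)) \<le> B" using B by blast
        then show "cmod (leg2 1 (f (Suc k) 1 (shift R k) (mat1 w)) (0, k) $$ (0, 0)) \<le> cmod ?s * B"
          unfolding eq[OF i0] norm_mult by (rule mult_left_mono) simp
      qed
      then have "cmod (c l) / cmod ?s \<le> (cmod ?s * B / r ^ l) / cmod ?s"
        by (rule divide_right_mono) simp
      also have "\<dots> = B / r ^ l" using shift_scale_nz[OF R, of k] by simp
      finally show "cmod (c l / ?s) \<le> B / r ^ l" by (simp only: norm_divide)
    qed
    ultimately show "\<exists>c. cauchy_estimates R c (\<lambda>w. b k 1 (mat1 w) (0, 0)) \<and>
      (\<forall>n. \<forall>\<eta>\<in>RD0 R n. \<forall>y\<in>idx n. ((\<lambda>l. c l * (\<eta> ^\<^sub>m l) $$ y) has_sum b k n \<eta> y) UNIV)"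
      by (intro exI[of _ "\<lambda>l. c l / ?s"]) simp
  qed
  obtain a where a: "\<forall>k. cauchy_estimates R (a k) (\<lambda>w. b k 1 (mat1 w) (0, 0)) \<and>
      (\<forall>n. \<forall>\<eta>\<in>RD0 R n. \<forall>y\<in>idx n. ((\<lambda>l. a k l * (\<eta> ^\<^sub>m l) $$ y) has_sum b k n \<eta> y) UNIV)"
    using choice[OF ex] by (elim exE) (rule that)
  have a2: "((\<lambda>l. a k l * (\<eta> ^\<^sub>m l) $$ y) has_sum b k n \<eta> y) UNIV"
    if "\<eta> \<in> RD0 R n" "y \<in> idx n" for k n \<eta> y
    using a that by simp
  have bound: "\<exists>M. \<forall>k l. cmod (a k l) \<le> M / r ^ k / r ^ l" if r: "0 < r" "r < R" for r
  proof -
    have "compact ((\<lambda>(z, w). f 1 1 (mat1 z) (mat1 w) (0, 0) (0, 0)) ` (cball 0 r \<times> cball 0 r))"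
      using r by (intro compact_continuous_image continuous_on_subset[OF A2_scalar_continuous[OF f]]
          compact_Times) auto
    then have "bounded ((\<lambda>(z, w). f 1 1 (mat1 z) (mat1 w) (0, 0) (0, 0)) ` (cball 0 r \<times> cball 0 r))"
      by (rule compact_imp_bounded)
    then obtain M where M0: "\<forall>u \<in> (\<lambda>(z, w). f 1 1 (mat1 z) (mat1 w) (0, 0) (0, 0)) ` (cball 0 r \<times> cball 0 r).
        cmod u \<le> M"
      unfolding bounded_iff by (elim exE) (rule that)
    have M: "cmod (f 1 1 (mat1 z) (mat1 w) (0, 0) (0, 0)) \<le> M" if "cmod z \<le> r" "cmod w \<le> r" for z w
      by (rule bspec[OF M0 image_eqI[of _ _ "(z, w)"]]) (use that in auto)
    have "cmod (b k 1 (mat1 w) (0, 0)) \<le> M / r ^ k" if "cmod w = r" for k w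
    proof -
      have "mat1 w \<in> RD0 R 1" using that r by (simp add: mat1_in_RD0 del: One_nat_def)
      then show ?thesis by (rule cauchy_estimatesD[OF b'[OF _ i0] r]) (use M that in auto)
    qed
    then have "cmod (a k l) \<le> M / r ^ k / r ^ l" for k l
      by (intro cauchy_estimatesD[OF conjunct1[OF a[rule_format]] r])
    then show ?thesis by blast
  qed
  have "((\<lambda>(k, l). a k l * ((\<omega> ^\<^sub>m k) $$ x * (\<eta> ^\<^sub>m l) $$ y)) has_sum f m n \<omega> \<eta> x y) UNIV"
    if \<omega>: "\<omega> \<in> RD0 R m" and \<eta>: "\<eta> \<in> RD0 R n" and x: "x \<in> idx m" and y: "y \<in> idx n"
    for m n \<omega> \<eta> x y
  proof -
    note \<omega>c = RD0_carrier[OF \<omega>] and \<eta>c = RD0_carrier[OF \<eta>]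
    define \<rho> where "\<rho> = max (op_norm \<omega>) (op_norm \<eta>)"
    have \<rho>: "0 \<le> \<rho>" "\<rho> < R" using op_norm_nonneg[OF \<omega>c] RD0_norm[OF \<omega>] RD0_norm[OF \<eta>] by (auto simp: \<rho>_def)
    obtain r where r: "\<rho> < r" "r < R" using dense[OF \<rho>(2)] by blast
    have r0: "0 < r" using r \<rho> by linarith
    obtain M where M: "\<And>k l. cmod (a k l) \<le> M / r ^ k / r ^ l" using bound[OF r0 r(2)] by blast
    have M0: "M \<ge> 0" using order_trans[OF norm_ge_zero M[of 0 0]] by simp
    define q where "q = \<rho> / r"
    have q: "0 \<le> q" "q < 1" using \<rho> r r0 by (auto simp: q_def)
    have pw: "cmod ((\<omega> ^\<^sub>m k) $$ x) \<le> \<rho> ^ k" "cmod ((\<eta> ^\<^sub>m k) $$ y) \<le> \<rho> ^ k" for k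
    proof -
      have "cmod ((\<omega> ^\<^sub>m k) $$ x) \<le> op_norm \<omega> ^ k"
        using x cmod_pow_index_le[OF \<omega>c] by (cases x) (auto simp: idx_def)
      also have "\<dots> \<le> \<rho> ^ k" by (intro power_mono op_norm_nonneg[OF \<omega>c]) (simp add: \<rho>_def)
      finally show "cmod ((\<omega> ^\<^sub>m k) $$ x) \<le> \<rho> ^ k" .
      have "cmod ((\<eta> ^\<^sub>m k) $$ y) \<le> op_norm \<eta> ^ k"
        using y cmod_pow_index_le[OF \<eta>c] by (cases y) (auto simp: idx_def)
      also have "\<dots> \<le> \<rho> ^ k" by (intro power_mono op_norm_nonneg[OF \<eta>c]) (simp add: \<rho>_def)
      finally show "cmod ((\<eta> ^\<^sub>m k) $$ y) \<le> \<rho> ^ k" .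
    qed
    have le: "norm (a k l * ((\<omega> ^\<^sub>m k) $$ x * (\<eta> ^\<^sub>m l) $$ y)) \<le> M * (q ^ k * q ^ l)" for k l
    proof -
      have "norm (a k l * ((\<omega> ^\<^sub>m k) $$ x * (\<eta> ^\<^sub>m l) $$ y)) \<le> (M / r ^ k / r ^ l) * (\<rho> ^ k * \<rho> ^ l)"
        unfolding norm_mult using M0 r0 \<rho>(1) by (intro mult_mono M pw) auto
      also have "\<dots> = M * (q ^ k * q ^ l)" by (simp add: q_def power_divide)
      finally show ?thesis .
    qed
    have "(\<lambda>p. M * (case p of (k, l) \<Rightarrow> q ^ k * q ^ l)) summable_on UNIV"
      by (rule summable_on_cmult_right[OF summable_on_geometric2[OF q]])
    then have "(\<lambda>p. norm (case p of (k, l) \<Rightarrow> a k l * ((\<omega> ^\<^sub>m k) $$ x * (\<eta> ^\<^sub>m l) $$ y))) summable_on UNIV"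
      by (rule Infinite_Sum.summable_on_comparison_test) (use le in auto)
    then have summ: "(\<lambda>(k, l). a k l * ((\<omega> ^\<^sub>m k) $$ x * (\<eta> ^\<^sub>m l) $$ y)) summable_on (UNIV \<times> UNIV)"
      unfolding UNIV_Times_UNIV by (rule abs_summable_summable)
    have "((\<lambda>(k, l). a k l * ((\<omega> ^\<^sub>m k) $$ x * (\<eta> ^\<^sub>m l) $$ y)) has_sum f m n \<omega> \<eta> x y) (UNIV \<times> UNIV)"
    proof (rule has_sum_SigmaI[OF _ b[OF \<omega> \<eta> x y] summ])
      fix k
      show "((\<lambda>l. case (k, l) of (k, l) \<Rightarrow> a k l * ((\<omega> ^\<^sub>m k) $$ x * (\<eta> ^\<^sub>m l) $$ y))
          has_sum (b k n \<eta> y * (\<omega> ^\<^sub>m k) $$ x)) UNIV"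
        using has_sum_cmult_left[OF a2[OF \<eta> y, of k], of "(\<omega> ^\<^sub>m k) $$ x"] by (simp add: mult_ac)
    qed
    then show ?thesis by simp
  qed
  then have "series2 R a f" unfolding series2_def by blast
  then show thesis by (rule that)
qed

section \<open>The difference quotient on power series\<close>

lemma pow_mat_add:
  assumes "A \<in> carrier_mat n n"
  shows "A ^\<^sub>m k * A ^\<^sub>m l = A ^\<^sub>m (k + l)"
proof (induction l)
  case 0
  then show ?case using assms by simp
next
  case (Suc l)
  have "A ^\<^sub>m k * (A ^\<^sub>m l * A) = A ^\<^sub>m k * A ^\<^sub>m l * A"
    using assms by (intro assoc_mult_mat[symmetric]) auto
  then show ?case using Suc by simp
qed

text \<open>The coefficient of \<open>\<partial>(z\<^sup>k) = (\<Sum>i<k. z\<^sup>i \<otimes> z\<^sup>k\<^sup>-\<^sup>1\<^sup>-\<^sup>i)\<close> at \<open>e\<^sub>x \<otimes> e\<^sub>y\<close>.\<close>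

definition del_pow :: "nat \<Rightarrow> complex mat \<Rightarrow> complex mat \<Rightarrow> nat \<times> nat \<Rightarrow> nat \<times> nat \<Rightarrow> complex" where
  "del_pow k \<omega> \<omega>' x y = (\<Sum>i<k. (\<omega> ^\<^sub>m i) $$ x * (\<omega>' ^\<^sub>m (k - 1 - i)) $$ y)"

lemma del_pow_Suc: "del_pow (Suc k) \<omega> \<omega>' x y = (\<Sum>i\<le>k. (\<omega> ^\<^sub>m i) $$ x * (\<omega>' ^\<^sub>m (k - i)) $$ y)"
  by (simp add: del_pow_def lessThan_Suc_atMost)

lemma upper_block_carrier:
  "\<omega> \<in> carrier_mat m m \<Longrightarrow> \<omega>' \<in> carrier_mat n n \<Longrightarrow>
    upper_block m n \<omega> \<omega>' b c \<epsilon> \<in> carrier_mat (m + n) (m + n)"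
  by (simp add: upper_block_def)

lemma upper_block_index:
  assumes "\<omega> \<in> carrier_mat m m" "\<omega>' \<in> carrier_mat n n" "i < m + n" "j < m + n"
  shows "upper_block m n \<omega> \<omega>' b c \<epsilon> $$ (i, j) =
    (if i < m then if j < m then \<omega> $$ (i, j) else if i = b \<and> j - m = c then \<epsilon> else 0
     else if j < m then 0 else \<omega>' $$ (i - m, j - m))"
  using assms by (auto simp: upper_block_def matrix_unit_def)

text \<open>The first \<open>m\<close> rows of the powers of an upper triangular block matrix. The corner block is
  linear in \<open>\<epsilon>\<close>, without higher order terms, since a product of blocks that contains the corner
  twice vanishes.\<close>

lemma upper_block_pow:
  assumes \<omega>: "\<omega> \<in> carrier_mat m m" and \<omega>': "\<omega>' \<in> carrier_mat n n"
    and bc: "b < m" "c < n" and a: "a < m"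
  shows "(\<forall>p<m. (upper_block m n \<omega> \<omega>' b c \<epsilon> ^\<^sub>m k) $$ (a, p) = (\<omega> ^\<^sub>m k) $$ (a, p)) \<and>
    (\<forall>d<n. (upper_block m n \<omega> \<omega>' b c \<epsilon> ^\<^sub>m k) $$ (a, m + d) = \<epsilon> * del_pow k \<omega> \<omega>' (a, b) (c, d))"
proof (induction k)
  case 0
  have "dim_row (upper_block m n \<omega> \<omega>' b c \<epsilon>) = m + n"
    using upper_block_carrier[OF \<omega> \<omega>'] by blast
  then show ?case using \<omega> a by (auto simp: del_pow_def)
next
  case (Suc k)
  let ?U = "upper_block m n \<omega> \<omega>' b c \<epsilon>"
  have U: "?U \<in> carrier_mat (m + n) (m + n)" by (rule upper_block_carrier[OF \<omega> \<omega>'])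
  have step: "(?U ^\<^sub>m Suc k) $$ (a, j) =
      (\<Sum>r<m. (\<omega> ^\<^sub>m k) $$ (a, r) * ?U $$ (r, j)) + (\<Sum>q<n. \<epsilon> * del_pow k \<omega> \<omega>' (a, b) (c, q) * ?U $$ (m + q, j))"
    if "j < m + n" for j
  proof -
    have "(?U ^\<^sub>m Suc k) $$ (a, j) = (\<Sum>r<m + n. (?U ^\<^sub>m k) $$ (a, r) * ?U $$ (r, j))"
      unfolding pow_mat.simps using a that U by (intro mult_mat_index[of _ "m + n" "m + n" _ "m + n"]) auto
    then show ?thesis unfolding sum_lessThan_add using Suc by simp
  qed
  show ?case
  proof (intro conjI allI impI)
    fix p assume p: "p < m"
    have "(?U ^\<^sub>m Suc k) $$ (a, p) = (\<Sum>r<m. (\<omega> ^\<^sub>m k) $$ (a, r) * \<omega> $$ (r, p))"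
      unfolding step[OF trans_less_add1[OF p]] using p by (simp add: upper_block_index[OF \<omega> \<omega>'])
    also have "\<dots> = (\<omega> ^\<^sub>m Suc k) $$ (a, p)"
      unfolding pow_mat.simps using a p \<omega> by (intro mult_mat_index[of _ m m _ m, symmetric]) auto
    finally show "(?U ^\<^sub>m Suc k) $$ (a, p) = (\<omega> ^\<^sub>m Suc k) $$ (a, p)" .
  next
    fix d assume d: "d < n"
    have 1: "(\<Sum>r<m. (\<omega> ^\<^sub>m k) $$ (a, r) * ?U $$ (r, m + d)) = \<epsilon> * ((\<omega> ^\<^sub>m k) $$ (a, b) * (\<omega>' ^\<^sub>m 0) $$ (c, d))"
    proof -
      have "(\<Sum>r<m. (\<omega> ^\<^sub>m k) $$ (a, r) * ?U $$ (r, m + d))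
          = (\<Sum>r<m. if r = b then \<epsilon> * ((\<omega> ^\<^sub>m k) $$ (a, b) * (\<omega>' ^\<^sub>m 0) $$ (c, d)) else 0)"
        using d bc \<omega>' by (intro sum.cong) (auto simp: upper_block_index[OF \<omega> \<omega>'])
      then show ?thesis using bc by simp
    qed
    have 2: "(\<Sum>q<n. (\<omega>' ^\<^sub>m l) $$ (c, q) * \<omega>' $$ (q, d)) = (\<omega>' ^\<^sub>m Suc l) $$ (c, d)" for l
      unfolding pow_mat.simps using bc d \<omega>' by (intro mult_mat_index[of _ n n _ n, symmetric]) auto
    have "(\<Sum>q<n. del_pow k \<omega> \<omega>' (a, b) (c, q) * \<omega>' $$ (q, d))
        = (\<Sum>i<k. (\<omega> ^\<^sub>m i) $$ (a, b) * (\<Sum>q<n. (\<omega>' ^\<^sub>m (k - 1 - i)) $$ (c, q) * \<omega>' $$ (q, d)))"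
      unfolding del_pow_def sum_distrib_right sum_distrib_left
      by (subst sum.swap) (simp only: mult.assoc)
    also have "\<dots> = (\<Sum>i<k. (\<omega> ^\<^sub>m i) $$ (a, b) * (\<omega>' ^\<^sub>m (k - i)) $$ (c, d))"
      unfolding 2 by (intro sum.cong) (auto simp: Suc_diff_Suc simp del: pow_mat.simps)
    finally have 3: "(\<Sum>q<n. del_pow k \<omega> \<omega>' (a, b) (c, q) * \<omega>' $$ (q, d)) = \<dots>" .
    have "(\<Sum>q<n. \<epsilon> * del_pow k \<omega> \<omega>' (a, b) (c, q) * ?U $$ (m + q, m + d))
        = \<epsilon> * (\<Sum>q<n. del_pow k \<omega> \<omega>' (a, b) (c, q) * \<omega>' $$ (q, d))"
      unfolding sum_distrib_left using d by (intro sum.cong) (auto simp: upper_block_index[OF \<omega> \<omega>'])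
    then show "(?U ^\<^sub>m Suc k) $$ (a, m + d) = \<epsilon> * del_pow (Suc k) \<omega> \<omega>' (a, b) (c, d)"
      using d unfolding step[OF nat_add_left_cancel_less[THEN iffD2, OF d]] 1 3
      by (simp add: del_pow_def distrib_left del: pow_mat.simps)
  qed
qed

lemma upper_block_pow_corner:
  assumes "\<omega> \<in> carrier_mat m m" "\<omega>' \<in> carrier_mat n n" "(a, b) \<in> idx m" "(c, d) \<in> idx n"
  shows "(upper_block m n \<omega> \<omega>' b c \<epsilon> ^\<^sub>m k) $$ (a, m + d) = \<epsilon> * del_pow k \<omega> \<omega>' (a, b) (c, d)"
  using upper_block_pow[of \<omega> m \<omega>' n b c a] assms by (auto simp: idx_def)

lemma upper_block_in_RD0:
  assumes \<omega>: "\<omega> \<in> RD0 R m" and \<omega>': "\<omega>' \<in> RD0 R n"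
  obtains \<delta> where "\<delta> > 0" "\<And>\<epsilon>. cmod \<epsilon> < \<delta> \<Longrightarrow> upper_block m n \<omega> \<omega>' b c \<epsilon> \<in> RD0 R (m + n)"
proof -
  note c = RD0_carrier[OF \<omega>] RD0_carrier[OF \<omega>']
  define K where "K = upper_block m n (0\<^sub>m m m) (0\<^sub>m n n) b c 1"
  have K: "K \<in> carrier_mat (m + n) (m + n)" unfolding K_def by (rule upper_block_carrier) auto
  have eq: "upper_block m n \<omega> \<omega>' b c \<epsilon> = dir_sum \<omega> \<omega>' + \<epsilon> \<cdot>\<^sub>m K" for \<epsilon>
    using c by (intro eq_matI) (auto simp: K_def upper_block_def dir_sum_def matrix_unit_def)
  define \<rho> where "\<rho> = max (op_norm \<omega>) (op_norm \<omega>')"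
  have \<rho>: "\<rho> < R" using RD0_norm[OF \<omega>] RD0_norm[OF \<omega>'] by (simp add: \<rho>_def)
  have ds: "dir_sum \<omega> \<omega>' \<in> carrier_mat (m + n) (m + n)" by (rule dir_sum_carrier[OF c])
  have dsn: "op_norm (dir_sum \<omega> \<omega>') \<le> \<rho>" by (rule op_norm_dir_sum[OF c]) (auto simp: \<rho>_def)
  have K0: "op_norm K \<ge> 0" by (rule op_norm_nonneg[OF K])
  define \<delta> where "\<delta> = (R - \<rho>) / (op_norm K + 1)"
  have \<delta>: "\<delta> > 0" using \<rho> K0 by (simp add: \<delta>_def)
  have "upper_block m n \<omega> \<omega>' b c \<epsilon> \<in> RD0 R (m + n)" if "cmod \<epsilon> < \<delta>" for \<epsilon>
  proof -
    have "op_norm (dir_sum \<omega> \<omega>' + \<epsilon> \<cdot>\<^sub>m K) \<le> op_norm (dir_sum \<omega> \<omega>') + op_norm (\<epsilon> \<cdot>\<^sub>m K)"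
      using K by (intro op_norm_add[OF ds]) simp
    also have "\<dots> \<le> \<rho> + cmod \<epsilon> * op_norm K" by (intro add_mono dsn op_norm_smult[OF K])
    also have "cmod \<epsilon> * op_norm K \<le> cmod \<epsilon> * (op_norm K + 1)" by (simp add: mult_left_mono)
    also have "cmod \<epsilon> * (op_norm K + 1) < \<delta> * (op_norm K + 1)" using that K0 by simp
    also have "\<delta> * (op_norm K + 1) = R - \<rho>" using K0 by (simp add: \<delta>_def)
    finally have "op_norm (upper_block m n \<omega> \<omega>' b c \<epsilon>) < R" unfolding eq by simp
    then show ?thesis using upper_block_carrier[OF c] RD0_pos[OF \<omega>] by (simp add: RD0_def)
  qed
  then show thesis using that \<delta> by blast
qed

lemma has_sum_sum_finite:
  fixes f :: "'i \<Rightarrow> 'k \<Rightarrow> complex"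
  assumes "finite A" "\<And>i. i \<in> A \<Longrightarrow> (f i has_sum S i) B"
  shows "((\<lambda>k. \<Sum>i\<in>A. f i k) has_sum (\<Sum>i\<in>A. S i)) B"
  using assms by (induction A rule: finite_induct) (auto intro: has_sum_add)

text \<open>Near 0 the function \<open>G\<close> is linear, so that its derivative can be read off from one value,
  without differentiating a series.\<close>

lemma has_sum_deriv_line:
  fixes G :: "complex \<Rightarrow> complex" and g :: "'k \<Rightarrow> complex"
  assumes \<delta>: "\<delta> > 0" and G: "\<And>\<epsilon>. cmod \<epsilon> < \<delta> \<Longrightarrow> ((\<lambda>k. \<epsilon> * g k) has_sum G \<epsilon>) A"
  shows "(g has_sum deriv G 0) A"
proof -
  define e where "e = complex_of_real (\<delta> / 2)"
  have e: "e \<noteq> 0" "cmod e < \<delta>" using \<delta> unfolding e_def norm_of_real by auto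
  define S where "S = G e / e"
  have S: "(g has_sum S) A"
    using has_sum_cmult_right[OF G[OF e(2)], of "1 / e"] e(1) by (simp add: S_def)
  have eq: "G \<epsilon> = \<epsilon> * S" if "cmod \<epsilon> < \<delta>" for \<epsilon>
    using has_sum_unique[OF G[OF that] has_sum_cmult_right[OF S]] .
  have "eventually (\<lambda>\<epsilon>. \<epsilon> \<in> ball 0 \<delta>) (nhds (0 :: complex))"
    using \<delta> by (intro eventually_nhds_in_open) auto
  then have "eventually (\<lambda>\<epsilon>. G \<epsilon> = \<epsilon> * S) (nhds 0)"
    by (rule eventually_mono) (simp add: eq)
  then have "deriv G 0 = deriv (\<lambda>\<epsilon>. \<epsilon> * S) 0" by (rule deriv_cong_ev) simp
  also have "\<dots> = S" by (rule DERIV_imp_deriv) (auto intro!: derivative_eq_intros)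
  finally show ?thesis using S by simp
qed

lemma similar_index:
  assumes "A \<in> carrier_mat n n" "s \<in> carrier_mat n n" "t \<in> carrier_mat n n" "i < n" "j < n"
  shows "(s * A * t) $$ (i, j) = (\<Sum>q<n. \<Sum>p<n. s $$ (i, p) * A $$ (p, q) * t $$ (q, j))"
proof -
  have "(s * A * t) $$ (i, j) = (\<Sum>q<n. (s * A) $$ (i, q) * t $$ (q, j))"
    using assms by (intro mult_mat_index[of _ n n _ n]) auto
  also have "\<dots> = (\<Sum>q<n. (\<Sum>p<n. s $$ (i, p) * A $$ (p, q)) * t $$ (q, j))"
    using assms by (intro sum.cong refl arg_cong2[where f = "(*)"] mult_mat_index[of _ n n _ n]) auto
  finally show ?thesis by (simp add: sum_distrib_right)
qed

text \<open>A matrix power series is compatible with similarities; therefore its extension agrees with it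
  on the original domain. Analyticity is not needed for this.\<close>

lemma series1_ext1:
  assumes ser: "series1 R c h" and \<omega>: "\<omega> \<in> RD0 R n"
  shows "ext1 (RD0 R) h n \<omega> = h n \<omega>"
proof -
  have sim: "h n \<omega> = s * h n w * t" if w: "w \<in> RD0 R n" and st: "similar_mat_wit \<omega> w s t" for w s t
  proof -
    note D = similar_mat_witD2[OF RD0_carrier[OF \<omega>] st]
    have wc: "w \<in> carrier_mat n n" and sc: "s \<in> carrier_mat n n" and tc: "t \<in> carrier_mat n n"
      using D by blast+
    show ?thesis
    proof (rule eq_matI)
      fix i j assume "i < dim_row (s * h n w * t)" "j < dim_col (s * h n w * t)"
      then have ij: "i < n" "j < n" using sc tc by auto
      have "((\<lambda>k. \<Sum>q<n. \<Sum>p<n. s $$ (i, p) * (c k * (w ^\<^sub>m k) $$ (p, q)) * t $$ (q, j)) has_sum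
          (\<Sum>q<n. \<Sum>p<n. s $$ (i, p) * h n w $$ (p, q) * t $$ (q, j))) UNIV"
        by (intro has_sum_sum_finite has_sum_cmult_left has_sum_cmult_right series1D[OF ser w])
          (auto simp: idx_def)
      moreover have "(\<Sum>q<n. \<Sum>p<n. s $$ (i, p) * (c k * (w ^\<^sub>m k) $$ (p, q)) * t $$ (q, j))
          = c k * (\<omega> ^\<^sub>m k) $$ (i, j)" for k
        unfolding similar_mat_wit_pow_id[OF st] similar_index[OF pow_carrier_mat[OF wc] sc tc ij]
        by (simp add: sum_distrib_left mult_ac)
      ultimately have "((\<lambda>k. c k * (\<omega> ^\<^sub>m k) $$ (i, j)) has_sum (s * h n w * t) $$ (i, j)) UNIV"
        unfolding similar_index[OF series1_carrier[OF ser w] sc tc ij] by simp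
      moreover have "((\<lambda>k. c k * (\<omega> ^\<^sub>m k) $$ (i, j)) has_sum h n \<omega> $$ (i, j)) UNIV"
        using ij by (intro series1D[OF ser \<omega>]) (auto simp: idx_def)
      ultimately show "h n \<omega> $$ (i, j) = (s * h n w * t) $$ (i, j)" using has_sum_unique by blast
    qed (use series1_carrier[OF ser \<omega>] sc tc in auto)
  qed
  have "similar_mat_wit \<omega> \<omega> (1\<^sub>m n) (1\<^sub>m n)" by (rule similar_mat_wit_refl[OF RD0_carrier[OF \<omega>]])
  then have "\<exists>w\<in>RD0 R n. \<exists>s t. similar_mat_wit \<omega> w s t \<and> h n \<omega> = s * h n w * t"
    using sim[OF \<omega>] \<omega> by blast
  then show ?thesis
    unfolding ext1_def
  proof (rule the_equality)
    fix A assume "\<exists>w\<in>RD0 R n. \<exists>s t. similar_mat_wit \<omega> w s t \<and> A = s * h n w * t"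
    then obtain w s t where "w \<in> RD0 R n" "similar_mat_wit \<omega> w s t" and A: "A = s * h n w * t"
      by (elim bexE exE conjE) (rule that)
    then show "A = h n \<omega>" unfolding A by (intro sim[symmetric])
  qed
qed

lemma A2_ext2:
  assumes f: "f \<in> A2 (RD0 R)" and \<omega>: "\<omega> \<in> RD0 R m" and \<eta>: "\<eta> \<in> RD0 R n"
  shows "ext2 (RD0 R) f m n \<omega> \<eta> = f m n \<omega> \<eta>"
proof -
  have sim: "conj_leg1 m n s t (conj_leg2 m n u v (f m n w h)) = f m n \<omega> \<eta>"
    if "w \<in> RD0 R m" "h \<in> RD0 R n" "similar_mat_wit \<omega> w s t" "similar_mat_wit \<eta> h u v" for w h s t u v
    using A2_similar1[OF f that(1) \<omega> \<eta> that(3)] A2_similar2[OF f that(1,2) \<eta> that(4)] by simp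
  have r: "similar_mat_wit \<omega> \<omega> (1\<^sub>m m) (1\<^sub>m m)" "similar_mat_wit \<eta> \<eta> (1\<^sub>m n) (1\<^sub>m n)"
    using similar_mat_wit_refl[OF RD0_carrier[OF \<omega>]] similar_mat_wit_refl[OF RD0_carrier[OF \<eta>]] by blast+
  have ex: "\<exists>w\<in>RD0 R m. \<exists>h\<in>RD0 R n. \<exists>s t u v. similar_mat_wit \<omega> w s t \<and> similar_mat_wit \<eta> h u v \<and>
      f m n \<omega> \<eta> = conj_leg1 m n s t (conj_leg2 m n u v (f m n w h))"
    by (rule bexI[OF _ \<omega>], rule bexI[OF _ \<eta>], intro exI conjI, rule r(1), rule r(2),
        rule sim[OF \<omega> \<eta> r, symmetric])
  show ?thesis
    unfolding ext2_def
  proof (rule the_equality, rule ex)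
    fix T assume "\<exists>w\<in>RD0 R m. \<exists>h\<in>RD0 R n. \<exists>s t u v. similar_mat_wit \<omega> w s t \<and> similar_mat_wit \<eta> h u v \<and>
      T = conj_leg1 m n s t (conj_leg2 m n u v (f m n w h))"
    then obtain w h s t u v where "w \<in> RD0 R m" "h \<in> RD0 R n" "similar_mat_wit \<omega> w s t" "similar_mat_wit \<eta> h u v"
      and T: "T = conj_leg1 m n s t (conj_leg2 m n u v (f m n w h))"
      by (elim bexE exE conjE) (rule that)
    then show "T = f m n \<omega> \<eta>" unfolding T by (intro sim)
  qed
qed

text \<open>The action of \<open>\<partial>\<close>, \<open>\<partial> \<otimes> id\<close> and \<open>id \<otimes> \<partial>\<close> on power series, term by term.\<close>

lemma del_series:
  assumes ser: "series1 R c h" and \<omega>: "\<omega> \<in> RD0 R m" and \<omega>': "\<omega>' \<in> RD0 R n" and x: "x \<in> idx m" and y: "y \<in> idx n"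
  shows "((\<lambda>k. c k * del_pow k \<omega> \<omega>' x y) has_sum del (RD0 R) h m n \<omega> \<omega>' x y) UNIV"
proof -
  obtain a b where ab: "x = (a, b)" by (cases x)
  obtain p q where pq: "y = (p, q)" by (cases y)
  note xy = x[unfolded ab] y[unfolded pq]
  obtain \<delta> where \<delta>: "\<delta> > 0" "\<And>\<epsilon>. cmod \<epsilon> < \<delta> \<Longrightarrow> upper_block m n \<omega> \<omega>' b p \<epsilon> \<in> RD0 R (m + n)"
    using upper_block_in_RD0[OF \<omega> \<omega>'] by blast
  have "((\<lambda>k. \<epsilon> * (c k * del_pow k \<omega> \<omega>' x y)) has_sum
      ext1 (RD0 R) h (m + n) (upper_block m n \<omega> \<omega>' b p \<epsilon>) $$ (a, m + q)) UNIV" if \<epsilon>: "cmod \<epsilon> < \<delta>" for \<epsilon>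
  proof -
    have "(a, m + q) \<in> idx (m + n)" using xy by (auto simp: idx_def)
    moreover have ext: "ext1 (RD0 R) h (m + n) (upper_block m n \<omega> \<omega>' b p \<epsilon>)
        = h (m + n) (upper_block m n \<omega> \<omega>' b p \<epsilon>)"
      by (rule series1_ext1[OF ser \<delta>(2)[OF \<epsilon>]])
    ultimately show ?thesis
      using series1D[OF ser \<delta>(2)[OF \<epsilon>], of "(a, m + q)"] unfolding ext
        upper_block_pow_corner[OF RD0_carrier[OF \<omega>] RD0_carrier[OF \<omega>'] xy] ab pq
      by (simp only: mult.left_commute)
  qed
  from has_sum_deriv_line[OF \<delta>(1) this] show ?thesis
    using x y unfolding ab pq del_def mk2_def by simp
qed

lemma del_id_series:
  assumes ser: "series2 R a f" and f: "f \<in> A2 (RD0 R)"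
    and \<omega>: "\<omega> \<in> RD0 R m" and \<omega>': "\<omega>' \<in> RD0 R n" and \<omega>'': "\<omega>'' \<in> RD0 R l"
    and x: "x \<in> idx m" and y: "y \<in> idx n" and z: "z \<in> idx l"
  shows "((\<lambda>(i, j). a i j * (del_pow i \<omega> \<omega>' x y * (\<omega>'' ^\<^sub>m j) $$ z))
    has_sum del_id (RD0 R) f m n l \<omega> \<omega>' \<omega>'' x y z) UNIV"
proof -
  obtain a' b where ab: "x = (a', b)" by (cases x)
  obtain p q where pq: "y = (p, q)" by (cases y)
  note xy = x[unfolded ab] y[unfolded pq]
  obtain \<delta> where \<delta>: "\<delta> > 0" "\<And>\<epsilon>. cmod \<epsilon> < \<delta> \<Longrightarrow> upper_block m n \<omega> \<omega>' b p \<epsilon> \<in> RD0 R (m + n)"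
    using upper_block_in_RD0[OF \<omega> \<omega>'] by blast
  have "((\<lambda>k. \<epsilon> * (case k of (i, j) \<Rightarrow> a i j * (del_pow i \<omega> \<omega>' x y * (\<omega>'' ^\<^sub>m j) $$ z))) has_sum
      ext2 (RD0 R) f (m + n) l (upper_block m n \<omega> \<omega>' b p \<epsilon>) \<omega>'' (a', m + q) z) UNIV" if \<epsilon>: "cmod \<epsilon> < \<delta>" for \<epsilon>
  proof -
    have "(a', m + q) \<in> idx (m + n)" using xy by (auto simp: idx_def)
    from series2D[OF ser \<delta>(2)[OF \<epsilon>] \<omega>'' this z] show ?thesis
      unfolding A2_ext2[OF f \<delta>(2)[OF \<epsilon>] \<omega>'']
        upper_block_pow_corner[OF RD0_carrier[OF \<omega>] RD0_carrier[OF \<omega>'] xy] ab pq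
      by (simp add: case_prod_unfold mult_ac)
  qed
  from has_sum_deriv_line[OF \<delta>(1) this] show ?thesis
    using x y z unfolding ab pq del_id_def mk3_def by simp
qed

lemma id_del_series:
  assumes ser: "series2 R a f" and f: "f \<in> A2 (RD0 R)"
    and \<omega>'': "\<omega>'' \<in> RD0 R l" and \<omega>: "\<omega> \<in> RD0 R m" and \<omega>': "\<omega>' \<in> RD0 R n"
    and z: "z \<in> idx l" and x: "x \<in> idx m" and y: "y \<in> idx n"
  shows "((\<lambda>(i, j). a i j * ((\<omega>'' ^\<^sub>m i) $$ z * del_pow j \<omega> \<omega>' x y))
    has_sum id_del (RD0 R) f l m n \<omega>'' \<omega> \<omega>' z x y) UNIV"
proof -
  obtain a' b where ab: "x = (a', b)" by (cases x)
  obtain p q where pq: "y = (p, q)" by (cases y)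
  note xy = x[unfolded ab] y[unfolded pq]
  obtain \<delta> where \<delta>: "\<delta> > 0" "\<And>\<epsilon>. cmod \<epsilon> < \<delta> \<Longrightarrow> upper_block m n \<omega> \<omega>' b p \<epsilon> \<in> RD0 R (m + n)"
    using upper_block_in_RD0[OF \<omega> \<omega>'] by blast
  have "((\<lambda>k. \<epsilon> * (case k of (i, j) \<Rightarrow> a i j * ((\<omega>'' ^\<^sub>m i) $$ z * del_pow j \<omega> \<omega>' x y))) has_sum
      ext2 (RD0 R) f l (m + n) \<omega>'' (upper_block m n \<omega> \<omega>' b p \<epsilon>) z (a', m + q)) UNIV" if \<epsilon>: "cmod \<epsilon> < \<delta>" for \<epsilon>
  proof -
    have "(a', m + q) \<in> idx (m + n)" using xy by (auto simp: idx_def)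
    from series2D[OF ser \<omega>'' \<delta>(2)[OF \<epsilon>] z this] show ?thesis
      unfolding A2_ext2[OF f \<omega>'' \<delta>(2)[OF \<epsilon>]]
        upper_block_pow_corner[OF RD0_carrier[OF \<omega>] RD0_carrier[OF \<omega>'] xy] ab pq
      by (simp add: case_prod_unfold mult_ac)
  qed
  from has_sum_deriv_line[OF \<delta>(1) this] show ?thesis
    using x y z unfolding ab pq id_del_def mk3_def by simp
qed

section \<open>Contraction with the coordinate function\<close>

lemma hash_index: "i < n \<Longrightarrow> q < n \<Longrightarrow> hash n T b $$ (i, q) = (\<Sum>j<n. \<Sum>p<n. T (i, j) (p, q) * b $$ (j, p))"
  by (simp add: hash_def)

lemma hash_has_sum:
  assumes "\<And>u v. u \<in> idx n \<Longrightarrow> v \<in> idx n \<Longrightarrow> ((\<lambda>k. F k u v) has_sum T u v) A" "x \<in> idx n"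
  shows "((\<lambda>k. hash n (F k) b $$ x) has_sum hash n T b $$ x) A"
proof -
  obtain i q where x: "x = (i, q)" "i < n" "q < n" using assms(2) by (cases x) (auto simp: idx_def)
  show ?thesis
    unfolding x(1) hash_index[OF x(2,3)] using x
    by (intro has_sum_sum_finite has_sum_cmult_left assms(1)) (auto simp: idx_def)
qed

lemma hash_pow:
  assumes \<omega>: "\<omega> \<in> carrier_mat n n" and x: "x \<in> idx n"
  shows "hash n (\<lambda>u v. (\<omega> ^\<^sub>m k) $$ u * (\<omega> ^\<^sub>m l) $$ v) \<omega> $$ x = (\<omega> ^\<^sub>m (k + l + 1)) $$ x"
proof -
  obtain i q where iq: "x = (i, q)" "i < n" "q < n" using x by (cases x) (auto simp: idx_def)
  have "\<omega> ^\<^sub>m (k + l + 1) = \<omega> ^\<^sub>m (k + 1) * \<omega> ^\<^sub>m l"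
    using pow_mat_add[OF \<omega>, of "k + 1" l] by (simp add: add.commute add.left_commute)
  also have "\<dots> = \<omega> ^\<^sub>m k * \<omega> * \<omega> ^\<^sub>m l" by simp
  finally have "(\<omega> ^\<^sub>m (k + l + 1)) $$ (i, q)
      = (\<Sum>p<n. \<Sum>j<n. (\<omega> ^\<^sub>m k) $$ (i, j) * \<omega> $$ (j, p) * (\<omega> ^\<^sub>m l) $$ (p, q))"
    using similar_index[OF \<omega> pow_carrier_mat[OF \<omega>] pow_carrier_mat[OF \<omega>] iq(2,3)] by simp
  then show ?thesis
    unfolding iq(1) hash_index[OF iq(2,3)] by (subst sum.swap) (simp add: mult_ac)
qed

lemma hash_scale: "hash n (\<lambda>u v. c * T u v) b $$ x = c * hash n T b $$ x" if "x \<in> idx n"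
  using that by (cases x) (auto simp: idx_def hash_index sum_distrib_left mult_ac)

lemma hash_sum: "hash n (\<lambda>u v. \<Sum>i\<in>A. T i u v) b $$ x = (\<Sum>i\<in>A. hash n (T i) b $$ x)" if x: "x \<in> idx n"
proof -
  obtain i q where iq: "x = (i, q)" "i < n" "q < n" using x by (cases x) (auto simp: idx_def)
  have "(\<Sum>k\<in>A. \<Sum>j<n. \<Sum>p<n. T k (i, j) (p, q) * b $$ (j, p))
      = (\<Sum>j<n. \<Sum>k\<in>A. \<Sum>p<n. T k (i, j) (p, q) * b $$ (j, p))"
    by (rule sum.swap)
  also have "\<dots> = (\<Sum>j<n. \<Sum>p<n. \<Sum>k\<in>A. T k (i, j) (p, q) * b $$ (j, p))"
    by (intro sum.cong refl sum.swap)
  finally show ?thesis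
    unfolding iq(1) hash_index[OF iq(2,3)] sum_distrib_right by (rule sym)
qed

text \<open>Contracting \<open>\<partial>(z\<^sup>k)\<close> with \<open>z\<close> gives \<open>k z\<^sup>k\<close>.\<close>

lemma hash_del_pow:
  assumes \<omega>: "\<omega> \<in> carrier_mat n n" and x: "x \<in> idx n"
  shows "hash n (\<lambda>u v. del_pow k \<omega> \<omega> u v) \<omega> $$ x = of_nat k * (\<omega> ^\<^sub>m k) $$ x"
proof -
  have "hash n (\<lambda>u v. del_pow k \<omega> \<omega> u v) \<omega> $$ x = (\<Sum>i<k. (\<omega> ^\<^sub>m (i + (k - 1 - i) + 1)) $$ x)"
    unfolding del_pow_def hash_sum[OF x] hash_pow[OF \<omega> x] ..
  also have "\<dots> = (\<Sum>i<k. (\<omega> ^\<^sub>m k) $$ x)" by (intro sum.cong) auto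
  finally show ?thesis by simp
qed

lemma del_star_series:
  assumes ser: "series2 R a f" and \<omega>: "\<omega> \<in> RD0 R n" and x: "x \<in> idx n"
  shows "((\<lambda>(k, l). a k l * (\<omega> ^\<^sub>m (k + l + 1)) $$ x) has_sum del_star f n \<omega> $$ x) UNIV"
proof -
  have "((\<lambda>p. hash n (\<lambda>u v. a (fst p) (snd p) * ((\<omega> ^\<^sub>m fst p) $$ u * (\<omega> ^\<^sub>m snd p) $$ v)) \<omega> $$ x)
      has_sum del_star f n \<omega> $$ x) UNIV"
    unfolding del_star_def z_theta_def
    using series2D[OF ser \<omega> \<omega>] by (intro hash_has_sum[OF _ x]) (simp add: case_prod_unfold)
  then show ?thesis
    unfolding hash_scale[OF x] hash_pow[OF RD0_carrier[OF \<omega>] x] by (simp add: case_prod_unfold)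
qed

lemma N2_series:
  assumes ser: "series2 R a f" and f: "f \<in> A2 (RD0 R)"
    and \<omega>: "\<omega> \<in> RD0 R m" and \<omega>': "\<omega>' \<in> RD0 R n" and x: "x \<in> idx m" and y: "y \<in> idx n"
  shows "((\<lambda>(k, l). of_nat (k + l + 1) * a k l * ((\<omega> ^\<^sub>m k) $$ x * (\<omega>' ^\<^sub>m l) $$ y))
    has_sum N2 (RD0 R) f m n \<omega> \<omega>' x y) UNIV"
proof -
  have "((\<lambda>p. hash m (\<lambda>u v. a (fst p) (snd p) * (\<omega>' ^\<^sub>m snd p) $$ y * del_pow (fst p) \<omega> \<omega> u v) \<omega> $$ x)
      has_sum hash m (\<lambda>u v. del_id (RD0 R) f m m n \<omega> \<omega> \<omega>' u v y) \<omega> $$ x) UNIV"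
    using del_id_series[OF ser f \<omega> \<omega> \<omega>' _ _ y]
    by (intro hash_has_sum[OF _ x]) (simp add: case_prod_unfold mult_ac)
  then have 1: "((\<lambda>p. of_nat (fst p) * (a (fst p) (snd p) * ((\<omega> ^\<^sub>m fst p) $$ x * (\<omega>' ^\<^sub>m snd p) $$ y)))
      has_sum N_id (RD0 R) f m n \<omega> \<omega>' x y) UNIV"
    unfolding hash_scale[OF x] hash_del_pow[OF RD0_carrier[OF \<omega>] x]
    using x y by (simp add: N_id_def del_star_id_def hash12_def mk2_def z_theta_def mult_ac)
  have "((\<lambda>p. hash n (\<lambda>u v. a (fst p) (snd p) * (\<omega> ^\<^sub>m fst p) $$ x * del_pow (snd p) \<omega>' \<omega>' u v) \<omega>' $$ y)
      has_sum hash n (\<lambda>u v. id_del (RD0 R) f m n n \<omega> \<omega>' \<omega>' x u v) \<omega>' $$ y) UNIV"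
    using id_del_series[OF ser f \<omega> \<omega>' \<omega>' x]
    by (intro hash_has_sum[OF _ y]) (simp add: case_prod_unfold mult_ac)
  then have 2: "((\<lambda>p. of_nat (snd p) * (a (fst p) (snd p) * ((\<omega> ^\<^sub>m fst p) $$ x * (\<omega>' ^\<^sub>m snd p) $$ y)))
      has_sum id_N (RD0 R) f m n \<omega> \<omega>' x y) UNIV"
    unfolding hash_scale[OF y] hash_del_pow[OF RD0_carrier[OF \<omega>'] y]
    using x y by (simp add: id_N_def id_del_star_def hash23_def mk2_def z_theta_def mult_ac)
  have "of_nat k * c + of_nat l * c + a k l * e = of_nat (k + l + 1) * a k l * e"
    if "c = a k l * e" for k l and c e :: complex
    unfolding that by (simp add: distrib_right)
  then show ?thesis
    using has_sum_add[OF has_sum_add[OF 1 2] series2D[OF ser \<omega> \<omega>' x y]]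
    unfolding N2_def by (simp add: case_prod_unfold)
qed

section \<open>Multiplication by the coordinate function\<close>

lemma cdiff1_zero: "cdiff1 n (\<lambda>_. 0) \<omega>"
  unfolding cdiff1_def
  by (intro exI[of _ "\<lambda>_. 0"] allI impI exI[of _ 1]) (auto intro!: mult_nonneg_nonneg op_norm_nonneg)

lemma cdiff1_add:
  assumes F: "cdiff1 n F \<omega>" and G: "cdiff1 n G \<omega>"
  shows "cdiff1 n (\<lambda>w. F w + G w) \<omega>"
proof -
  obtain D where D: "\<forall>e>0. \<exists>\<delta>>0. \<forall>h \<in> carrier_mat n n. op_norm h < \<delta> \<longrightarrow>
     cmod (F (\<omega> + h) - F \<omega> - (\<Sum>x\<in>idx n. D x * h $$ x)) \<le> e * op_norm h"
    using F[unfolded cdiff1_def] by (elim exE) (rule that)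
  obtain E where E: "\<forall>e>0. \<exists>\<delta>>0. \<forall>h \<in> carrier_mat n n. op_norm h < \<delta> \<longrightarrow>
     cmod (G (\<omega> + h) - G \<omega> - (\<Sum>x\<in>idx n. E x * h $$ x)) \<le> e * op_norm h"
    using G[unfolded cdiff1_def] by (elim exE) (rule that)
  show ?thesis
    unfolding cdiff1_def
  proof (rule exI[of _ "\<lambda>x. D x + E x"], intro allI impI)
    fix e :: real assume "e > 0"
    then have e2: "e / 2 > 0" by simp
    obtain \<delta> where \<delta>: "\<delta> > 0" "\<forall>h \<in> carrier_mat n n. op_norm h < \<delta> \<longrightarrow>
       cmod (F (\<omega> + h) - F \<omega> - (\<Sum>x\<in>idx n. D x * h $$ x)) \<le> (e / 2) * op_norm h"
      using D[rule_format, OF e2] by (elim exE conjE) (rule that)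
    obtain \<delta>' where \<delta>': "\<delta>' > 0" "\<forall>h \<in> carrier_mat n n. op_norm h < \<delta>' \<longrightarrow>
       cmod (G (\<omega> + h) - G \<omega> - (\<Sum>x\<in>idx n. E x * h $$ x)) \<le> (e / 2) * op_norm h"
      using E[rule_format, OF e2] by (elim exE conjE) (rule that)
    show "\<exists>\<delta>>0. \<forall>h \<in> carrier_mat n n. op_norm h < \<delta> \<longrightarrow>
       cmod (F (\<omega> + h) + G (\<omega> + h) - (F \<omega> + G \<omega>) - (\<Sum>x\<in>idx n. (D x + E x) * h $$ x)) \<le> e * op_norm h"
    proof (rule exI[of _ "min \<delta> \<delta>'"], intro conjI ballI impI)
      fix h assume h: "h \<in> carrier_mat n n" "op_norm h < min \<delta> \<delta>'"
      have "F (\<omega> + h) + G (\<omega> + h) - (F \<omega> + G \<omega>) - (\<Sum>x\<in>idx n. (D x + E x) * h $$ x)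
          = (F (\<omega> + h) - F \<omega> - (\<Sum>x\<in>idx n. D x * h $$ x)) + (G (\<omega> + h) - G \<omega> - (\<Sum>x\<in>idx n. E x * h $$ x))"
        by (simp add: distrib_right sum.distrib)
      then have "cmod (F (\<omega> + h) + G (\<omega> + h) - (F \<omega> + G \<omega>) - (\<Sum>x\<in>idx n. (D x + E x) * h $$ x))
          \<le> cmod (F (\<omega> + h) - F \<omega> - (\<Sum>x\<in>idx n. D x * h $$ x)) + cmod (G (\<omega> + h) - G \<omega> - (\<Sum>x\<in>idx n. E x * h $$ x))"
        by (simp only: norm_triangle_ineq)
      also have "\<dots> \<le> (e / 2) * op_norm h + (e / 2) * op_norm h"
        using \<delta>(2)[rule_format, OF h(1)] \<delta>'(2)[rule_format, OF h(1)] h(2) by (intro add_mono) auto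
      finally show "cmod (F (\<omega> + h) + G (\<omega> + h) - (F \<omega> + G \<omega>) - (\<Sum>x\<in>idx n. (D x + E x) * h $$ x))
          \<le> e * op_norm h" by simp
    qed (use \<delta>(1) \<delta>'(1) in simp)
  qed
qed

lemma cdiff1_sum:
  assumes "finite I" "\<And>i. i \<in> I \<Longrightarrow> cdiff1 n (F i) \<omega>"
  shows "cdiff1 n (\<lambda>w. \<Sum>i\<in>I. F i w) \<omega>"
  using assms by (induction I rule: finite_induct) (auto simp: cdiff1_zero intro: cdiff1_add)

lemma cdiff1_coordinate_mult:
  assumes G: "cdiff1 n G \<omega>" and p: "p \<in> idx n" and \<omega>: "\<omega> \<in> carrier_mat n n"
  shows "cdiff1 n (\<lambda>w. w $$ p * G w) \<omega>"
proof -
  obtain D where D: "\<forall>e>0. \<exists>\<delta>>0. \<forall>h \<in> carrier_mat n n. op_norm h < \<delta> \<longrightarrow>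
     cmod (G (\<omega> + h) - G \<omega> - (\<Sum>x\<in>idx n. D x * h $$ x)) \<le> e * op_norm h"
    using G[unfolded cdiff1_def] by (elim exE) (rule that)
  obtain C \<delta>\<^sub>0 where C: "C \<ge> 0" "\<delta>\<^sub>0 > 0"
    "\<And>h. h \<in> carrier_mat n n \<Longrightarrow> op_norm h < \<delta>\<^sub>0 \<Longrightarrow> cmod (G (\<omega> + h) - G \<omega>) \<le> C * op_norm h"
    using cdiff1_lipschitz[OF G] by blast
  show ?thesis
    unfolding cdiff1_def
  proof (rule exI[of _ "\<lambda>x. \<omega> $$ p * D x + (if x = p then G \<omega> else 0)"], intro allI impI)
    fix e :: real assume e: "e > 0"
    define e1 where "e1 = e / (2 * (cmod (\<omega> $$ p) + 1))"
    define \<delta>\<^sub>1 where "\<delta>\<^sub>1 = e / (2 * (C + 1))"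
    have half: "0 < e / (2 * (c + 1))" "c * (e / (2 * (c + 1))) \<le> e / 2" if "c \<ge> 0" for c
    proof -
      have c1: "c + 1 > 0" using that by simp
      then show pos: "0 < e / (2 * (c + 1))" using e by simp
      have "c * (e / (2 * (c + 1))) \<le> (c + 1) * (e / (2 * (c + 1)))"
        by (rule mult_right_mono) (use pos in auto)
      also have "\<dots> = e / 2" using c1 by (simp add: field_simps)
      finally show "c * (e / (2 * (c + 1))) \<le> e / 2" .
    qed
    have e1: "e1 > 0" and e1': "cmod (\<omega> $$ p) * e1 \<le> e / 2"
      unfolding e1_def by (rule half, simp)+
    have \<delta>1: "\<delta>\<^sub>1 > 0" and \<delta>1': "C * \<delta>\<^sub>1 \<le> e / 2"
      unfolding \<delta>\<^sub>1_def by (rule half, rule C(1))+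
    obtain \<delta> where \<delta>: "\<delta> > 0" "\<forall>h \<in> carrier_mat n n. op_norm h < \<delta> \<longrightarrow>
       cmod (G (\<omega> + h) - G \<omega> - (\<Sum>x\<in>idx n. D x * h $$ x)) \<le> e1 * op_norm h"
      using D[rule_format, OF e1] by (elim exE conjE) (rule that)
    show "\<exists>\<delta>>0. \<forall>h \<in> carrier_mat n n. op_norm h < \<delta> \<longrightarrow>
       cmod ((\<omega> + h) $$ p * G (\<omega> + h) - \<omega> $$ p * G \<omega>
         - (\<Sum>x\<in>idx n. (\<omega> $$ p * D x + (if x = p then G \<omega> else 0)) * h $$ x)) \<le> e * op_norm h"
    proof (rule exI[of _ "min \<delta> (min \<delta>\<^sub>0 \<delta>\<^sub>1)"], intro conjI ballI impI)
      fix h assume h: "h \<in> carrier_mat n n" "op_norm h < min \<delta> (min \<delta>\<^sub>0 \<delta>\<^sub>1)"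
      have h0: "op_norm h \<ge> 0" by (rule op_norm_nonneg[OF h(1)])
      have fin: "finite (idx n)" by (simp add: idx_def)
      have wh: "(\<omega> + h) $$ p = \<omega> $$ p + h $$ p" using p \<omega> h(1) by (auto simp: idx_def)
      have hp: "cmod (h $$ p) \<le> op_norm h" using p cmod_index_le_op_norm[OF h(1)] by (auto simp: idx_def)
      have "(\<Sum>x\<in>idx n. (\<omega> $$ p * D x + (if x = p then G \<omega> else 0)) * h $$ x)
          = \<omega> $$ p * (\<Sum>x\<in>idx n. D x * h $$ x) + (\<Sum>x\<in>idx n. if x = p then G \<omega> * h $$ p else 0)"
        unfolding sum_distrib_left sum.distrib[symmetric] by (intro sum.cong) (auto simp: algebra_simps)
      also have "(\<Sum>x\<in>idx n. if x = p then G \<omega> * h $$ p else 0) = G \<omega> * h $$ p"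
        using p fin by simp
      finally have "(\<omega> + h) $$ p * G (\<omega> + h) - \<omega> $$ p * G \<omega>
         - (\<Sum>x\<in>idx n. (\<omega> $$ p * D x + (if x = p then G \<omega> else 0)) * h $$ x)
         = \<omega> $$ p * (G (\<omega> + h) - G \<omega> - (\<Sum>x\<in>idx n. D x * h $$ x)) + h $$ p * (G (\<omega> + h) - G \<omega>)"
        unfolding wh by (simp only:) (simp add: algebra_simps)
      then have "cmod ((\<omega> + h) $$ p * G (\<omega> + h) - \<omega> $$ p * G \<omega>
         - (\<Sum>x\<in>idx n. (\<omega> $$ p * D x + (if x = p then G \<omega> else 0)) * h $$ x))
         \<le> cmod (\<omega> $$ p) * cmod (G (\<omega> + h) - G \<omega> - (\<Sum>x\<in>idx n. D x * h $$ x))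
           + cmod (h $$ p) * cmod (G (\<omega> + h) - G \<omega>)"
        by (simp only: norm_mult[symmetric] norm_triangle_ineq)
      also have "\<dots> \<le> cmod (\<omega> $$ p) * (e1 * op_norm h) + op_norm h * (C * op_norm h)"
        using \<delta>(2)[rule_format, OF h(1)] C(3)[OF h(1)] h(2) hp h0
        by (intro add_mono mult_mono) auto
      also have "\<dots> = (cmod (\<omega> $$ p) * e1) * op_norm h + (C * op_norm h) * op_norm h"
        by (simp only: mult_ac)
      also have "\<dots> \<le> (e / 2) * op_norm h + (e / 2) * op_norm h"
      proof -
        have "C * op_norm h \<le> C * \<delta>\<^sub>1" using h(2) C(1) by (intro mult_left_mono) auto
        then show ?thesis using e1' \<delta>1' h0 by (intro add_mono mult_right_mono) auto
      qed
      finally show "cmod ((\<omega> + h) $$ p * G (\<omega> + h) - \<omega> $$ p * G \<omega>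
         - (\<Sum>x\<in>idx n. (\<omega> $$ p * D x + (if x = p then G \<omega> else 0)) * h $$ x)) \<le> e * op_norm h" by simp
    qed (use \<delta>(1) C(2) \<delta>1 in simp)
  qed
qed

text \<open>Differentiability is local, and the domain is open.\<close>

lemma cdiff1_cong_RD0:
  assumes F: "cdiff1 n F \<omega>" and \<omega>: "\<omega> \<in> RD0 R n" and eq: "\<And>w. w \<in> RD0 R n \<Longrightarrow> F w = G w"
  shows "cdiff1 n G \<omega>"
proof -
  obtain D where D: "\<forall>e>0. \<exists>\<delta>>0. \<forall>h \<in> carrier_mat n n. op_norm h < \<delta> \<longrightarrow>
     cmod (F (\<omega> + h) - F \<omega> - (\<Sum>x\<in>idx n. D x * h $$ x)) \<le> e * op_norm h"
    using F[unfolded cdiff1_def] by (elim exE) (rule that)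
  show ?thesis
    unfolding cdiff1_def
  proof (rule exI[of _ D], intro allI impI)
    fix e :: real assume e: "e > 0"
    obtain \<delta> where \<delta>: "\<delta> > 0" "\<forall>h \<in> carrier_mat n n. op_norm h < \<delta> \<longrightarrow>
       cmod (F (\<omega> + h) - F \<omega> - (\<Sum>x\<in>idx n. D x * h $$ x)) \<le> e * op_norm h"
      using D[rule_format, OF e] by (elim exE conjE) (rule that)
    show "\<exists>\<delta>>0. \<forall>h \<in> carrier_mat n n. op_norm h < \<delta> \<longrightarrow>
       cmod (G (\<omega> + h) - G \<omega> - (\<Sum>x\<in>idx n. D x * h $$ x)) \<le> e * op_norm h"
    proof (rule exI[of _ "min \<delta> (R - op_norm \<omega>)"], intro conjI ballI impI)
      fix h assume h: "h \<in> carrier_mat n n" "op_norm h < min \<delta> (R - op_norm \<omega>)"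
      have "\<omega> + h \<in> RD0 R n"
        using op_norm_add[OF RD0_carrier[OF \<omega>] h(1)] h RD0_pos[OF \<omega>] RD0_carrier[OF \<omega>] by (simp add: RD0_def)
      then show "cmod (G (\<omega> + h) - G \<omega> - (\<Sum>x\<in>idx n. D x * h $$ x)) \<le> e * op_norm h"
        using \<delta>(2)[rule_format, OF h(1)] h(2) eq[OF \<omega>] eq[of "\<omega> + h"] by simp
    qed (use \<delta>(1) RD0_norm[OF \<omega>] in simp)
  qed
qed

lemma dir_sum_mult:
  assumes "A \<in> carrier_mat m m" "B \<in> carrier_mat n n" "A' \<in> carrier_mat m m" "B' \<in> carrier_mat n n"
  shows "dir_sum A B * dir_sum A' B' = dir_sum (A * A') (B * B')"
proof -
  have d: "dim_row A = m" "dim_col A = m" "dim_row B = n" "dim_col B = n"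
    "dim_row A' = m" "dim_col A' = m" "dim_row B' = n" "dim_col B' = n"
    using assms by auto
  show ?thesis
    unfolding dir_sum_def index_mult_mat d
    by (subst mult_four_block_mat[of A m m _ n _ n B _ m _ n]) (use assms in auto)
qed

text \<open>\<open>A(\<Omega>)\<close> is closed under multiplication by the coordinate function.\<close>

lemma A1_z_mult:
  assumes h: "h \<in> A1 (RD0 R)"
  shows "(\<lambda>n \<omega>. \<omega> * h n \<omega>) \<in> A1 (RD0 R)"
proof -
  have "\<omega> * h n \<omega> \<in> carrier_mat n n" if "\<omega> \<in> RD0 R n" for n \<omega>
    using RD0_carrier[OF that] A1_carrier[OF h that] by simp
  moreover have "cdiff1 n (\<lambda>w. (w * h n w) $$ x) \<omega>" if \<omega>: "\<omega> \<in> RD0 R n" and x: "x \<in> idx n" for n \<omega> x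
  proof (rule cdiff1_cong_RD0[OF _ \<omega>])
    obtain i j where ij: "x = (i, j)" "i < n" "j < n" using x by (cases x) (auto simp: idx_def)
    show "cdiff1 n (\<lambda>w. \<Sum>p<n. w $$ (fst x, p) * h n w $$ (p, snd x)) \<omega>"
      using ij by (intro cdiff1_sum cdiff1_coordinate_mult A1_cdiff1[OF h \<omega>] RD0_carrier[OF \<omega>]) (auto simp: idx_def)
    show "(\<Sum>p<n. w $$ (fst x, p) * h n w $$ (p, snd x)) = (w * h n w) $$ x" if "w \<in> RD0 R n" for w
      unfolding ij(1) fst_conv snd_conv
      by (rule mult_mat_index[OF RD0_carrier[OF that] A1_carrier[OF h that] ij(2,3), symmetric])
  qed
  moreover have "dir_sum \<omega> \<omega>' * h (m + n) (dir_sum \<omega> \<omega>') = dir_sum (\<omega> * h m \<omega>) (\<omega>' * h n \<omega>')"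
    if "\<omega> \<in> RD0 R m" "\<omega>' \<in> RD0 R n" for m n \<omega> \<omega>'
    unfolding A1_dir_sum[OF h that]
    by (rule dir_sum_mult[OF RD0_carrier[OF that(1)] RD0_carrier[OF that(2)]
          A1_carrier[OF h that(1)] A1_carrier[OF h that(2)]])
  moreover have "\<omega>' * h n \<omega>' = s * (\<omega> * h n \<omega>) * t"
    if \<omega>: "\<omega> \<in> RD0 R n" and \<omega>': "\<omega>' \<in> RD0 R n" and st: "similar_mat_wit \<omega>' \<omega> s t" for n \<omega> \<omega>' s t
  proof -
    note D = similar_mat_witD2[OF RD0_carrier[OF \<omega>'] st]
    have c: "\<omega> \<in> carrier_mat n n" "s \<in> carrier_mat n n" "t \<in> carrier_mat n n" "h n \<omega> \<in> carrier_mat n n"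
      using D A1_carrier[OF h \<omega>] by blast+
    have ts: "t * s = 1\<^sub>m n" and w': "\<omega>' = s * \<omega> * t" using D by blast+
    have "\<omega>' * h n \<omega>' = (s * \<omega> * t) * (s * h n \<omega> * t)"
      using A1_similar[OF h \<omega> \<omega>' st] w' by simp
    also have "\<dots> = s * (\<omega> * ((t * s) * (h n \<omega> * t)))"
      using c by (simp add: assoc_mult_mat[of _ n n _ n _ n])
    also have "\<dots> = s * (\<omega> * h n \<omega>) * t"
      unfolding ts using c by (simp add: assoc_mult_mat[of _ n n _ n _ n])
    finally show ?thesis .
  qed
  ultimately show ?thesis unfolding A1_def by blast
qed

section \<open>Rearrangements\<close>

lemma has_sum_antidiagonal:
  fixes F :: "nat \<times> nat \<Rightarrow> complex"
  assumes "(F has_sum S) UNIV"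
  shows "((\<lambda>n. \<Sum>i\<le>n. F (i, n - i)) has_sum S) UNIV"
proof -
  have bij: "bij_betw (\<lambda>(n, i). (i, n - i)) (SIGMA n : UNIV. {..n :: nat}) UNIV"
    by (rule bij_betwI[where g = "\<lambda>(i, j). (i + j, i)"]) auto
  have "((\<lambda>p. F (case p of (n, i) \<Rightarrow> (i, n - i))) has_sum S) (SIGMA n : UNIV. {..n :: nat})"
    using assms has_sum_reindex_bij_betw[OF bij, of F S] by simp
  then show ?thesis
    by (rule has_sum_Sigma') (auto intro: has_sum_finiteI)
qed

lemma has_sum_Suc:
  fixes F :: "nat \<Rightarrow> complex"
  assumes "F 0 = 0"
  shows "(F has_sum S) UNIV \<longleftrightarrow> ((\<lambda>k. F (Suc k)) has_sum S) UNIV"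
proof -
  have "(F has_sum S) UNIV \<longleftrightarrow> (F has_sum S) (range Suc)"
  proof (rule has_sum_cong_neutral)
    show "F k = 0" if "k \<in> UNIV - range Suc" for k
      using that assms by (cases k) auto
  qed auto
  also have "\<dots> \<longleftrightarrow> ((\<lambda>k. F (Suc k)) has_sum S) UNIV"
    using has_sum_reindex[of Suc UNIV F S] by (simp add: o_def)
  finally show ?thesis .
qed

text \<open>Coassociativity of \<open>\<partial>\<close> on monomials, in the form in which it is summed.\<close>

lemma del_pow_coassoc:
  "(\<Sum>k\<le>n. del_pow k \<omega> \<omega>' x y * (\<omega>'' ^\<^sub>m (n - k)) $$ z) =
   (\<Sum>k\<le>n. (\<omega> ^\<^sub>m k) $$ x * del_pow (n - k) \<omega>' \<omega>'' y z)"
proof (cases n)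
  case 0
  then show ?thesis by (simp add: del_pow_def)
next
  case (Suc N)
  let ?u = "\<lambda>i. (\<omega> ^\<^sub>m i) $$ x" and ?v = "\<lambda>i. (\<omega>' ^\<^sub>m i) $$ y" and ?w = "\<lambda>i. (\<omega>'' ^\<^sub>m i) $$ z"
  have "(\<Sum>k\<le>n. del_pow k \<omega> \<omega>' x y * ?w (n - k)) = (\<Sum>k\<le>N. del_pow (Suc k) \<omega> \<omega>' x y * ?w (N - k))"
    unfolding Suc sum.atMost_Suc_shift by (simp add: del_pow_def)
  also have "\<dots> = (\<Sum>k=0..N. \<Sum>i=0..k. ?u i * ?v (k - i) * ?w (N - k))"
    unfolding del_pow_Suc by (simp only: sum_distrib_right atLeast0AtMost)
  also have "\<dots> = (\<Sum>k=0..N. \<Sum>i=0..N - k. ?u k * ?v i * ?w (N - k - i))"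
    by (rule fps_mult_assoc_lemma[of "\<lambda>i j l. ?u i * ?v j * ?w l" N N])
  also have "\<dots> = (\<Sum>k\<le>N. ?u k * del_pow (Suc (N - k)) \<omega>' \<omega>'' y z)"
    unfolding del_pow_Suc by (simp only: sum_distrib_left atLeast0AtMost mult.assoc)
  also have "\<dots> = (\<Sum>k\<le>N. ?u k * del_pow (n - k) \<omega>' \<omega>'' y z)"
    unfolding Suc by (intro sum.cong) (auto simp: Suc_diff_le)
  also have "\<dots> = (\<Sum>k\<le>n. ?u k * del_pow (n - k) \<omega>' \<omega>'' y z)"
    unfolding Suc by (simp add: del_pow_def)
  finally show ?thesis .
qed

lemma mat1_zero_pow: "(mat1 0 ^\<^sub>m k) $$ (0, 0) = (if k = 0 then 1 else 0)"
  unfolding mat_diag_pow by (simp add: mat_diag_def)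

lemma del_pow_shift_shift:
  "del_pow j (shift R k) (shift R l) (0, k) (0, l) =
    (if j = Suc (k + l) then shift_scale R k ^ k * shift_scale R l ^ l else 0)"
proof -
  have "del_pow j (shift R k) (shift R l) (0, k) (0, l) =
      (\<Sum>i<j. if i = k then (if j = Suc (k + l) then shift_scale R k ^ k * shift_scale R l ^ l else 0) else 0)"
    unfolding del_pow_def shift_pow_corner by (intro sum.cong) auto
  then show ?thesis by simp
qed

lemma del_pow_shift_zero:
  "del_pow j (shift R k) (mat1 0) (0, k) (0, 0) = (if j = Suc k then shift_scale R k ^ k else 0)"
proof -
  have "del_pow j (shift R k) (mat1 0) (0, k) (0, 0) =
      (\<Sum>i<j. if i = k then (if j = Suc k then shift_scale R k ^ k else 0) else 0)"
    unfolding del_pow_def shift_pow_corner mat1_zero_pow by (intro sum.cong) auto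
  then show ?thesis by simp
qed

lemma del_pow_zero_shift:
  "del_pow j (mat1 0) (shift R l) (0, 0) (0, l) = (if j = Suc l then shift_scale R l ^ l else 0)"
proof -
  have "del_pow j (mat1 0) (shift R l) (0, 0) (0, l) =
      (\<Sum>i<j. if i = 0 then (if j = Suc l then shift_scale R l ^ l else 0) else 0)"
    unfolding del_pow_def shift_pow_corner mat1_zero_pow by (intro sum.cong) auto
  then show ?thesis by simp
qed

section \<open>The conditions in terms of coefficients\<close>

text \<open>The coefficient \<open>a k l\<close> depends only on \<open>k + l\<close>.\<close>

definition hankel :: "(nat \<Rightarrow> nat \<Rightarrow> complex) \<Rightarrow> bool" where
  "hankel a \<longleftrightarrow> (\<forall>k l. a (Suc k) l = a k (Suc l))"

lemma hankelD: "hankel a \<Longrightarrow> a k l = a (k + l) 0"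
proof (induction l arbitrary: k)
  case (Suc l)
  have "a k (Suc l) = a (Suc k) l"
    by (simp only: Suc.prems[unfolded hankel_def, rule_format])
  also have "\<dots> = a (Suc k + l) 0" by (rule Suc.IH[OF Suc.prems])
  finally show ?case by (simp only: add_Suc add_Suc_right)
qed simp

lemma hankel_antidiagonal: "hankel a \<Longrightarrow> i \<le> n \<Longrightarrow> a i (n - i) = a n 0"
  using hankelD[of a i "n - i"] by simp

text \<open>At the point \<open>(S\<^sub>k, 0, S\<^sub>l)\<close>, where \<open>S\<^sub>k\<close> is the shift of size \<open>k + 1\<close>, the corner entries of
  the two sides are \<open>a (k + 1) l\<close> and \<open>a k (l + 1)\<close> up to a common nonzero factor. Conversely, if
  \<open>a\<close> depends on the total degree only, the terms of each degree agree by coassociativity on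
  monomials.\<close>

lemma coassoc_iff_hankel:
  assumes R: "R > 0" and f: "f \<in> A2 (RD0 R)" and ser: "series2 R a f"
  shows "eq3 (RD0 R) (del_id (RD0 R) f) (id_del (RD0 R) f) \<longleftrightarrow> hankel a"
proof
  assume eq: "eq3 (RD0 R) (del_id (RD0 R) f) (id_del (RD0 R) f)"
  show "hankel a" unfolding hankel_def
  proof (intro allI)
    fix k l
    let ?s = "shift_scale R k ^ k * shift_scale R l ^ l"
    have m0: "mat1 0 \<in> RD0 R 1" using R by (simp add: mat1_in_RD0 del: One_nat_def)
    have i0: "(0, 0) \<in> idx 1" by (simp add: idx_def)
    note k = shift_in_RD0[OF R, of k] and l = shift_in_RD0[OF R, of l]
    let ?L = "del_id (RD0 R) f (Suc k) 1 (Suc l) (shift R k) (mat1 0) (shift R l) (0, k) (0, 0) (0, l)"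
    let ?R = "id_del (RD0 R) f (Suc k) 1 (Suc l) (shift R k) (mat1 0) (shift R l) (0, k) (0, 0) (0, l)"
    have "((\<lambda>(i, j). a i j * (del_pow i (shift R k) (mat1 0) (0, k) (0, 0) * (shift R l ^\<^sub>m j) $$ (0, l)))
        has_sum a (Suc k) l * ?s) UNIV"
      unfolding del_pow_shift_zero shift_pow_corner
      by (rule has_sum_finite_neutralI[of "{(Suc k, l)}"]) (auto split: if_splits)
    then have L: "?L = a (Suc k) l * ?s"
      by (rule has_sum_unique[OF del_id_series[OF ser f k m0 l corner_idx i0 corner_idx]])
    have "((\<lambda>(i, j). a i j * ((shift R k ^\<^sub>m i) $$ (0, k) * del_pow j (mat1 0) (shift R l) (0, 0) (0, l)))
        has_sum a k (Suc l) * ?s) UNIV"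
      unfolding del_pow_zero_shift shift_pow_corner
      by (rule has_sum_finite_neutralI[of "{(k, Suc l)}"]) (auto split: if_splits)
    then have R': "?R = a k (Suc l) * ?s"
      by (rule has_sum_unique[OF id_del_series[OF ser f k m0 l corner_idx i0 corner_idx]])
    have "?L = ?R" using eq k m0 l unfolding eq3_def by simp
    then show "a (Suc k) l = a k (Suc l)"
      unfolding L R' using shift_scale_nz[OF R, of k] shift_scale_nz[OF R, of l] by simp
  qed
next
  assume a: "hankel a"
  show "eq3 (RD0 R) (del_id (RD0 R) f) (id_del (RD0 R) f)"
    unfolding eq3_def
  proof (intro allI ballI ext)
    fix m n l \<omega> \<omega>' \<omega>'' x y z
    assume \<omega>: "\<omega> \<in> RD0 R m" and \<omega>': "\<omega>' \<in> RD0 R n" and \<omega>'': "\<omega>'' \<in> RD0 R l"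
    show "del_id (RD0 R) f m n l \<omega> \<omega>' \<omega>'' x y z = id_del (RD0 R) f m n l \<omega> \<omega>' \<omega>'' x y z"
    proof (cases "x \<in> idx m \<and> y \<in> idx n \<and> z \<in> idx l")
      case True
      then have xyz: "x \<in> idx m" "y \<in> idx n" "z \<in> idx l" by auto
      have "((\<lambda>N. a N 0 * (\<Sum>i\<le>N. del_pow i \<omega> \<omega>' x y * (\<omega>'' ^\<^sub>m (N - i)) $$ z))
          has_sum del_id (RD0 R) f m n l \<omega> \<omega>' \<omega>'' x y z) UNIV"
        using has_sum_antidiagonal[OF del_id_series[OF ser f \<omega> \<omega>' \<omega>'' xyz]]
        by (simp add: hankel_antidiagonal[OF a] sum_distrib_left)
      moreover have "((\<lambda>N. a N 0 * (\<Sum>i\<le>N. (\<omega> ^\<^sub>m i) $$ x * del_pow (N - i) \<omega>' \<omega>'' y z))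
          has_sum id_del (RD0 R) f m n l \<omega> \<omega>' \<omega>'' x y z) UNIV"
        using has_sum_antidiagonal[OF id_del_series[OF ser f \<omega> \<omega>' \<omega>'' xyz]]
        by (simp add: hankel_antidiagonal[OF a] sum_distrib_left)
      ultimately show ?thesis unfolding del_pow_coassoc by (rule has_sum_unique)
    next
      case False
      then show ?thesis by (auto simp: del_id_def id_del_def mk3_def)
    qed
  qed
qed

lemma del_outside: "x \<notin> idx m \<or> y \<notin> idx n \<Longrightarrow> del \<Omega> h m n \<omega> \<omega>' x y = 0"
  by (auto simp: del_def mk2_def)

text \<open>The case of a vanishing constant term, with coefficients indexed by the degree of the
  derivative.\<close>

lemma del_series_Suc:
  assumes ser: "series1 R (case_nat 0 c) h" and "\<omega> \<in> RD0 R m" "\<omega>' \<in> RD0 R n" "x \<in> idx m" "y \<in> idx n"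
  shows "((\<lambda>k. c k * (\<Sum>i\<le>k. (\<omega> ^\<^sub>m i) $$ x * (\<omega>' ^\<^sub>m (k - i)) $$ y)) has_sum del (RD0 R) h m n \<omega> \<omega>' x y) UNIV"
  using iffD1[OF has_sum_Suc del_series[OF assms]] by (simp add: del_pow_Suc)

lemma del_at_shifts:
  assumes R: "R > 0" and ser: "series1 R c h"
  shows "del (RD0 R) h (Suc k) (Suc l) (shift R k) (shift R l) (0, k) (0, l)
    = c (Suc (k + l)) * (shift_scale R k ^ k * shift_scale R l ^ l)"
proof -
  have "((\<lambda>j. c j * del_pow j (shift R k) (shift R l) (0, k) (0, l))
      has_sum c (Suc (k + l)) * (shift_scale R k ^ k * shift_scale R l ^ l)) UNIV"
    unfolding del_pow_shift_shift by (rule has_sum_finite_neutralI[of "{Suc (k + l)}"]) auto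
  then show ?thesis
    by (rule has_sum_unique[OF del_series[OF ser shift_in_RD0[OF R] shift_in_RD0[OF R] corner_idx corner_idx]])
qed

lemma del_star_series1:
  assumes ser: "series2 R a f"
  shows "series1 R (case_nat 0 (\<lambda>n. \<Sum>i\<le>n. a i (n - i))) (del_star f)"
  unfolding series1_def
proof (intro allI ballI conjI)
  show "del_star f n \<omega> \<in> carrier_mat n n" for n \<omega>
    by (simp add: del_star_def hash_def)
  fix n \<omega> x assume \<omega>: "\<omega> \<in> RD0 R n" and x: "x \<in> idx n"
  have "(\<Sum>i\<le>N. a i (N - i) * (\<omega> ^\<^sub>m (i + (N - i) + 1)) $$ x) = (\<Sum>i\<le>N. a i (N - i)) * (\<omega> ^\<^sub>m Suc N) $$ x" for N
    unfolding sum_distrib_right by (intro sum.cong) auto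
  then have "((\<lambda>N. (\<Sum>i\<le>N. a i (N - i)) * (\<omega> ^\<^sub>m Suc N) $$ x) has_sum del_star f n \<omega> $$ x) UNIV"
    using has_sum_antidiagonal[OF del_star_series[OF ser \<omega> x]] by (simp del: pow_mat.simps)
  then show "((\<lambda>k. (case k of 0 \<Rightarrow> 0 | Suc n \<Rightarrow> \<Sum>i\<le>n. a i (n - i)) * (\<omega> ^\<^sub>m k) $$ x) has_sum del_star f n \<omega> $$ x) UNIV"
    by (subst has_sum_Suc) (simp_all del: pow_mat.simps)
qed

lemma tens2_outside: "T \<in> tens2 m n \<Longrightarrow> x \<notin> idx m \<or> y \<notin> idx n \<Longrightarrow> T x y = 0"
  unfolding tens2_def by blast

lemma N2_outside:
  assumes "f m n \<omega> \<omega>' \<in> tens2 m n" and "x \<notin> idx m \<or> y \<notin> idx n"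
  shows "N2 \<Omega> f m n \<omega> \<omega>' x y = 0"
  using tens2_outside[OF assms] assms(2)
  by (auto simp: N2_def N_id_def id_N_def del_star_id_def id_del_star_def hash12_def hash23_def mk2_def)

text \<open>Comparing coefficients, the equation says that \<open>(k + l + 1) a k l\<close> is the sum of the coefficients
  of total degree \<open>k + l\<close>, hence depends on \<open>k + l\<close> only.\<close>

lemma number_operator_iff_hankel:
  assumes R: "R > 0" and f: "f \<in> A2 (RD0 R)" and ser: "series2 R a f"
  shows "eq2 (RD0 R) (del (RD0 R) (del_star f)) (N2 (RD0 R) f) \<longleftrightarrow> hankel a"
proof
  assume eq: "eq2 (RD0 R) (del (RD0 R) (del_star f)) (N2 (RD0 R) f)"
  have coeff: "(\<Sum>i\<le>k + l. a i (k + l - i)) = of_nat (k + l + 1) * a k l" for k l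
  proof -
    let ?s = "shift_scale R k ^ k * shift_scale R l ^ l"
    note k = shift_in_RD0[OF R, of k] and l = shift_in_RD0[OF R, of l]
    have N: "N2 (RD0 R) f (Suc k) (Suc l) (shift R k) (shift R l) (0, k) (0, l) = of_nat (k + l + 1) * a k l * ?s"
      by (rule shift_has_sum2[of "\<lambda>k l. of_nat (k + l + 1) * a k l"])
        (rule N2_series[OF ser f k l corner_idx corner_idx])
    have D: "del (RD0 R) (del_star f) (Suc k) (Suc l) (shift R k) (shift R l) (0, k) (0, l)
        = (\<Sum>i\<le>k + l. a i (k + l - i)) * ?s"
      using del_at_shifts[OF R del_star_series1[OF ser]] by simp
    have "del (RD0 R) (del_star f) (Suc k) (Suc l) (shift R k) (shift R l)
        = N2 (RD0 R) f (Suc k) (Suc l) (shift R k) (shift R l)"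
      using eq k l unfolding eq2_def by blast
    then have "(\<Sum>i\<le>k + l. a i (k + l - i)) * ?s = of_nat (k + l + 1) * a k l * ?s"
      using N D by (simp only:)
    then show ?thesis
      using shift_scale_nz[OF R, of k] shift_scale_nz[OF R, of l] unfolding mult_cancel_right by simp
  qed
  show "hankel a" unfolding hankel_def
  proof (intro allI)
    fix k l
    have "of_nat (k + l + 2) * a (Suc k) l = of_nat (k + l + 2) * a k (Suc l)"
      using coeff[of "Suc k" l] coeff[of k "Suc l"] by simp
    then show "a (Suc k) l = a k (Suc l)"
      unfolding mult_cancel_left of_nat_eq_0_iff by simp
  qed
next
  assume a: "hankel a"
  show "eq2 (RD0 R) (del (RD0 R) (del_star f)) (N2 (RD0 R) f)"
    unfolding eq2_def
  proof (intro allI ballI ext)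
    fix m n \<omega> \<omega>' x y
    assume \<omega>: "\<omega> \<in> RD0 R m" and \<omega>': "\<omega>' \<in> RD0 R n"
    show "del (RD0 R) (del_star f) m n \<omega> \<omega>' x y = N2 (RD0 R) f m n \<omega> \<omega>' x y"
    proof (cases "x \<in> idx m \<and> y \<in> idx n")
      case True
      then have xy: "x \<in> idx m" "y \<in> idx n" by auto
      have diag: "(\<Sum>i\<le>k. a i (k - i)) = of_nat (k + 1) * a k 0" for k
        by (simp add: hankel_antidiagonal[OF a])
      have "((\<lambda>k. of_nat (k + 1) * a k 0 * (\<Sum>i\<le>k. (\<omega> ^\<^sub>m i) $$ x * (\<omega>' ^\<^sub>m (k - i)) $$ y))
          has_sum del (RD0 R) (del_star f) m n \<omega> \<omega>' x y) UNIV"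
        using del_series_Suc[OF del_star_series1[OF ser] \<omega> \<omega>' xy] unfolding diag .
      moreover have "(\<Sum>i\<le>k. of_nat (i + (k - i) + 1) * a i (k - i) * ((\<omega> ^\<^sub>m i) $$ x * (\<omega>' ^\<^sub>m (k - i)) $$ y))
          = of_nat (k + 1) * a k 0 * (\<Sum>i\<le>k. (\<omega> ^\<^sub>m i) $$ x * (\<omega>' ^\<^sub>m (k - i)) $$ y)" for k
        unfolding sum_distrib_left by (intro sum.cong) (auto simp: hankel_antidiagonal[OF a])
      then have "((\<lambda>k. of_nat (k + 1) * a k 0 * (\<Sum>i\<le>k. (\<omega> ^\<^sub>m i) $$ x * (\<omega>' ^\<^sub>m (k - i)) $$ y))
          has_sum N2 (RD0 R) f m n \<omega> \<omega>' x y) UNIV"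
        using has_sum_antidiagonal[OF N2_series[OF ser f \<omega> \<omega>' xy]] unfolding prod.case by simp
      ultimately show ?thesis by (rule has_sum_unique)
    next
      case False
      then have out: "x \<notin> idx m \<or> y \<notin> idx n" by blast
      show ?thesis unfolding del_outside[OF out] N2_outside[of f m n \<omega> \<omega>', OF A2_tens[OF f \<omega> \<omega>'] out] ..
    qed
  qed
qed

lemma series1_z_mult:
  assumes h: "h \<in> A1 (RD0 R)" and ser: "series1 R c h"
  shows "series1 R (case_nat 0 c) (\<lambda>n \<omega>. \<omega> * h n \<omega>)"
  unfolding series1_def
proof (intro allI ballI conjI)
  show "\<omega> * h n \<omega> \<in> carrier_mat n n" if "\<omega> \<in> RD0 R n" for n \<omega>
    by (rule mult_carrier_mat[OF RD0_carrier[OF that] A1_carrier[OF h that]])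
  fix n \<omega> x assume \<omega>: "\<omega> \<in> RD0 R n" and x: "x \<in> idx n"
  note \<omega>c = RD0_carrier[OF \<omega>]
  obtain i j where ij: "x = (i, j)" "i < n" "j < n" using x by (cases x) (auto simp: idx_def)
  have "((\<lambda>k. \<Sum>p<n. \<omega> $$ (i, p) * (c k * (\<omega> ^\<^sub>m k) $$ (p, j))) has_sum (\<Sum>p<n. \<omega> $$ (i, p) * h n \<omega> $$ (p, j))) UNIV"
    using ij by (intro has_sum_sum_finite has_sum_cmult_right series1D[OF ser \<omega>]) (auto simp: idx_def)
  moreover have "(\<Sum>p<n. \<omega> $$ (i, p) * (c k * (\<omega> ^\<^sub>m k) $$ (p, j))) = c k * (\<omega> ^\<^sub>m Suc k) $$ (i, j)" for k
  proof -
    have "\<omega> ^\<^sub>m Suc k = \<omega> * \<omega> ^\<^sub>m k" using pow_mat_add[OF \<omega>c, of 1 k] \<omega>c by simp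
    then show ?thesis
      using mult_mat_index[OF \<omega>c pow_carrier_mat[OF \<omega>c] ij(2,3), of k]
      by (simp add: sum_distrib_left mult.left_commute del: pow_mat.simps)
  qed
  ultimately have "((\<lambda>k. c k * (\<omega> ^\<^sub>m Suc k) $$ x) has_sum (\<omega> * h n \<omega>) $$ x) UNIV"
    unfolding ij(1) mult_mat_index[OF \<omega>c A1_carrier[OF h \<omega>] ij(2,3)] by (simp del: pow_mat.simps)
  then show "((\<lambda>k. case_nat 0 c k * (\<omega> ^\<^sub>m k) $$ x) has_sum (\<omega> * h n \<omega>) $$ x) UNIV"
    by (subst has_sum_Suc) (simp_all del: pow_mat.simps)
qed

lemma series1_leg_at_zero:
  assumes R: "R > 0" and ser: "series2 R a f"
  shows "series1 R (\<lambda>k. a k 0) (\<lambda>m \<omega>. leg1 m (f m 1 \<omega> (mat1 0)) (0, 0))"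
  unfolding series1_def
proof (intro allI ballI conjI)
  show "leg1 m (f m 1 \<omega> (mat1 0)) (0, 0) \<in> carrier_mat m m" for m \<omega>
    by (simp add: leg1_def)
  fix m \<omega> x assume \<omega>: "\<omega> \<in> RD0 R m" and x: "x \<in> idx m"
  have m0: "mat1 0 \<in> RD0 R 1" using R by (simp add: mat1_in_RD0 del: One_nat_def)
  have i0: "(0, 0) \<in> idx 1" by (simp add: idx_def)
  let ?F = "\<lambda>(k, l). a k l * ((\<omega> ^\<^sub>m k) $$ x * (mat1 0 ^\<^sub>m l) $$ (0, 0))"
  have "(?F has_sum f m 1 \<omega> (mat1 0) x (0, 0)) UNIV" by (rule series2D[OF ser \<omega> m0 x i0])
  also have "(?F has_sum f m 1 \<omega> (mat1 0) x (0, 0)) UNIV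
      \<longleftrightarrow> (?F has_sum f m 1 \<omega> (mat1 0) x (0, 0)) (range (\<lambda>k. (k, 0)))"
    by (rule has_sum_cong_neutral) (auto simp: mat1_zero_pow simp del: One_nat_def)
  also have "\<dots> \<longleftrightarrow> ((\<lambda>k. a k 0 * (\<omega> ^\<^sub>m k) $$ x) has_sum f m 1 \<omega> (mat1 0) x (0, 0)) UNIV"
    by (subst has_sum_reindex) (auto simp: inj_on_def o_def mat1_zero_pow simp del: One_nat_def)
  finally show "((\<lambda>k. a k 0 * (\<omega> ^\<^sub>m k) $$ x) has_sum leg1 m (f m 1 \<omega> (mat1 0)) (0, 0) $$ x) UNIV"
    unfolding leg1_index[OF x] .
qed

text \<open>If \<open>a k l\<close> depends on \<open>k + l\<close> only, then \<open>f\<close> is the difference quotient of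
  \<open>g(\<omega>) = \<omega> f(\<omega>; 0)\<close>.\<close>

lemma range_del_iff_hankel:
  assumes R: "R > 0" and f: "f \<in> A2 (RD0 R)" and ser: "series2 R a f"
  shows "(\<exists>g \<in> A1 (RD0 R). eq2 (RD0 R) (del (RD0 R) g) f) \<longleftrightarrow> hankel a"
proof
  assume "\<exists>g \<in> A1 (RD0 R). eq2 (RD0 R) (del (RD0 R) g) f"
  then obtain g where g: "g \<in> A1 (RD0 R)" and eq: "eq2 (RD0 R) (del (RD0 R) g) f" by blast
  obtain c where c: "series1 R c g" by (rule A1_power_series[OF g])
  have "a k l = c (Suc (k + l))" for k l
  proof -
    let ?s = "shift_scale R k ^ k * shift_scale R l ^ l"
    note k = shift_in_RD0[OF R, of k] and l = shift_in_RD0[OF R, of l]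
    have "f (Suc k) (Suc l) (shift R k) (shift R l) (0, k) (0, l) = a k l * ?s"
      by (rule shift_has_sum2[of a]) (rule series2D[OF ser k l corner_idx corner_idx])
    moreover have "del (RD0 R) g (Suc k) (Suc l) (shift R k) (shift R l) (0, k) (0, l) = c (Suc (k + l)) * ?s"
      by (rule del_at_shifts[OF R c])
    moreover have "del (RD0 R) g (Suc k) (Suc l) (shift R k) (shift R l) = f (Suc k) (Suc l) (shift R k) (shift R l)"
      using eq k l unfolding eq2_def by blast
    ultimately have "a k l * ?s = c (Suc (k + l)) * ?s" by simp
    then show ?thesis using shift_scale_nz[OF R, of k] shift_scale_nz[OF R, of l] by simp
  qed
  then show "hankel a" by (simp add: hankel_def)
next
  assume a: "hankel a"
  have m0: "mat1 0 \<in> RD0 R 1" using R by (simp add: mat1_in_RD0 del: One_nat_def)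
  have i0: "(0, 0) \<in> idx 1" by (simp add: idx_def)
  define g where "g = (\<lambda>n \<omega>. \<omega> * leg1 n (f n 1 \<omega> (mat1 0)) (0, 0))"
  have g: "g \<in> A1 (RD0 R)" unfolding g_def by (rule A1_z_mult[OF leg1_in_A1[OF f m0 i0]])
  have c: "series1 R (case_nat 0 (\<lambda>k. a k 0)) g"
    unfolding g_def by (rule series1_z_mult[OF leg1_in_A1[OF f m0 i0] series1_leg_at_zero[OF R ser]])
  have "eq2 (RD0 R) (del (RD0 R) g) f"
    unfolding eq2_def
  proof (intro allI ballI ext)
    fix m n \<omega> \<omega>' x y
    assume \<omega>: "\<omega> \<in> RD0 R m" and \<omega>': "\<omega>' \<in> RD0 R n"
    show "del (RD0 R) g m n \<omega> \<omega>' x y = f m n \<omega> \<omega>' x y"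
    proof (cases "x \<in> idx m \<and> y \<in> idx n")
      case True
      then have xy: "x \<in> idx m" "y \<in> idx n" by auto
      have "((\<lambda>k. a k 0 * (\<Sum>i\<le>k. (\<omega> ^\<^sub>m i) $$ x * (\<omega>' ^\<^sub>m (k - i)) $$ y))
          has_sum f m n \<omega> \<omega>' x y) UNIV"
        using has_sum_antidiagonal[OF series2D[OF ser \<omega> \<omega>' xy]]
        by (simp add: hankel_antidiagonal[OF a] sum_distrib_left)
      with del_series_Suc[OF c \<omega> \<omega>' xy] show ?thesis by (rule has_sum_unique)
    next
      case False
      then have out: "x \<notin> idx m \<or> y \<notin> idx n" by blast
      show ?thesis unfolding del_outside[OF out] tens2_outside[OF A2_tens[OF f \<omega> \<omega>'] out] ..
    qed
  qed
  then show "\<exists>g \<in> A1 (RD0 R). eq2 (RD0 R) (del (RD0 R) g) f" using g by blast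
qed

theorem theorem7p9:
  fixes R :: real and f :: fam2
  assumes "R > 0"
    and "f \<in> A2 (RD0 R)"
  shows "((\<exists>g \<in> A1 (RD0 R). eq2 (RD0 R) (del (RD0 R) g) f)
            \<longleftrightarrow> eq3 (RD0 R) (del_id (RD0 R) f) (id_del (RD0 R) f))
       \<and> (eq3 (RD0 R) (del_id (RD0 R) f) (id_del (RD0 R) f)
            \<longleftrightarrow> eq2 (RD0 R) (del (RD0 R) (del_star f)) (N2 (RD0 R) f))"
proof -
  obtain a where a: "series2 R a f" by (rule A2_power_series[OF assms])
  show ?thesis
    using range_del_iff_hankel[OF assms a] coassoc_iff_hankel[OF assms a]
      number_operator_iff_hankel[OF assms a] by blast
qed

end
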